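(* Let $d\ge 1$ and $t\ge 0$ be integers and let $f(n)=dn+t$. For any $1\le B<\infty$, let $$E_B=\left\{x\in[0,1): a_{f(n)}(x)\,a_{2f(n)}(x)\cdots a_{nf(n)}(x)\ge B^{dn^2}\ \text{for infinitely many } n\in\mathbb{N}\right\}.$$ Then $$\dim_{\mathcal H}E_B=\inf\left\{s\ge 0:\mathsf{P}\left(-s\log|T'|-(2s-1)\log B\right)\le 0\right\},$$ where $\dim_{\mathcal H}$ denotes Hausdorff dimension.
   Context: $T:[0,1)\to[0,1)$ is the Gauss map: $T(0)=0$ and $T(x)=\frac1x-\lfloor\frac1x\rfloor$ for $x\in(0,1)$; $T'$ is its derivative, so $|T'(x)|=x^{-2}$. For irrational $x\in(0,1)$ the continued fraction expansion is $x=[a_1(x),a_2(x),\ldots]$ with partial quotients $a_1(x)=\lfloor 1/x\rfloor$ and $a_n(x)=a_1(T^{n-1}(x))$ for $n\ge 2$. (Rational $x$ form a countable set and do not affect the dimension.) Pressure function: for a real function $\phi$ on $[0,1)$, $$\mathsf{P}(\phi)=\mathsf{P}(T,\phi)=\lim_{n\to\infty}\frac1n\log\sum_{(a_1,\ldots,a_n)\in\mathbb{N}^n}\ \sup_{x\in X} e^{S_n\phi([a_1,\ldots,a_n+x])},$$ where $\mathbb{N}=\{1,2,\ldots\}$ in the sum, $X$ is the set of $x\in[0,1)$ with $a_n(x)\in\mathbb{N}$ for all $n\ge1$, $[a_1,\ldots,a_n+x]$ is the finite continued fraction $\cfrac{1}{a_1+\cfrac{1}{\ddots+\cfrac{1}{a_n+x}}}$,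 and $S_n\phi(y)=\phi(y)+\phi(Ty)+\cdots+\phi(T^{n-1}y)$. The value $+\infty$ is allowed for $\mathsf P$. *)

theory Defs
  imports "HOL-Analysis.Analysis"
begin

section \<open>Hausdorff measure and dimension\<close>

text \<open>The \<open>s\<close>-th power of the diameter, with the usual conventions for \<open>s = 0\<close>: the empty set
  contributes 0 and every nonempty set (in particular a singleton) contributes 1. The case
  distinction is needed because \<open>0 powr 0 = 0\<close>.\<close>

definition diameter_pow :: "real \<Rightarrow> 'a::metric_space set \<Rightarrow> ennreal" where
  "diameter_pow s U =
     (if U = {} then 0 else if s = 0 then 1 else ennreal (diameter U powr s))"

text \<open>Boundedness is required separately because \<^const>\<open>diameter\<close> is real-valued and unspecified
  on unbounded sets. Finite covers are included, by padding with empty sets.\<close>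

definition hausdorff_premeasure :: "real \<Rightarrow> real \<Rightarrow> 'a::metric_space set \<Rightarrow> ennreal" where
  "hausdorff_premeasure \<delta> s E =
     (INF U \<in> {U :: nat \<Rightarrow> 'a set. E \<subseteq> (\<Union>i. U i) \<and> (\<forall>i. bounded (U i) \<and> diameter (U i) \<le> \<delta>)}.
        \<Sum>i. diameter_pow s (U i))"

definition hausdorff_measure :: "real \<Rightarrow> 'a::metric_space set \<Rightarrow> ennreal" where
  "hausdorff_measure s E = (SUP \<delta> \<in> {0<..}. hausdorff_premeasure \<delta> s E)"

definition hausdorff_dim :: "'a::metric_space set \<Rightarrow> ereal" where
  "hausdorff_dim E = (INF s \<in> {s. 0 \<le> s \<and> hausdorff_measure s E = 0}. ereal s)"


section \<open>The Gauss map and continued fractions\<close>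

definition gauss_map :: "real \<Rightarrow> real" where
  "gauss_map x = (if x = 0 then 0 else 1 / x - of_int \<lfloor>1 / x\<rfloor>)"

text \<open>Indices start at 1. If the expansion of a rational \<open>x\<close> has terminated before \<open>n\<close>, i.e. if
  the \<open>(n - 1)\<close>-st iterate is 0, then \<open>1 / 0 = 0\<close> makes the value 0, which is not an admissible
  partial quotient.\<close>

definition partial_quotient :: "nat \<Rightarrow> real \<Rightarrow> int" where
  "partial_quotient n x = \<lfloor>1 / (gauss_map ^^ (n - 1)) x\<rfloor>"

definition cf_domain :: "real set" where
  "cf_domain = {x \<in> {0..<1}. \<forall>n\<ge>1. partial_quotient n x \<ge> 1}"

text \<open>\<open>cf_eval [a\<^sub>1, \<dots>, a\<^sub>n] x\<close> is the finite continued fraction \<open>[a\<^sub>1, \<dots>, a\<^sub>n + x]\<close>.\<close>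

fun cf_eval :: "nat list \<Rightarrow> real \<Rightarrow> real" where
  "cf_eval [] x = x"
| "cf_eval (a # as) x = 1 / (real a + cf_eval as x)"


section \<open>The pressure function\<close>

definition birkhoff_sum :: "(real \<Rightarrow> real) \<Rightarrow> nat \<Rightarrow> real \<Rightarrow> real" where
  "birkhoff_sum \<phi> n y = (\<Sum>k<n. \<phi> ((gauss_map ^^ k) y))"

definition ln_ennreal :: "ennreal \<Rightarrow> ereal" where
  "ln_ennreal u =
     (if u = 0 then - \<infinity> else if u = \<infinity> then \<infinity> else ereal (ln (enn2real u)))"

definition pressure_sum :: "(real \<Rightarrow> real) \<Rightarrow> nat \<Rightarrow> ennreal" where
  "pressure_sum \<phi> n =
     (\<Sum>\<^sub>\<infinity>as \<in> {as :: nat list. length as = n \<and> (\<forall>a \<in> set as. 1 \<le> a)}.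
        SUP x \<in> cf_domain. ennreal (exp (birkhoff_sum \<phi> n (cf_eval as x))))"

definition pressure :: "(real \<Rightarrow> real) \<Rightarrow> ereal" where
  "pressure \<phi> = lim (\<lambda>n. ereal (1 / real n) * ln_ennreal (pressure_sum \<phi> n))"


section \<open>Large products of partial quotients along arithmetic progressions\<close>

text \<open>Rational points never belong to this set: for them \<^const>\<open>partial_quotient\<close> is eventually 0,
  and the last factor of the product has index \<open>n * (d * n + t)\<close>.\<close>

definition large_product_set :: "nat \<Rightarrow> nat \<Rightarrow> real \<Rightarrow> real set" where
  "large_product_set d t B =
     {x \<in> {0..<1}. \<exists>\<^sub>\<infinity>n. (\<Prod>i=1..n. real_of_int (partial_quotient (i * (d * n + t)) x))
        \<ge> B ^ (d * n\<^sup>2)}"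

end

theory Submission
  imports Defs "HOL-Probability.Probability" "HOL-Real_Asymp.Real_Asymp" "HOL-Library.Sublist"
begin

text \<open>Write \<open>q(w)\<close> for the denominator of the finite continued fraction of a word \<open>w\<close>, so that the
  cylinder of \<open>w\<close> has length about \<open>q(w)\<^sup>-\<^sup>2\<close>, and let \<open>P(s)\<close> be the pressure of \<open>- s log |T'|\<close>, the growth
  rate of the sums of \<open>q(w)\<^sup>-\<^sup>2\<^sup>s\<close>. The claim is that the dimension is the root of
  \<open>P(s) = (2s - 1) log B\<close>.

  Upper bound: cover by the cylinders of length \<open>n f(n)\<close>. Cutting the words at the \<open>n\<close> prescribed
  positions and using supermultiplicativity of \<open>q\<close>, the constraint that the prescribed digits have
  product at least \<open>B\<close> to the power \<open>d n\<^sup>2\<close> gains the factor \<open>B\<close> to the power \<open>- (2s - 1) d n\<^sup>2\<close>, up to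
  constants to the power \<open>n\<close>, which are negligible against the \<open>d n\<^sup>2\<close> digits.

  Lower bound: if \<open>P(s) > (2s - 1) log B\<close>, build a Cantor set out of words of a fixed length,
  weighted by \<open>q\<^sup>-\<^sup>2\<^sup>s\<close>, and, for a sparse sequence of \<open>n\<close>, put digits of size about \<open>e\<close> to the power
  \<open>b f(n)\<close>, with \<open>b\<close> slightly larger than \<open>log B\<close>, at the prescribed positions except the first \<open>i\<^sub>0\<close>
  ones. A block of \<open>f(n)\<close> digits gains more than a big digit loses, and the \<open>i\<^sub>0\<close> blocks without big
  digits pay for the loss in front of a big digit, where the cylinders to be chosen next cluster
  in a much smaller interval.\<close>


section \<open>Denominators of finite continued fractions\<close>

text \<open>Origin of the exponent \<open>2s - 1\<close>: about A digits have size A and each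
  multiplies the weight \<open>q^(-2s)\<close> by about \<open>A^(-2s)\<close>, so a digit of that
  size costs \<open>A^(-(2s-1))\<close> in all. In the upper bound, spending exactly this exponent
  on the constraint leaves a harmonic series at each prescribed digit. Enlarging s to s' > s makes
  it converge and also yields an exponential gain per digit that absorbs all constants; this covers
  equality in the pressure inequality. The obstacle in the lower bound: just before a digit of size
  A is chosen, the mass of a cylinder sits in a part of relative length about 1/A. This requires a
  reserve \<open>A^s\<close>, although only \<open>A^(2s-1)\<close> is finally lost, and one block
  of \<open>f(n)\<close> digits need not supply it. The excess comes back once the digit is chosen,
  so the reserve is built up only once for each n: more than \<open>s b / \<theta>\<close> blocks do
  it, where \<theta> is the gain per digit. The missing big digits do no harm, because b > log B and
  n is large.\<close>

text \<open>For \<open>w = [a\<^sub>1, \<dots>, a\<^sub>n]\<close> this is \<open>q\<^sub>n + x q\<^sub>n\<^sub>-\<^sub>1\<close>, the square root of the Jacobian of \<open>T\<^sup>n\<close>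
  at \<open>[a\<^sub>1, \<dots>, a\<^sub>n + x]\<close>.\<close>

fun cf_den :: "nat list \<Rightarrow> real \<Rightarrow> real" where
  "cf_den [] x = 1"
| "cf_den (a # w) x = (real a + cf_eval w x) * cf_den w x"

abbreviation cont :: "nat list \<Rightarrow> real" where
  "cont w \<equiv> cf_den w 0"

lemma cf_eval_append: "cf_eval (u @ v) x = cf_eval u (cf_eval v x)"
  by (induction u) auto

lemma cf_den_append: "cf_den (u @ v) x = cf_den u (cf_eval v x) * cf_den v x"
  by (induction u) (auto simp: cf_eval_append)

lemma cf_eval_bounds:
  assumes "\<forall>a\<in>set w. 1 \<le> a" "0 \<le> x" "x \<le> 1"
  shows "0 \<le> cf_eval w x" "cf_eval w x \<le> 1"
proof -
  have "0 \<le> cf_eval w x \<and> cf_eval w x \<le> 1" using assms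
    by (induction w) (auto simp: field_simps intro: add_increasing2)
  then show "0 \<le> cf_eval w x" "cf_eval w x \<le> 1" by auto
qed

lemma cf_eval_strict_bounds:
  assumes "\<forall>a\<in>set w. 1 \<le> a" "0 < x" "x < 1"
  shows "0 < cf_eval w x" "cf_eval w x < 1"
proof -
  have "0 < cf_eval w x \<and> cf_eval w x < 1" using assms
  proof (induction w)
    case (Cons a w)
    then have "1 \<le> real a" "0 < cf_eval w x" by auto
    then have "1 < real a + cf_eval w x" by linarith
    then show ?case by simp
  qed simp
  then show "0 < cf_eval w x" "cf_eval w x < 1" by auto
qed

lemma cf_den_ge_1:
  assumes "\<forall>a\<in>set w. 1 \<le> a" "0 \<le> x" "x \<le> 1"
  shows "1 \<le> cf_den w x"
  using assms
proof (induction w)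
  case (Cons a w)
  then have "1 \<le> real a + cf_eval w x" "1 \<le> cf_den w x"
    using cf_eval_bounds[of w x] by auto
  then show ?case using mult_mono[of 1 "real a + cf_eval w x" 1 "cf_den w x"] by simp
qed simp

lemma cf_den_pos:
  assumes "\<forall>a\<in>set w. 1 \<le> a" "0 \<le> x" "x \<le> 1"
  shows "0 < cf_den w x"
  using cf_den_ge_1[OF assms] by linarith

text \<open>The classical linear recursion of continuants: the factor
  \<open>real b + cf_eval w x\<close> cancels against the denominator of
  \<open>cf_eval (b # w) x\<close>. It strips letters from the front, which is why the inductions
  below descend by two letters.\<close>

lemma cf_den_Cons2:
  assumes "\<forall>a\<in>set (b # w). 1 \<le> a" "0 \<le> x" "x \<le> 1"
  shows "cf_den (a # b # w) x = real a * cf_den (b # w) x + cf_den w x"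
proof -
  have "real b + cf_eval w x \<noteq> 0"
    using assms cf_eval_bounds[of w x] by auto
  then show ?thesis by (simp add: field_simps)
qed

text \<open>All three quantities obey the same linear recursion with nonnegative coefficients, so
  only words of length at most one have to be checked. The factor 1 + x encodes that the last but
  one denominator is at most the last one.\<close>

lemma cf_den_mono_affine:
  assumes "\<forall>a\<in>set w. 1 \<le> a" "0 \<le> x" "x \<le> 1"
  shows "cont w \<le> cf_den w x \<and> cf_den w x \<le> (1 + x) * cont w"
  using assms(1)
proof (induction w rule: induct_list012)
  case (2 a)
  then have "x * 1 \<le> x * real a" using assms by (intro mult_left_mono) auto
  then show ?case using assms by (simp add: algebra_simps)
next
  case (3 a b w)
  have "real a * cont (b # w) \<le> real a * cf_den (b # w) x"
    "real a * cf_den (b # w) x \<le> real a * ((1 + x) * cont (b # w))"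
    using 3 by (auto intro: mult_left_mono)
  moreover have "cont w \<le> cf_den w x" "cf_den w x \<le> (1 + x) * cont w" using 3 by auto
  moreover have "cf_den (a # b # w) x = real a * cf_den (b # w) x + cf_den w x"
    "cont (a # b # w) = real a * cont (b # w) + cont w"
    using 3 assms by (intro cf_den_Cons2; auto)+
  ultimately show ?case by (simp only: algebra_simps) linarith
qed (use assms in simp)

lemma cont_le_cf_den: "\<forall>a\<in>set w. 1 \<le> a \<Longrightarrow> 0 \<le> x \<Longrightarrow> x \<le> 1 \<Longrightarrow> cont w \<le> cf_den w x"
  using cf_den_mono_affine by blast

lemma cf_den_le_2_cont:
  assumes "\<forall>a\<in>set w. 1 \<le> a" "0 \<le> x" "x \<le> 1"
  shows "cf_den w x \<le> 2 * cont w"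
proof -
  have "(1 + x) * cont w \<le> 2 * cont w"
    using assms cf_den_pos[of w 0] by (intro mult_right_mono) auto
  then show ?thesis using cf_den_mono_affine[OF assms] by linarith
qed

lemma cont_pos: "\<forall>a\<in>set w. 1 \<le> a \<Longrightarrow> 0 < cont w"
  using cf_den_pos[of w 0] by simp

text \<open>By the chain rule \<open>cf_den_append\<close>, appending v only moves the point at
  which \<open>cf_den u\<close> is evaluated, and \<open>cf_den u\<close> varies between
  \<open>cont u\<close> and \<open>2 * cont u\<close>.\<close>

lemma cont_append_ge:
  assumes "\<forall>a\<in>set u. 1 \<le> a" "\<forall>a\<in>set v. 1 \<le> a"
  shows "cont u * cont v \<le> cont (u @ v)"
  using assms cont_pos[of v] cf_eval_bounds[of v 0]
  by (auto simp: cf_den_append intro!: mult_right_mono cont_le_cf_den)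

lemma cont_append_le:
  assumes "\<forall>a\<in>set u. 1 \<le> a" "\<forall>a\<in>set v. 1 \<le> a"
  shows "cont (u @ v) \<le> 2 * cont u * cont v"
  using assms cont_pos[of v] cf_eval_bounds[of v 0]
  by (auto simp: cf_den_append intro!: mult_right_mono cf_den_le_2_cont)

text \<open>Two letters at least double the denominator: \<open>cont (a # b # w)\<close> is at least
  \<open>cont (b # w) + cont w\<close>, hence at least \<open>2 * cont w\<close>.\<close>

lemma cont_ge_power2:
  assumes "\<forall>a\<in>set w. 1 \<le> a"
  shows "2 ^ (length w div 2) \<le> cont w"
  using assms
proof (induction w rule: induct_list012)
  case (3 a b w)
  have "1 * cont (b # w) \<le> real a * cont (b # w)"
    using 3 cont_pos[of "b # w"] by (intro mult_right_mono) auto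
  moreover have "cont w \<le> cont (b # w)" using cont_append_ge[of "[b]" w] 3 cont_pos[of w]
    by (auto simp: mult_le_cancel_right1 elim!: order_trans[rotated])
  ultimately have "2 * cont w \<le> cont (a # b # w)"
    using 3 by (subst cf_den_Cons2) auto
  moreover have "2 * 2 ^ (length w div 2) \<le> 2 * cont w" using 3 by simp
  ultimately show ?case by simp
qed auto

text \<open>An equality rather than a mean value estimate, because the branch is a Moebius map of
  the tail; the two denominators are the square roots of the Jacobians at the two points.\<close>

lemma cf_eval_diff:
  assumes "\<forall>a\<in>set w. 1 \<le> a" "0 \<le> x" "x \<le> 1" "0 \<le> y" "y \<le> 1"
  shows "\<bar>cf_eval w x - cf_eval w y\<bar> = \<bar>x - y\<bar> / (cf_den w x * cf_den w y)"
  using assms(1)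
proof (induction w)
  case (Cons a w)
  define X Y where "X = real a + cf_eval w x" and "Y = real a + cf_eval w y"
  have "0 < X" "0 < Y" using Cons.prems assms cf_eval_bounds[of w x] cf_eval_bounds[of w y]
    by (auto simp: X_def Y_def)
  then have "\<bar>1 / X - 1 / Y\<bar> = \<bar>Y - X\<bar> / (X * Y)"
    by (simp add: field_simps)
  also have "\<bar>Y - X\<bar> = \<bar>x - y\<bar> / (cf_den w x * cf_den w y)"
    using Cons by (simp add: X_def Y_def abs_minus_commute)
  finally show ?case using \<open>0 < X\<close> \<open>0 < Y\<close> by (simp add: X_def Y_def field_simps)
qed simp

lemma cf_eval_inj:
  assumes "\<forall>a\<in>set w. 1 \<le> a" "0 \<le> x" "x \<le> 1" "0 \<le> y" "y \<le> 1" "cf_eval w x = cf_eval w y"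
  shows "x = y"
  using cf_eval_diff[OF assms(1-5)] assms cf_den_pos[OF assms(1-3)] cf_den_pos[OF assms(1,4,5)]
  by auto

lemma cf_eval_diff_le:
  assumes "\<forall>a\<in>set w. 1 \<le> a" "0 \<le> x" "x \<le> 1" "0 \<le> y" "y \<le> 1"
  shows "\<bar>cf_eval w x - cf_eval w y\<bar> \<le> 1 / (cont w)\<^sup>2"
proof -
  have "cont w * cont w \<le> cf_den w x * cf_den w y"
    using assms cont_pos[of w] cf_den_pos[of w x] cf_den_pos[of w y]
    by (intro mult_mono cont_le_cf_den) auto
  then show ?thesis using assms cont_pos[of w]
    by (auto simp: cf_eval_diff power2_eq_square intro!: frac_le)
qed

text \<open>Bounded distortion in the form used by \<open>ball_mass\<close>: blowing a cylinder up
  to the unit interval enlarges distances by at most \<open>4 * (cont w)^2\<close>.\<close>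

lemma cf_eval_diff_ge:
  assumes "\<forall>a\<in>set w. 1 \<le> a" "0 \<le> x" "x \<le> 1" "0 \<le> y" "y \<le> 1"
  shows "\<bar>x - y\<bar> / (4 * (cont w)\<^sup>2) \<le> \<bar>cf_eval w x - cf_eval w y\<bar>"
proof -
  have "cf_den w x * cf_den w y \<le> (2 * cont w) * (2 * cont w)"
    using assms cont_pos[of w] cf_den_pos[of w x] cf_den_pos[of w y]
    by (intro mult_mono cf_den_le_2_cont) auto
  then have "\<bar>x - y\<bar> / ((2 * cont w) * (2 * cont w)) \<le> \<bar>x - y\<bar> / (cf_den w x * cf_den w y)"
    using assms cont_pos[of w]  by (intro divide_left_mono) (auto intro!: mult_pos_pos cf_den_pos)
  then show ?thesis using assms by (simp add: cf_eval_diff power2_eq_square)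
qed

lemma continuous_on_cf_eval:
  assumes "\<forall>a\<in>set w. 1 \<le> a"
  shows "continuous_on {0..1} (cf_eval w)"
  using assms
proof (induction w)
  case (Cons a w)
  have "real a + cf_eval w x \<noteq> 0" if "x \<in> {0..1}" for x
    using that Cons.prems cf_eval_bounds[of w x] by auto
  then show ?case using Cons by (auto intro!: continuous_intros)
qed (simp add: continuous_on_id)


section \<open>The Gauss map along an expansion\<close>

lemma gauss_map_0 [simp]: "gauss_map 0 = 0"
  by (simp add: gauss_map_def)

lemma gauss_map_iterate_0 [simp]: "(gauss_map ^^ n) 0 = 0"
  by (induction n) auto

lemma gauss_map_inverse:
  assumes "1 \<le> (a::nat)" "0 \<le> z" "z < 1"
  shows "gauss_map (1 / (real a + z)) = z" "\<lfloor>1 / (1 / (real a + z))\<rfloor> = int a"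
proof -
  show *: "\<lfloor>1 / (1 / (real a + z))\<rfloor> = int a"
    using assms by (auto simp: floor_eq_iff)
  show "gauss_map (1 / (real a + z)) = z" using assms * by (auto simp: gauss_map_def)
qed

text \<open>The endpoints z = 0 and z = 1 are excluded because a tail could then equal 1, which
  \<open>gauss_map\<close> absorbs into the preceding digit.\<close>

lemma gauss_map_iterate_cf_eval:
  assumes "\<forall>a\<in>set w. 1 \<le> a" "0 < z" "z < 1" "k \<le> length w"
  shows "(gauss_map ^^ k) (cf_eval w z) = cf_eval (drop k w) z"
  using assms(1,4)
proof (induction k arbitrary: w)
  case (Suc k)
  then obtain a v where w: "w = a # v" by (cases w) auto
  have "gauss_map (cf_eval w z) = cf_eval v z"
    using w Suc.prems assms cf_eval_strict_bounds[of v z] gauss_map_inverse(1)[of a "cf_eval v z"] by auto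
  then show ?case using Suc w by (simp add: funpow_Suc_right del: funpow.simps)
qed simp

lemma partial_quotient_cf_eval:
  assumes "\<forall>a\<in>set w. 1 \<le> a" "0 < z" "z < 1" "1 \<le> j" "j \<le> length w"
  shows "partial_quotient j (cf_eval w z) = int (w ! (j - 1))"
proof -
  have "drop (j - 1) w = (w ! (j - 1)) # drop j w"
    using assms by (simp add: Cons_nth_drop_Suc[symmetric])
  moreover have "\<forall>a\<in>set (drop j w). 1 \<le> a" using assms by (meson in_set_dropD)
  moreover have "1 \<le> w ! (j - 1)" using assms by (auto simp: all_set_conv_all_nth)
  ultimately show ?thesis
    using assms gauss_map_inverse(2)[of "w ! (j - 1)" "cf_eval (drop j w) z"]
      cf_eval_strict_bounds[of "drop j w" z]
    by (simp add: partial_quotient_def gauss_map_iterate_cf_eval)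
qed

lemma gauss_map_range:
  assumes "0 \<le> x" shows "0 \<le> gauss_map x" "gauss_map x < 1"
  unfolding gauss_map_def by (auto, linarith+)

lemma cf_eval_expansion:
  assumes "0 \<le> x" "x < 1" "\<forall>j<n. (gauss_map ^^ j) x \<noteq> 0"
  defines "w \<equiv> map (\<lambda>j. nat (partial_quotient (Suc j) x)) [0..<n]"
  shows "\<forall>a\<in>set w. 1 \<le> a" "x = cf_eval w ((gauss_map ^^ n) x)"
    "0 \<le> (gauss_map ^^ n) x" "(gauss_map ^^ n) x < 1"
    "\<forall>j<n. 1 \<le> partial_quotient (Suc j) x"
proof -
  have range: "0 \<le> (gauss_map ^^ j) x \<and> (gauss_map ^^ j) x < 1" for j
    using assms gauss_map_range by (induction j) auto
  show "0 \<le> (gauss_map ^^ n) x" "(gauss_map ^^ n) x < 1" using range by auto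
  have pq: "1 \<le> partial_quotient (Suc j) x" if "j < n" for j
  proof -
    have "0 < (gauss_map ^^ j) x" using assms that range[of j] by (metis order_le_less)
    then have "1 \<le> 1 / (gauss_map ^^ j) x" using range[of j] by (simp add: field_simps)
    then show ?thesis by (simp add: partial_quotient_def le_floor_iff)
  qed
  then show "\<forall>j<n. 1 \<le> partial_quotient (Suc j) x" by simp
  show "\<forall>a\<in>set w. 1 \<le> a"
  proof
    fix a assume "a \<in> set w"
    then obtain j where "j < n" "a = nat (partial_quotient (Suc j) x)" by (auto simp: w_def)
    then show "1 \<le> a" using pq[of j] by linarith
  qed
  have step: "(gauss_map ^^ j) x = 1 / (real (nat (partial_quotient (Suc j) x)) + (gauss_map ^^ Suc j) x)"
    if "j < n" for j
  proof -
    have "real (nat (partial_quotient (Suc j) x)) = of_int (partial_quotient (Suc j) x)"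
      using pq[OF that] by simp
    then have "real (nat (partial_quotient (Suc j) x)) = of_int \<lfloor>1 / (gauss_map ^^ j) x\<rfloor>"
      unfolding partial_quotient_def by simp
    then show ?thesis using assms(3) that by (simp add: gauss_map_def)
  qed
  have "x = cf_eval (map (\<lambda>j. nat (partial_quotient (Suc j) x)) [0..<m]) ((gauss_map ^^ m) x)"
    if "m \<le> n" for m
    using that
  proof (induction m)
    case (Suc m)
    have "cf_eval (map (\<lambda>j. nat (partial_quotient (Suc j) x)) [0..<Suc m]) ((gauss_map ^^ Suc m) x)
        = cf_eval (map (\<lambda>j. nat (partial_quotient (Suc j) x)) [0..<m]) ((gauss_map ^^ m) x)"
      unfolding step[OF Suc_le_lessD[OF Suc.prems]]
      by (simp add: cf_eval_append del: funpow.simps)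
    then show ?case using Suc by (simp del: funpow.simps)
  qed simp
  then show "x = cf_eval w ((gauss_map ^^ n) x)" by (simp add: w_def)
qed

lemma gauss_map_deriv:
  assumes "1 \<le> (a::nat)" "0 < z" "z < 1"
  shows "deriv gauss_map (1 / (real a + z)) = - ((real a + z)\<^sup>2)"
proof -
  define y where "y = 1 / (real a + z)"
  have "(gauss_map has_field_derivative - (1 / y\<^sup>2)) (at y)"
  proof (rule has_field_derivative_transform_within_open)
    show "((\<lambda>x. 1 / x - real a) has_field_derivative - (1 / y\<^sup>2)) (at y)"
      using assms by (auto intro!: derivative_eq_intros simp: y_def power2_eq_square)
    show "open {1 / (real a + 1)<..<1 / real a}" by simp
    show "y \<in> {1 / (real a + 1)<..<1 / real a}" using assms by (auto simp: y_def field_simps)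
    fix x assume x: "x \<in> {1 / (real a + 1)<..<1 / real a}"
    have "0 < 1 / (real a + 1)" by simp
    also have "\<dots> < x" using x by simp
    finally have "0 < x" .
    then have "\<lfloor>1 / x\<rfloor> = int a" using x assms by (auto simp: floor_eq_iff field_simps)
    then show "1 / x - real a = gauss_map x" using \<open>0 < x\<close> by (simp add: gauss_map_def)
  qed
  then show ?thesis by (simp add: DERIV_imp_deriv y_def power_divide)
qed

text \<open>Uniqueness of the tails makes the points of the nested cylinders cohere to one orbit.\<close>

lemma coding_exists:
  fixes \<omega> :: "nat \<Rightarrow> nat list"
  assumes "\<And>i. \<omega> i \<noteq> []" "\<And>i. \<forall>a\<in>set (\<omega> i). 1 \<le> a"
  shows "\<exists>y. \<forall>i. 0 < y i \<and> y i < 1 \<and> y i = cf_eval (\<omega> i) (y (Suc i))"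
proof -
  define w where "w n = concat (map \<omega> [0..<n])" for n
  have w1: "\<forall>a\<in>set (w n). 1 \<le> a" for n using assms by (auto simp: w_def)
  have wSuc: "w (Suc n) = w n @ \<omega> n" for n by (simp add: w_def)
  define K where "K n = cf_eval (w n) ` {0..1}" for n
  have "compact (K n)" for n
    unfolding K_def using w1 by (intro compact_continuous_image continuous_on_cf_eval) auto
  moreover have "K n \<noteq> {}" for n by (simp add: K_def)
  moreover have "K (Suc n) \<subseteq> K n" for n
    unfolding K_def wSuc cf_eval_append using assms cf_eval_bounds[of "\<omega> n"] by auto
  then have "K n \<subseteq> K m" if "m \<le> n" for m n using that by (rule lift_Suc_antimono_le)
  ultimately have "\<Inter>(range K) \<noteq> {}" by (intro compact_nest) auto
  then obtain x where x: "\<And>n. x \<in> K n" by auto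
  have "\<exists>z. 0 \<le> z \<and> z \<le> 1 \<and> x = cf_eval (w n) z" for n
    using x[of n] by (auto simp: K_def)
  then obtain y where y: "\<And>n. 0 \<le> y n" "\<And>n. y n \<le> 1" "\<And>n. x = cf_eval (w n) (y n)" by metis
  have rec: "y n = cf_eval (\<omega> n) (y (Suc n))" for n
  proof (rule cf_eval_inj[OF w1])
    show "cf_eval (w n) (y n) = cf_eval (w n) (cf_eval (\<omega> n) (y (Suc n)))"
      using y(3)[of n] y(3)[of "Suc n"] by (simp add: wSuc cf_eval_append)
  qed (use y assms cf_eval_bounds in auto)
  have pos: "0 < y n" for n
  proof -
    obtain a v where v: "\<omega> n = a # v" using assms(1) by (cases "\<omega> n") auto
    then have "1 \<le> real a" "0 \<le> cf_eval v (y (Suc n))"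
      using assms(2)[of n] y cf_eval_bounds[of v] by auto
    then show ?thesis using rec[of n] v by simp
  qed
  \<comment> \<open>The value 1 would need the first digit 1 followed by the tail 0, but every tail
    is positive.\<close>
  have "y n < 1" for n
  proof -
    obtain a v where v: "\<omega> n = a # v" using assms(1) by (cases "\<omega> n") auto
    have "y n \<noteq> 1"
    proof
      assume "y n = 1"
      moreover have "0 < cf_eval v (y (Suc n))"
      proof (cases v)
        case (Cons b u)
        then have "1 \<le> real b" "0 \<le> cf_eval u (y (Suc n))"
          using assms(2)[of n] v y cf_eval_bounds[of u] by auto
        then show ?thesis using Cons by simp
      qed (use pos in simp)
      moreover have "1 \<le> real a" using assms(2)[of n] v by auto
      ultimately show False using rec[of n] v by simp
    qed
    then show ?thesis using y(2)[of n] by linarith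
  qed
  then show ?thesis using rec pos by blast
qed


section \<open>Sums over words\<close>

definition words :: "nat \<Rightarrow> nat list set" where
  "words n = {w. length w = n \<and> (\<forall>a\<in>set w. 1 \<le> a)}"

lemma words_0 [simp]: "words 0 = {[]}"
  by (auto simp: words_def)

lemma wordsD: "w \<in> words n \<Longrightarrow> length w = n" "w \<in> words n \<Longrightarrow> \<forall>a\<in>set w. 1 \<le> a"
  by (auto simp: words_def)

lemma countable_words [simp]: "countable (words n)"
  by simp

lemma bij_betw_words_append: "bij_betw (\<lambda>(u, v). u @ v) (words m \<times> words n) (words (m + n))"
proof (rule bij_betwI[where g = "\<lambda>w. (take m w, drop m w)"])
  show "(\<lambda>w. (take m w, drop m w)) \<in> words (m + n) \<rightarrow> words m \<times> words n"
    by (auto simp: words_def dest: in_set_takeD in_set_dropD)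
qed (auto simp: words_def)

text \<open>Sums over words are integrals against counting measure, so that infinite values are
  allowed and Tonelli's theorem handles the cutting of words.\<close>

lemma nn_integral_words_append:
  "(\<integral>\<^sup>+w. f w \<partial>count_space (words (m + n))) =
     (\<integral>\<^sup>+u. \<integral>\<^sup>+v. f (u @ v) \<partial>count_space (words n) \<partial>count_space (words m))"
proof -
  interpret sigma_finite_measure "count_space (words n)"
    by (intro sigma_finite_measure_count_space_countable countable_words)
  have *: "count_space (words m) \<Otimes>\<^sub>M count_space (words n) = count_space (words m \<times> words n)"
    by (intro pair_measure_countable countable_words)
  have "(\<integral>\<^sup>+w. f w \<partial>count_space (words (m + n))) =
      (\<integral>\<^sup>+p. f (case p of (u, v) \<Rightarrow> u @ v) \<partial>count_space (words m \<times> words n))"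
    by (rule nn_integral_bij_count_space[OF bij_betw_words_append, symmetric])
  also have "\<dots> = (\<integral>\<^sup>+u. \<integral>\<^sup>+v. f (u @ v) \<partial>count_space (words n) \<partial>count_space (words m))"
    by (subst nn_integral_fst[symmetric, of _ "count_space (words m)", unfolded *]) auto
  finally show ?thesis .
qed

lemma nn_integral_words_1: "(\<integral>\<^sup>+w. f w \<partial>count_space (words 1)) = (\<Sum>n. f [Suc n])"
proof -
  have "bij_betw (\<lambda>n. [Suc n]) UNIV (words 1)"
  proof (rule bij_betwI[where g = "\<lambda>w. hd w - 1"])
    fix w assume "w \<in> words 1"
    then show "[Suc (hd w - 1)] = w" by (cases w) (auto simp: words_def)
  qed (auto simp: words_def)
  from nn_integral_bij_count_space[OF this, of f] show ?thesis
    by (simp add: nn_integral_count_space_nat)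
qed

text \<open>Links the unordered sum in \<open>pressure_sum\<close> to these integrals; both are
  suprema of finite partial sums.\<close>

lemma infsum_eq_nn_integral:
  fixes f :: "'a \<Rightarrow> ennreal"
  assumes "countable A"
  shows "infsum f A = (\<integral>\<^sup>+x. f x \<partial>count_space A)"
proof -
  have "(\<integral>\<^sup>+x. f x \<partial>count_space A) = (SUP F\<in>{F. finite F \<and> F \<subseteq> A}. sum f F)"
  proof (rule antisym)
    show "(\<integral>\<^sup>+x. f x \<partial>count_space A) \<le> (SUP F\<in>{F. finite F \<and> F \<subseteq> A}. sum f F)"
    proof (cases "finite A")
      case True
      then show ?thesis by (auto simp: nn_integral_count_space_finite intro!: SUP_upper)
    next
      case False
      note bij = bij_betw_from_nat_into[OF assms False]
      have "(\<integral>\<^sup>+x. f x \<partial>count_space A) = (\<Sum>n. f (from_nat_into A n))"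
        by (simp add: nn_integral_bij_count_space[OF bij, symmetric] nn_integral_count_space_nat)
      also have "\<dots> = (SUP n. \<Sum>i<n. f (from_nat_into A i))" by (rule suminf_eq_SUP)
      also have "\<dots> = (SUP n. sum f (from_nat_into A ` {..<n}))"
        using bij by (subst sum.reindex) (auto simp: bij_betw_def intro: inj_on_subset)
      also have "\<dots> \<le> (SUP F\<in>{F. finite F \<and> F \<subseteq> A}. sum f F)"
        using bij by (intro SUP_least SUP_upper) (auto simp: bij_betw_def)
      finally show ?thesis .
    qed
    show "(SUP F\<in>{F. finite F \<and> F \<subseteq> A}. sum f F) \<le> (\<integral>\<^sup>+x. f x \<partial>count_space A)"
    proof (rule SUP_least)
      fix F assume "F \<in> {F. finite F \<and> F \<subseteq> A}"
      then have F: "finite F" "F \<subseteq> A" by auto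
      then have "sum f F = (\<integral>\<^sup>+x. f x * indicator F x \<partial>count_space A)"
        by (subst nn_integral_count_space'[of F]) (auto simp: indicator_def)
      also have "\<dots> \<le> (\<integral>\<^sup>+x. f x \<partial>count_space A)"
        by (intro nn_integral_mono) (auto simp: indicator_def)
      finally show "sum f F \<le> (\<integral>\<^sup>+x. f x \<partial>count_space A)" .
    qed
  qed
  then show ?thesis by (simp add: nonneg_infsum_complete)
qed


section \<open>The partition function of the geometric potential\<close>

definition part_fun :: "real \<Rightarrow> nat \<Rightarrow> ennreal" where
  "part_fun s n = (\<integral>\<^sup>+w. ennreal (cont w powr (-2 * s)) \<partial>count_space (words n))"

lemma part_fun_0 [simp]: "part_fun s 0 = 1"
  by (simp add: part_fun_def nn_integral_count_space_finite)

lemma nn_integral_mult_split: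
  "(\<integral>\<^sup>+u. \<integral>\<^sup>+v. f u * g v \<partial>count_space B \<partial>count_space A) =
     (\<integral>\<^sup>+u. f u \<partial>count_space A) * (\<integral>\<^sup>+v. g v \<partial>count_space B)"
  by (simp add: nn_integral_cmult nn_integral_multc)

lemma part_fun_add_le:
  assumes "0 \<le> s"
  shows "part_fun s (m + n) \<le> part_fun s m * part_fun s n"
proof -
  have "part_fun s (m + n) \<le> (\<integral>\<^sup>+u. \<integral>\<^sup>+v. ennreal (cont u powr (-2 * s)) * ennreal (cont v powr (-2 * s))
      \<partial>count_space (words n) \<partial>count_space (words m))"
    unfolding part_fun_def nn_integral_words_append
  proof (intro nn_integral_mono)
    fix u v assume "u \<in> space (count_space (words m))" "v \<in> space (count_space (words n))"
    then have 1: "\<forall>a\<in>set u. 1 \<le> a" "\<forall>a\<in>set v. 1 \<le> a" by (auto simp: words_def)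
    have "cont (u @ v) powr (-2 * s) \<le> (cont u * cont v) powr (-2 * s)"
      using assms cont_pos[OF 1(1)] cont_pos[OF 1(2)] cont_append_ge[OF 1]
      by (intro powr_mono2') auto
    also have "\<dots> = cont u powr (-2 * s) * cont v powr (-2 * s)"
      using cont_pos[OF 1(1)] cont_pos[OF 1(2)] by (simp add: powr_mult)
    finally show "ennreal (cont (u @ v) powr (-2 * s))
        \<le> ennreal (cont u powr (-2 * s)) * ennreal (cont v powr (-2 * s))"
      by (simp add: ennreal_mult[symmetric])
  qed
  then show ?thesis by (simp add: nn_integral_mult_split part_fun_def)
qed

lemma part_fun_add_ge:
  assumes "0 \<le> s"
  shows "ennreal (4 powr (- s)) * (part_fun s m * part_fun s n) \<le> part_fun s (m + n)"
proof -
  have "(\<integral>\<^sup>+u. \<integral>\<^sup>+v. ennreal (4 powr (- s)) * (ennreal (cont u powr (-2 * s)) * ennreal (cont v powr (-2 * s)))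
      \<partial>count_space (words n) \<partial>count_space (words m)) \<le> part_fun s (m + n)"
    unfolding part_fun_def nn_integral_words_append
  proof (intro nn_integral_mono)
    fix u v assume "u \<in> space (count_space (words m))" "v \<in> space (count_space (words n))"
    then have 1: "\<forall>a\<in>set u. 1 \<le> a" "\<forall>a\<in>set v. 1 \<le> a" by (auto simp: words_def)
    have "4 powr (- s) = (2 powr 2) powr (- s)" by simp
    also have "\<dots> = 2 powr (-2 * s)" by (subst powr_powr) simp
    finally have "4 powr (- s) * (cont u powr (-2 * s) * cont v powr (-2 * s)) =
        (2 * cont u * cont v) powr (-2 * s)"
      using cont_pos[OF 1(1)] cont_pos[OF 1(2)] by (simp add: powr_mult)
    also have "\<dots> \<le> cont (u @ v) powr (-2 * s)"
      using assms cont_append_le[OF 1] cont_pos[of "u @ v"] 1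
      by (intro powr_mono2') auto
    finally show "ennreal (4 powr (- s)) * (ennreal (cont u powr (-2 * s)) * ennreal (cont v powr (-2 * s)))
        \<le> ennreal (cont (u @ v) powr (-2 * s))"
      by (simp add: ennreal_mult[symmetric])
  qed
  then show ?thesis by (simp add: nn_integral_cmult nn_integral_multc part_fun_def mult_ac)
qed

section \<open>Finiteness of the partition function and the zeta series at
  \<open>2 * s\<close>\<close>

lemma part_fun_1: "part_fun s 1 = (\<Sum>n. ennreal (real (Suc n) powr (-2 * s)))"
  unfolding part_fun_def nn_integral_words_1 by simp

lemma zeta_finite_iff: "(\<Sum>n. ennreal (real (Suc n) powr (- z))) < top \<longleftrightarrow> 1 < z"
proof -
  have sm: "summable (\<lambda>n. real (Suc n) powr (- z)) \<longleftrightarrow> 1 < z"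
    using summable_real_powr_iff[of "-z"] summable_Suc_iff[of "\<lambda>n. real n powr (-z)"] by simp
  show ?thesis
  proof
    assume "(\<Sum>n. ennreal (real (Suc n) powr (- z))) < top"
    then have "summable (\<lambda>n. real (Suc n) powr (- z))"
      by (intro summable_suminf_not_top) auto
    then show "1 < z" using sm by simp
  next
    assume "1 < z"
    then have "summable (\<lambda>n. real (Suc n) powr (- z))" using sm by simp
    then show "(\<Sum>n. ennreal (real (Suc n) powr (- z))) < top"
      by (subst suminf_ennreal2) auto
  qed
qed

lemma part_fun_finite:
  assumes "1 / 2 < s"
  shows "part_fun s n < top"
proof (induction n)
  case (Suc n)
  have "part_fun s 1 < top" unfolding part_fun_1 using zeta_finite_iff[of "2 * s"] assms by simp
  then have "part_fun s 1 * part_fun s n < top" using Suc by (simp add: ennreal_mult_less_top)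
  then show ?case using part_fun_add_le[of s 1 n] assms by simp
qed simp

lemma part_fun_pos: "0 < part_fun s n"
proof -
  have "0 < ennreal (cont (replicate n 1) powr (-2 * s))"
    using cont_pos[of "replicate n 1"] by auto
  also have "\<dots> \<le> part_fun s n" unfolding part_fun_def
    by (rule nn_integral_ge_point) (auto simp: words_def)
  finally show ?thesis .
qed

text \<open>The first letter alone makes the sum diverge, and supermultiplicativity up to a constant
  passes this on to every positive length.\<close>

lemma part_fun_infinite:
  assumes "0 \<le> s" "s \<le> 1 / 2" "0 < n"
  shows "part_fun s n = top"
proof -
  obtain m where n: "n = 1 + m" using assms by (cases n) auto
  have "\<not> part_fun s 1 < top" unfolding part_fun_1 using zeta_finite_iff[of "2 * s"] assms by simp
  then have "part_fun s 1 = top" by (simp add: less_top[symmetric])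
  then have "ennreal (4 powr (- s)) * (part_fun s 1 * part_fun s m) = top"
    using part_fun_pos[of s m] by (auto simp: ennreal_top_mult ennreal_mult_eq_top_iff)
  then show ?thesis using part_fun_add_ge[of s 1 m] assms n by (simp add: top.extremum_unique)
qed

text \<open>Fekete's lemma: the limit is the infimum of the quotients, which the linear lower bound
  keeps finite.\<close>

lemma subadditive_quotient_convergent:
  fixes u :: "nat \<Rightarrow> real"
  assumes sub: "\<And>m n. u (m + n) \<le> u m + u n" and lower: "\<And>n. c * real n \<le> u n"
  shows "convergent (\<lambda>n. u n / real n)"
proof -
  define S where "S = (\<lambda>n. u n / real n) ` {1..}"
  define L where "L = Inf S"
  have bdd: "bdd_below S"
    using lower by (intro bdd_belowI[of _ c]) (auto simp: S_def field_simps)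
  have L_le: "L \<le> u n / real n" if "1 \<le> n" for n
    unfolding L_def using bdd that by (intro cInf_lower) (auto simp: S_def)
  have mult: "u (q * m) \<le> real q * u m + \<bar>u 0\<bar>" for q m
  proof (induction q)
    case (Suc q)
    have "u (Suc q * m) \<le> u (q * m) + u m" using sub[of "q * m" m] by (simp add: add.commute)
    then show ?case using Suc by (simp add: algebra_simps)
  qed simp
  have "(\<lambda>n. u n / real n) \<longlonglongrightarrow> L"
  proof (rule LIMSEQ_I)
    fix e :: real assume "0 < e"
    have "S \<noteq> {}" by (auto simp: S_def)
    then obtain z where "z \<in> S" "z < L + e / 2"
      using cInf_lessD[of S "L + e / 2"] \<open>0 < e\<close> by (auto simp: L_def)
    then obtain m where m: "1 \<le> m" "u m / real m < L + e / 2" by (auto simp: S_def)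
    define K where "K = (\<Sum>r<m. \<bar>u r\<bar>) + \<bar>u 0\<bar> + \<bar>u m\<bar>"
    have upper: "u n \<le> real n * (u m / real m) + K" for n
    proof -
      define q r where "q = n div m" and "r = n mod m"
      have n: "n = q * m + r" by (simp add: q_def r_def)
      have "r < m" using m by (simp add: r_def)
      then have "\<bar>u r\<bar> \<le> (\<Sum>r<m. \<bar>u r\<bar>)" by (intro member_le_sum) auto
      moreover have "u n \<le> real q * u m + \<bar>u 0\<bar> + u r" using sub[of "q * m" r] mult[of q m] n by simp
      moreover have "real n * (u m / real m) = real q * u m + (real r / real m) * u m"
        using m by (simp add: n field_simps)
      moreover have "- ((real r / real m) * u m) \<le> \<bar>u m\<bar>"
      proof -
        have "\<bar>(real r / real m) * u m\<bar> \<le> 1 * \<bar>u m\<bar>"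
          unfolding abs_mult using \<open>r < m\<close> by (intro mult_right_mono) auto
        then show ?thesis by linarith
      qed
      ultimately show ?thesis unfolding K_def by linarith
    qed
    obtain N where N: "K / (e / 2) < real N" using reals_Archimedean2 by blast
    show "\<exists>N. \<forall>n\<ge>N. norm (u n / real n - L) < e"
    proof (intro exI[of _ "max 1 N"] allI impI)
      fix n assume n: "max 1 N \<le> n"
      then have "K / (e / 2) < real n" using N by linarith
      then have "K / real n < e / 2" using n \<open>0 < e\<close> by (simp add: field_simps)
      moreover have "u n / real n \<le> u m / real m + K / real n"
        using upper[of n] n by (simp add: field_simps)
      ultimately show "norm (u n / real n - L) < e"
        unfolding real_norm_def abs_less_iff using L_le[of n] m n by linarith
    qed
  qed
  then show ?thesis by (rule convergentI)
qed

definition log_part :: "real \<Rightarrow> nat \<Rightarrow> real" where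
  "log_part s n = ln (enn2real (part_fun s n))"

definition geom_pressure :: "real \<Rightarrow> real" where
  "geom_pressure s = lim (\<lambda>n. log_part s n / real n)"

lemma part_fun_eq_exp:
  assumes "1 / 2 < s"
  shows "part_fun s n = ennreal (exp (log_part s n))"
  using part_fun_finite[OF assms, of n] part_fun_pos[of s n]
  by (simp add: log_part_def enn2real_positive_iff less_top)

lemma log_part_add_ge:
  assumes "1 / 2 < s"
  shows "log_part s m + log_part s n - s * ln 4 \<le> log_part s (m + n)"
  using part_fun_add_ge[of s m n] assms
  by (simp add: part_fun_eq_exp ennreal_mult[symmetric] exp_add[symmetric] powr_def)

text \<open>Superadditivity up to \<open>s * ln 4\<close>. This is the lower bound for Fekete's
  lemma; through \<open>geom_pressure_ge\<close> it also drives the pressure to infinity as s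
  decreases to 1/2, where the zeta value behind \<open>log_part s 1\<close> blows up.\<close>

lemma log_part_ge:
  assumes "1 / 2 < s"
  shows "(log_part s 1 - s * ln 4) * real n \<le> log_part s n"
proof (induction n)
  case 0
  then show ?case by (simp add: log_part_def)
next
  case (Suc n)
  then show ?case using log_part_add_ge[OF assms, of n 1] by (simp add: algebra_simps)
qed

lemma geom_pressure_LIMSEQ:
  assumes "1 / 2 < s"
  shows "(\<lambda>n. log_part s n / real n) \<longlonglongrightarrow> geom_pressure s"
proof -
  have sub: "log_part s (m + n) \<le> log_part s m + log_part s n" for m n
    using part_fun_add_le[of s m n] assms
    by (simp add: part_fun_eq_exp ennreal_mult[symmetric] exp_add[symmetric])
  from subadditive_quotient_convergent[OF sub log_part_ge[OF assms]] show ?thesis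
    by (simp add: geom_pressure_def convergent_LIMSEQ_iff)
qed

lemma geom_pressure_ge:
  assumes "1 / 2 < s"
  shows "log_part s 1 - s * ln 4 \<le> geom_pressure s"
proof (rule LIMSEQ_le_const[OF geom_pressure_LIMSEQ[OF assms]])
  have "log_part s 1 - s * ln 4 \<le> log_part s n / real n" if "1 \<le> n" for n
    using log_part_ge[OF assms, of n] that by (simp add: field_simps)
  then show "\<exists>N. \<forall>n\<ge>N. log_part s 1 - s * ln 4 \<le> log_part s n / real n" by blast
qed


section \<open>The pressure of the potentials in the theorem\<close>

abbreviation dim_potential :: "real \<Rightarrow> real \<Rightarrow> real \<Rightarrow> real" where
  "dim_potential s B \<equiv> (\<lambda>x. - s * ln \<bar>deriv gauss_map x\<bar> - (2 * s - 1) * ln B)"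

lemma cf_domain_bounds: "x \<in> cf_domain \<Longrightarrow> 0 < x \<and> x < 1"
  by (force simp: cf_domain_def partial_quotient_def order_le_less)

text \<open>The point with all digits 1. Over an empty domain the suprema in
  \<open>pressure_sum\<close> would be 0 and its lower bound would fail.\<close>

lemma cf_domain_nonempty: "cf_domain \<noteq> {}"
proof -
  obtain y where y: "\<And>i. 0 < y i \<and> y i < 1 \<and> y i = cf_eval [1] (y (Suc i))"
    using coding_exists[of "\<lambda>_. [1]"] by auto
  have "y 0 = cf_eval (replicate n 1) (y n)" for n
  proof (induction n)
    case (Suc n)
    have "cf_eval (replicate (Suc n) 1) (y (Suc n)) = cf_eval (replicate n 1) (cf_eval [1] (y (Suc n)))"
      by (simp only: cf_eval_append[symmetric] replicate_append_same replicate_Suc)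
    then show ?case using Suc y[of n] by metis
  qed simp
  moreover have "partial_quotient n (cf_eval (replicate n 1) (y n)) = 1" if "1 \<le> n" for n
    using that y[of n] by (subst partial_quotient_cf_eval) auto
  ultimately have "partial_quotient n (y 0) = 1" if "1 \<le> n" for n using that by metis
  then have "y 0 \<in> cf_domain" using y[of 0] by (auto simp: cf_domain_def)
  then show ?thesis by auto
qed

lemma exp_birkhoff_sum:
  assumes "w \<in> words n" "0 < x" "x < 1" "0 < B"
  shows "exp (birkhoff_sum (dim_potential s B) n (cf_eval w x)) =
    cf_den w x powr (-2 * s) * exp (- (2 * s - 1) * ln B * real n)"
  using assms(1)
proof (induction w arbitrary: n)
  case Nil
  then show ?case by (simp add: words_def birkhoff_sum_def)
next
  case (Cons a w)
  then obtain m where n: "n = Suc m" and w: "w \<in> words m" and a: "1 \<le> a"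
    by (auto simp: words_def)
  define c where "c = cf_eval w x"
  have c: "0 < c" "c < 1" using cf_eval_strict_bounds[of w x] wordsD[OF w] assms by (auto simp: c_def)
  have "ln \<bar>deriv gauss_map (1 / (real a + c))\<bar> = 2 * ln (real a + c)"
    using gauss_map_deriv[OF a c] a c by (simp add: ln_realpow)
  then have "birkhoff_sum (dim_potential s B) n (cf_eval (a # w) x) =
      - 2 * s * ln (real a + c) - (2 * s - 1) * ln B + birkhoff_sum (dim_potential s B) m c"
    using gauss_map_inverse(1)[of a c] a c
    by (simp add: n birkhoff_sum_def sum.lessThan_Suc_shift funpow_Suc_right c_def
        del: funpow.simps sum.lessThan_Suc)
  moreover have "exp (- 2 * s * ln (real a + c)) = (real a + c) powr (-2 * s)"
    using a c by (simp add: powr_def)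
  moreover have "cf_den (a # w) x powr (-2 * s) = (real a + c) powr (-2 * s) * cf_den w x powr (-2 * s)"
    using a c by (simp add: c_def powr_mult)
  moreover have "exp (- (2 * s - 1) * ln B * real n) =
      exp (- ((2 * s - 1) * ln B)) * exp (- (2 * s - 1) * ln B * real m)"
    unfolding exp_add[symmetric] n by (simp add: algebra_simps)
  moreover have "exp (birkhoff_sum (dim_potential s B) m c) =
      cf_den w x powr (-2 * s) * exp (- (2 * s - 1) * ln B * real m)"
    unfolding c_def by (rule Cons.IH[OF w])
  moreover have "exp (X - Y + Z) = exp X * exp (- Y) * exp Z" for X Y Z :: real
    by (simp add: exp_add[symmetric])
  ultimately show ?case by (simp only: mult_ac)
qed

text \<open>Replacing the supremum over the tails by the tail 0 costs at most the distortion factor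
  \<open>4 powr (- s)\<close>. It does not depend on n, so it disappears after taking logarithms and
  dividing by n.\<close>

lemma pressure_sum_bounds:
  assumes "0 \<le> s" "0 < B"
  defines "c \<equiv> (\<lambda>n. exp (- (2 * s - 1) * ln B * real n))"
  shows "pressure_sum (dim_potential s B) n \<le> ennreal (c n) * part_fun s n"
    "ennreal (4 powr (- s) * c n) * part_fun s n \<le> pressure_sum (dim_potential s B) n"
proof -
  define G where "G w = (SUP x\<in>cf_domain. ennreal (exp (birkhoff_sum (dim_potential s B) n (cf_eval w x))))" for w
  have ps: "pressure_sum (dim_potential s B) n = (\<integral>\<^sup>+w. G w \<partial>count_space (words n))"
    unfolding pressure_sum_def G_def words_def[symmetric] by (rule infsum_eq_nn_integral) simp
  have "G w \<le> ennreal (c n) * ennreal (cont w powr (-2 * s)) \<and>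
     ennreal (4 powr (- s) * c n) * ennreal (cont w powr (-2 * s)) \<le> G w" if w: "w \<in> words n" for w
  proof
    show "G w \<le> ennreal (c n) * ennreal (cont w powr (-2 * s))"
      unfolding G_def
    proof (rule SUP_least)
      fix x assume "x \<in> cf_domain"
      then have x: "0 < x" "x < 1" using cf_domain_bounds by auto
      have "cf_den w x powr (-2 * s) \<le> cont w powr (-2 * s)"
        using assms x wordsD[OF w] cont_pos[of w] by (intro powr_mono2' cont_le_cf_den) auto
      then show "ennreal (exp (birkhoff_sum (dim_potential s B) n (cf_eval w x)))
          \<le> ennreal (c n) * ennreal (cont w powr (-2 * s))"
        unfolding exp_birkhoff_sum[OF w x assms(2)]
        by (simp add: c_def ennreal_mult[symmetric] mult.commute ennreal_leI)
    qed
    obtain x where xd: "x \<in> cf_domain" using cf_domain_nonempty by auto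
    then have x: "0 < x" "x < 1" using cf_domain_bounds by auto
    have "4 powr (- s) = (2 powr 2) powr (- s)" by simp
    also have "\<dots> = 2 powr (-2 * s)" by (subst powr_powr) simp
    finally have "4 powr (- s) * cont w powr (-2 * s) = (2 * cont w) powr (-2 * s)"
      using wordsD[OF w] cont_pos[of w] by (simp add: powr_mult)
    also have "\<dots> \<le> cf_den w x powr (-2 * s)"
      using assms x wordsD[OF w] cf_den_pos[of w x] by (intro powr_mono2' cf_den_le_2_cont) auto
    finally have "ennreal (4 powr (- s) * c n) * ennreal (cont w powr (-2 * s)) \<le>
        ennreal (exp (birkhoff_sum (dim_potential s B) n (cf_eval w x)))"
      unfolding exp_birkhoff_sum[OF w x assms(2)]
      by (simp add: c_def ennreal_mult[symmetric] mult_ac ennreal_leI)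
    also have "\<dots> \<le> G w" unfolding G_def using xd by (rule SUP_upper)
    finally show "ennreal (4 powr (- s) * c n) * ennreal (cont w powr (-2 * s)) \<le> G w" .
  qed
  then show "pressure_sum (dim_potential s B) n \<le> ennreal (c n) * part_fun s n"
    "ennreal (4 powr (- s) * c n) * part_fun s n \<le> pressure_sum (dim_potential s B) n"
    unfolding ps part_fun_def by (auto simp: nn_integral_cmult[symmetric] intro!: nn_integral_mono)
qed

lemma pressure_eq:
  assumes "1 / 2 < s" "0 < B"
  shows "pressure (dim_potential s B) = ereal (geom_pressure s - (2 * s - 1) * ln B)"
proof -
  define D where "D = (2 * s - 1) * ln B"
  define p where "p n = ln (enn2real (pressure_sum (dim_potential s B) n))" for n
  have bounds: "ln_ennreal (pressure_sum (dim_potential s B) n) = ereal (p n) \<and>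
      - s * ln 4 - D * real n + log_part s n \<le> p n \<and> p n \<le> - D * real n + log_part s n" for n
  proof -
    let ?P = "pressure_sum (dim_potential s B) n"
    have c: "- (2 * s - 1) * ln B * real n = - D * real n" by (simp only: D_def mult_minus_left)
    have up: "?P \<le> ennreal (exp (- D * real n + log_part s n))"
      using pressure_sum_bounds(1)[of s B n, unfolded c] assms
      by (simp add: part_fun_eq_exp ennreal_mult[symmetric] exp_add[symmetric])
    have lo: "ennreal (exp (- s * ln 4 - D * real n + log_part s n)) \<le> ?P"
      using pressure_sum_bounds(2)[of s B n, unfolded c] assms
      by (simp add: part_fun_eq_exp ennreal_mult[symmetric] exp_add[symmetric] powr_def)
    from up have fin: "?P < top" by (rule order.strict_trans1) simp
    then obtain r where r: "?P = ennreal r" "0 \<le> r" by (cases ?P) auto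
    have "exp (- s * ln 4 - D * real n + log_part s n) \<le> r" using lo r by (simp add: ennreal_le_iff)
    moreover from this have "0 < r" using exp_gt_zero order.strict_trans2 by blast
    moreover have "r \<le> exp (- D * real n + log_part s n)" using up r by (simp add: ennreal_le_iff)
    then have "ln r \<le> - D * real n + log_part s n"
      using ln_le_cancel_iff[OF \<open>0 < r\<close> exp_gt_zero] by simp
    ultimately show ?thesis
      using r by (auto simp: ln_ennreal_def p_def ln_ge_iff)
  qed
  have "(\<lambda>n. p n / real n) \<longlonglongrightarrow> geom_pressure s - D"
  proof (rule tendsto_sandwich)
    show "\<forall>\<^sub>F n in sequentially. - s * ln 4 / real n - D + log_part s n / real n \<le> p n / real n"
      using eventually_gt_at_top[of 0]
    proof eventually_elim
      case (elim n)
      have "(- s * ln 4 - D * real n + log_part s n) / real n \<le> p n / real n"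
        using bounds[of n] by (intro divide_right_mono) auto
      then show ?case using elim by (simp add: add_divide_distrib diff_divide_distrib)
    qed
    show "\<forall>\<^sub>F n in sequentially. p n / real n \<le> - D + log_part s n / real n"
      using eventually_gt_at_top[of 0]
    proof eventually_elim
      case (elim n)
      have "p n / real n \<le> (- D * real n + log_part s n) / real n"
        using bounds[of n] by (intro divide_right_mono) auto
      then show ?case using elim by (simp add: add_divide_distrib diff_divide_distrib)
    qed
    have "(\<lambda>n. - s * ln 4 / real n - D + log_part s n / real n) \<longlonglongrightarrow> 0 - D + geom_pressure s"
      by (intro tendsto_intros geom_pressure_LIMSEQ assms real_tendsto_divide_at_top
          filterlim_real_sequentially)
    then show "(\<lambda>n. - s * ln 4 / real n - D + log_part s n / real n) \<longlonglongrightarrow> geom_pressure s - D"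
      by simp
    have "(\<lambda>n. - D + log_part s n / real n) \<longlonglongrightarrow> - D + geom_pressure s"
      by (intro tendsto_intros geom_pressure_LIMSEQ assms)
    then show "(\<lambda>n. - D + log_part s n / real n) \<longlonglongrightarrow> geom_pressure s - D" by simp
  qed
  then have "(\<lambda>n. ereal (1 / real n) * ln_ennreal (pressure_sum (dim_potential s B) n))
      \<longlonglongrightarrow> ereal (geom_pressure s - D)"
    using bounds by simp
  then show ?thesis unfolding pressure_def D_def by (rule limI)
qed

lemma pressure_eq_infinity:
  assumes "0 \<le> s" "s \<le> 1 / 2" "0 < B"
  shows "pressure (dim_potential s B) = \<infinity>"
proof -
  have "ereal (1 / real n) * ln_ennreal (pressure_sum (dim_potential s B) n) = \<infinity>" if "0 < n" for n
  proof -
    have "pressure_sum (dim_potential s B) n = top"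
      using pressure_sum_bounds(2)[of s B n] part_fun_infinite[of s n] assms that
      by (simp add: ennreal_mult_top top.extremum_unique)
    then show ?thesis using that by (simp add: ln_ennreal_def)
  qed
  then have "(\<lambda>n. ereal (1 / real n) * ln_ennreal (pressure_sum (dim_potential s B) n)) \<longlonglongrightarrow> \<infinity>"
    by (intro tendsto_eventually eventually_sequentiallyI[of 1]) auto
  then show ?thesis unfolding pressure_def by (rule limI)
qed

text \<open>\<open>1 / (1 + x)\<close> is the density of the Gauss measure; its invariance makes the weighted sums
  over the words of each length equal to 1.\<close>

lemma part_fun_one_le: "part_fun 1 n \<le> 2"
proof -
  define g where "g w = ennreal (1 / ((cont w)\<^sup>2 * (1 + cf_eval w 0)))" for w
  have "(\<integral>\<^sup>+w. g w \<partial>count_space (words n)) \<le> 1"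
  proof (induction n)
    case 0
    then show ?case by (simp add: g_def nn_integral_count_space_finite)
  next
    case (Suc n)
    have "(\<integral>\<^sup>+w. g w \<partial>count_space (words (Suc n))) =
        (\<integral>\<^sup>+u. \<integral>\<^sup>+v. g (u @ v) \<partial>count_space (words n) \<partial>count_space (words 1))"
      using nn_integral_words_append[of 1 n g] by simp
    \<comment> \<open>The new digit stands in front and is summed first, for fixed v: this is the
      transfer operator applied to the Gauss density at \<open>cf_eval v 0\<close>.\<close>
    also have "\<dots> = (\<integral>\<^sup>+v. \<integral>\<^sup>+u. g (u @ v) \<partial>count_space (words 1) \<partial>count_space (words n))"
      by (rule nn_integral_count_space_nn_integral) auto
    also have "\<dots> \<le> (\<integral>\<^sup>+v. g v \<partial>count_space (words n))"
    proof (rule nn_integral_mono)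
      fix v assume "v \<in> space (count_space (words n))"
      then have v: "\<forall>a\<in>set v. 1 \<le> a" by (auto simp: words_def)
      define c where "c = cf_eval v 0"
      have c: "0 \<le> c" using cf_eval_bounds[of v 0] v by (simp add: c_def)
      \<comment> \<open>Partial fractions: 1 / ((a + c) (a + 1 + c)) = 1 / (a + c) - 1 / (a + 1 +
        c), so the sum over the digit a = \<open>Suc k\<close> telescopes to \<open>h 0\<close>,
        which is \<open>g v\<close>.\<close>
      define h where "h k = 1 / ((cont v)\<^sup>2 * (real (Suc k) + c))" for k
      have tm: "g ([Suc k] @ v) = ennreal (h k - h (Suc k))" for k
      proof -
        have "(cont ([Suc k] @ v))\<^sup>2 * (1 + cf_eval ([Suc k] @ v) 0) =
            (cont v)\<^sup>2 * ((real (Suc k) + c) * (real (Suc (Suc k)) + c))"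
          using c by (simp add: c_def[symmetric] power2_eq_square field_simps)
        moreover have "1 / ((cont v)\<^sup>2 * ((real (Suc k) + c) * (real (Suc (Suc k)) + c))) = h k - h (Suc k)"
          unfolding h_def using c cont_pos[OF v] by (simp add: divide_simps)
        ultimately show ?thesis by (simp only: g_def)
      qed
      have "(\<integral>\<^sup>+u. g (u @ v) \<partial>count_space (words 1)) = (\<Sum>k. ennreal (h k - h (Suc k)))"
        unfolding nn_integral_words_1 tm ..
      also have "\<dots> \<le> ennreal (h 0)"
      proof (rule suminf_le_const)
        fix m
        have mono: "h (Suc k) \<le> h k" for k
          unfolding h_def using c cont_pos[OF v] by (intro divide_left_mono) auto
        have "(\<Sum>k<m. ennreal (h k - h (Suc k))) = ennreal (\<Sum>k<m. h k - h (Suc k))"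
          using mono by (intro sum_ennreal) auto
        also have "(\<Sum>k<m. h k - h (Suc k)) = h 0 - h m" by (rule sum_lessThan_telescope')
        also have "ennreal (h 0 - h m) \<le> ennreal (h 0)"
          using c cont_pos[OF v] by (intro ennreal_leI) (simp add: h_def)
        finally show "(\<Sum>k<m. ennreal (h k - h (Suc k))) \<le> ennreal (h 0)" .
      qed simp
      also have "\<dots> = g v" by (simp add: h_def g_def c_def)
      finally show "(\<integral>\<^sup>+u. g (u @ v) \<partial>count_space (words 1)) \<le> g v" .
    qed
    finally show ?case using Suc by simp
  qed
  moreover have "part_fun 1 n \<le> (\<integral>\<^sup>+w. 2 * g w \<partial>count_space (words n))"
    unfolding part_fun_def
  proof (rule nn_integral_mono)
    fix w assume "w \<in> space (count_space (words n))"
    then have w: "\<forall>a\<in>set w. 1 \<le> a" by (auto simp: words_def)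
    have "cont w powr (-2 * 1) = 2 * (1 / ((cont w)\<^sup>2 * 2))"
      using cont_pos[OF w] by (simp add: powr_minus powr_numeral field_simps)
    also have "\<dots> \<le> 2 * (1 / ((cont w)\<^sup>2 * (1 + cf_eval w 0)))"
      using cont_pos[OF w] cf_eval_bounds[OF w, of 0]
      by (intro mult_left_mono divide_left_mono) auto
    finally show "ennreal (cont w powr (-2 * 1)) \<le> 2 * g w"
      using cont_pos[OF w] cf_eval_bounds[OF w, of 0]
      by (simp add: g_def ennreal_mult[symmetric] ennreal_leI flip: ennreal_numeral)
  qed
  ultimately show ?thesis
    by (simp add: nn_integral_cmult) (metis mult_left_mono mult.right_neutral order_trans zero_le)
qed

text \<open>Puts s = 1 into the set whose infimum is taken; the lower bound can then confine itself
  to s <= 1.\<close>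

lemma geom_pressure_one_le: "geom_pressure 1 \<le> 0"
proof (rule LIMSEQ_le_const2)
  show "(\<lambda>n. log_part 1 n / real n - ln 2 / real n) \<longlonglongrightarrow> geom_pressure 1"
    using tendsto_diff[OF geom_pressure_LIMSEQ[of 1]
        real_tendsto_divide_at_top[OF tendsto_const filterlim_real_sequentially], of "ln 2"] by simp
  have "exp (log_part 1 n) \<le> 2" for n
    using part_fun_one_le[of n] by (simp add: part_fun_eq_exp ennreal_le_iff flip: ennreal_numeral)
  then have "log_part 1 n \<le> ln 2" for n by (simp add: ln_ge_iff)
  then show "\<exists>N. \<forall>n\<ge>N. log_part 1 n / real n - ln 2 / real n \<le> 0"
    by (auto simp: divide_right_mono)
qed

text \<open>Since q is at least 2^((n-1)/2), a larger exponent gains exponentially in n. This is the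
  room between s and s' in the upper bound.\<close>

lemma part_fun_decay:
  assumes "s \<le> s'"
  shows "part_fun s' n \<le> ennreal (2 powr (- (s' - s) * (real n - 1))) * part_fun s n"
proof -
  have "part_fun s' n \<le> (\<integral>\<^sup>+w. ennreal (2 powr (- (s' - s) * (real n - 1))) * ennreal (cont w powr (-2 * s)) \<partial>count_space (words n))"
    unfolding part_fun_def
  proof (rule nn_integral_mono)
    fix w assume "w \<in> space (count_space (words n))"
    then have w: "\<forall>a\<in>set w. 1 \<le> a" "length w = n" by (auto simp: words_def)
    have "real n \<le> real (2 * (n div 2) + 1)" unfolding of_nat_le_iff by simp
    then have "2 powr ((real n - 1) / 2) \<le> 2 powr real (n div 2)" by (intro powr_mono) auto
    also have "\<dots> \<le> cont w" using cont_ge_power2[OF w(1)] w by (simp add: powr_realpow)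
    finally have "cont w powr (-2 * (s' - s)) \<le> (2 powr ((real n - 1) / 2)) powr (-2 * (s' - s))"
      using assms by (intro powr_mono2') auto
    also have "\<dots> = 2 powr (- (s' - s) * (real n - 1))"
      unfolding powr_powr by (rule arg_cong[where f = "(powr) 2"]) (simp add: field_simps)
    finally have "cont w powr (-2 * (s' - s)) * cont w powr (-2 * s)
        \<le> 2 powr (- (s' - s) * (real n - 1)) * cont w powr (-2 * s)" by (intro mult_right_mono) auto
    moreover have "cont w powr (-2 * (s' - s)) * cont w powr (-2 * s) = cont w powr (-2 * s')"
      by (simp add: powr_add[symmetric] algebra_simps)
    ultimately show "ennreal (cont w powr (-2 * s')) \<le>
        ennreal (2 powr (- (s' - s) * (real n - 1))) * ennreal (cont w powr (-2 * s))"
      by (simp add: ennreal_mult[symmetric] ennreal_leI)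
  qed
  then show ?thesis by (simp add: part_fun_def nn_integral_cmult)
qed


section \<open>The upper bound\<close>

text \<open>Each term of a sum is at most the sum, so a cover whose sum is at most
  \<open>\<delta> powr s\<close> automatically consists of sets of diameter at most
  \<delta>.\<close>

lemma hausdorff_measure_zeroI:
  fixes E :: "'a::metric_space set"
  assumes "0 < s"
    and cover: "\<And>\<eta>. 0 < \<eta> \<Longrightarrow> \<exists>U :: nat \<Rightarrow> 'a set. E \<subseteq> (\<Union>i. U i) \<and> (\<forall>i. bounded (U i)) \<and>
      (\<Sum>i. ennreal (diameter (U i) powr s)) \<le> ennreal \<eta>"
  shows "hausdorff_measure s E = 0"
proof -
  have *: "hausdorff_premeasure \<delta> s E \<le> ennreal \<eta>" if "0 < \<delta>" "0 < \<eta>" for \<delta> \<eta>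
  proof -
    have "0 < min \<eta> (\<delta> powr s)" using that by simp
    from cover[OF this] obtain U where U: "E \<subseteq> (\<Union>i. U i)" "\<And>i. bounded (U i)"
      "(\<Sum>i. ennreal (diameter (U i) powr s)) \<le> ennreal (min \<eta> (\<delta> powr s))"
      by blast
    have "diameter (U i) \<le> \<delta>" for i
    proof -
      have "ennreal (diameter (U i) powr s) \<le> (\<Sum>i. ennreal (diameter (U i) powr s))"
      proof -
        define h where "h = (\<lambda>i. ennreal (diameter (U i) powr s))"
        have "sum h {i} \<le> suminf h" by (rule sum_le_suminf) auto
        then show ?thesis by (simp add: h_def)
      qed
      also have "\<dots> \<le> ennreal (\<delta> powr s)" using U(3) by (rule order_trans) (simp add: ennreal_leI)
      finally have "diameter (U i) powr s \<le> \<delta> powr s" by simp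
      then show ?thesis using that \<open>0 < s\<close> by (meson not_le powr_less_mono2 less_imp_le)
    qed
    then have "hausdorff_premeasure \<delta> s E \<le> (\<Sum>i. diameter_pow s (U i))"
      unfolding hausdorff_premeasure_def using U by (intro INF_lower) auto
    also have "\<dots> \<le> (\<Sum>i. ennreal (diameter (U i) powr s))"
      using \<open>0 < s\<close> by (intro suminf_le) (auto simp: diameter_pow_def)
    also have "\<dots> \<le> ennreal \<eta>" using U(3) by (rule order_trans) (simp add: ennreal_leI)
    finally show ?thesis .
  qed
  have "hausdorff_premeasure \<delta> s E \<le> 0" if "0 < \<delta>" for \<delta>
  proof (rule ennreal_le_epsilon)
    fix e :: real assume "0 < e"
    then show "hausdorff_premeasure \<delta> s E \<le> 0 + ennreal e" using * that by simp
  qed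
  then have "hausdorff_measure s E \<le> 0" unfolding hausdorff_measure_def by (intro SUP_least) simp
  then show ?thesis by simp
qed

text \<open>A Borel-Cantelli argument: the families with index at least M cover E for every M, and
  their sums form a geometric tail. Pairs of indices are merged into one sequence by
  \<open>to_nat\<close>, and numbers outside its range get the empty set.\<close>

lemma hausdorff_measure_limsup_zero:
  fixes V :: "nat \<Rightarrow> 'b::countable \<Rightarrow> 'a::metric_space set"
  assumes "0 < s" and bd: "\<And>n w. bounded (V n w)"
    and E: "\<And>x. x \<in> E \<Longrightarrow> \<exists>\<^sub>\<infinity>n. \<exists>w. x \<in> V n w"
    and small: "\<And>n. N \<le> n \<Longrightarrow>
      (\<integral>\<^sup>+w. ennreal (diameter (V n w) powr s) \<partial>count_space UNIV) \<le> ennreal ((1 / 2) ^ n)"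
  shows "hausdorff_measure s E = 0"
proof (rule hausdorff_measure_zeroI[OF \<open>0 < s\<close>])
  fix \<eta> :: real assume "0 < \<eta>"
  then obtain M0 where M0: "(1 / 2 :: real) ^ M0 < \<eta> / 2" using real_arch_pow_inv[of "\<eta> / 2" "1 / 2"] by auto
  define M where "M = max M0 N"
  have "(1 / 2 :: real) ^ M \<le> (1 / 2) ^ M0" by (intro power_decreasing) (auto simp: M_def)
  then have M: "2 * (1 / 2 :: real) ^ M \<le> \<eta>" using M0 by linarith
  define V' :: "nat \<times> 'b \<Rightarrow> 'a set" where "V' p = V (fst p + M) (snd p)" for p
  define U where "U k = (if k \<in> range (to_nat :: nat \<times> 'b \<Rightarrow> nat) then V' (from_nat k) else {})" for k
  define g where "g p = ennreal (diameter (V' p) powr s)" for p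
  have "E \<subseteq> (\<Union>i. U i)"
  proof
    fix x assume "x \<in> E"
    then obtain n w where "M \<le> n" "x \<in> V n w" using E[of x] unfolding INFM_nat_le by blast
    then have "x \<in> V' (n - M, w)" by (simp add: V'_def)
    then have "x \<in> U (to_nat (n - M, w))" by (simp add: U_def)
    then show "x \<in> (\<Union>i. U i)" by blast
  qed
  moreover have "bounded (U i)" for i using bd by (simp add: U_def V'_def)
  moreover have "(\<Sum>i. ennreal (diameter (U i) powr s)) \<le> ennreal \<eta>"
  proof -
    have "(\<Sum>i. ennreal (diameter (U i) powr s)) =
        (\<integral>\<^sup>+k. g (from_nat k) * indicator (range (to_nat :: nat \<times> 'b \<Rightarrow> nat)) k \<partial>count_space UNIV)"
      unfolding nn_integral_count_space_nat by (intro suminf_cong) (auto simp: U_def g_def)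
    also have "\<dots> = (\<integral>\<^sup>+k. g (from_nat k) \<partial>count_space (range (to_nat :: nat \<times> 'b \<Rightarrow> nat)))"
      by (rule nn_integral_count_space_indicator[symmetric]) simp
    also have "\<dots> = (\<integral>\<^sup>+p. g p \<partial>count_space UNIV)"
    proof -
      have "bij_betw (to_nat :: nat \<times> 'b \<Rightarrow> nat) UNIV (range (to_nat :: nat \<times> 'b \<Rightarrow> nat))"
        by (simp add: bij_betw_def)
      from nn_integral_bij_count_space[OF this, of "\<lambda>k. g (from_nat k)"] show ?thesis by simp
    qed
    also have "\<dots> = (\<integral>\<^sup>+n. \<integral>\<^sup>+w. g (n, w) \<partial>count_space UNIV \<partial>count_space UNIV)"
    proof -
      interpret sigma_finite_measure "count_space (UNIV :: 'b set)"
        by (intro sigma_finite_measure_count_space_countable) simp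
      have *: "count_space (UNIV :: nat set) \<Otimes>\<^sub>M count_space (UNIV :: 'b set) = count_space UNIV"
        by (subst pair_measure_countable) auto
      show ?thesis
        by (subst nn_integral_fst[of _ "count_space (UNIV :: nat set)", unfolded *]) auto
    qed
    also have "\<dots> = (\<Sum>n. \<integral>\<^sup>+w. g (n, w) \<partial>count_space UNIV)" by (rule nn_integral_count_space_nat)
    also have "\<dots> \<le> (\<Sum>n. ennreal ((1 / 2) ^ M * (1 / 2) ^ n))"
    proof (rule suminf_le)
      fix n
      have "N \<le> n + M" by (simp add: M_def)
      then show "(\<integral>\<^sup>+w. g (n, w) \<partial>count_space UNIV) \<le> ennreal ((1 / 2) ^ M * (1 / 2) ^ n)"
        using small[of "n + M"] by (simp add: g_def V'_def power_add mult.commute)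
    qed auto
    also have "\<dots> = ennreal (2 * (1 / 2) ^ M)"
      by (subst suminf_ennreal2) (auto simp: suminf_mult suminf_geometric intro!: summable_mult summable_geometric)
    also have "\<dots> \<le> ennreal \<eta>" using M by (rule ennreal_leI)
    finally show ?thesis .
  qed
  ultimately show "\<exists>U :: nat \<Rightarrow> 'a set. E \<subseteq> (\<Union>i. U i) \<and> (\<forall>i. bounded (U i)) \<and>
      (\<Sum>i. ennreal (diameter (U i) powr s)) \<le> ennreal \<eta>" by blast
qed

section \<open>Words cut into blocks that end at the prescribed positions\<close>

lemma prod_blocks_Cons:
  assumes "length u = l"
  shows "(\<Prod>i<Suc n. F (take l (drop (i * l) (u @ v)))) = F u * (\<Prod>i<n. F (take l (drop (i * l) v)))"
  using assms by (subst prod.lessThan_Suc_shift) auto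

lemma nn_integral_prod_blocks:
  fixes g :: "nat list \<Rightarrow> ennreal"
  shows "(\<integral>\<^sup>+w. (\<Prod>i<n. g (take l (drop (i * l) w))) \<partial>count_space (words (n * l))) =
    (\<integral>\<^sup>+u. g u \<partial>count_space (words l)) ^ n"
proof (induction n)
  case 0
  then show ?case by (simp add: nn_integral_count_space_finite)
next
  case (Suc n)
  have "(\<integral>\<^sup>+w. (\<Prod>i<Suc n. g (take l (drop (i * l) w))) \<partial>count_space (words (Suc n * l))) =
      (\<integral>\<^sup>+u. \<integral>\<^sup>+v. (\<Prod>i<Suc n. g (take l (drop (i * l) (u @ v)))) \<partial>count_space (words (n * l)) \<partial>count_space (words l))"
    using nn_integral_words_append[of l "n * l"] by simp
  also have "\<dots> = (\<integral>\<^sup>+u. \<integral>\<^sup>+v. g u * (\<Prod>i<n. g (take l (drop (i * l) v))) \<partial>count_space (words (n * l)) \<partial>count_space (words l))"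
    by (intro nn_integral_cong prod_blocks_Cons) (simp add: words_def)
  finally show ?case using Suc by (simp add: nn_integral_mult_split)
qed

text \<open>Supermultiplicativity of q, used between the blocks and once more inside each block to
  split off its last letter, the prescribed digit.\<close>

lemma prod_blocks_le_cont:
  assumes "w \<in> words (n * l)" "0 < l"
  shows "(\<Prod>i<n. cont (butlast (take l (drop (i * l) w))) * real (last (take l (drop (i * l) w)))) \<le> cont w"
  using assms(1)
proof (induction n arbitrary: w)
  case (Suc n)
  define u v where "u = take l w" and "v = drop l w"
  have w: "w = u @ v" by (simp add: u_def v_def)
  have u: "length u = l" "\<forall>a\<in>set u. 1 \<le> a" and v: "v \<in> words (n * l)"
    using Suc.prems by (auto simp: words_def u_def v_def dest: in_set_takeD in_set_dropD)
  have v1: "\<forall>a\<in>set v. 1 \<le> a" using v by (simp add: words_def)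
  have "u \<noteq> []" using u assms by auto
  then have ue: "u = butlast u @ [last u]" by simp
  then have bl: "\<forall>a\<in>set (butlast u). 1 \<le> a" "1 \<le> last u" using u \<open>u \<noteq> []\<close> by (auto dest: in_set_butlastD)
  have "cont (butlast u) * cont [last u] \<le> cont (butlast u @ [last u])"
    using bl by (intro cont_append_ge) auto
  then have "cont (butlast u) * real (last u) \<le> cont u" using ue by simp
  then have "(cont (butlast u) * real (last u)) *
      (\<Prod>i<n. cont (butlast (take l (drop (i * l) v))) * real (last (take l (drop (i * l) v)))) \<le> cont u * cont v"
    using Suc.IH[OF v] cont_pos[OF u(2)] v
    by (intro mult_mono prod_nonneg) (auto simp: words_def intro!: mult_nonneg_nonneg less_imp_le[OF cont_pos]
        dest!: in_set_butlastD in_set_takeD in_set_dropD)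
  also have "\<dots> \<le> cont w" unfolding w using u v1 by (intro cont_append_ge) auto
  finally show ?case
    unfolding w using prod_blocks_Cons[OF u(1), where F = "\<lambda>c. cont (butlast c) * real (last c)"]
    by (simp only: w)
qed simp

text \<open>Rankin's trick: the constraint on the product of the last digits of the blocks is traded
  for the exponent \<open>r\<close>.\<close>

lemma block_cover_sum_le:
  assumes "0 < l" "0 < M" "0 \<le> r" "0 \<le> s"
  shows "(\<integral>\<^sup>+w. ennreal (cont w powr (-2 * s)) * indicator {w. M \<le> (\<Prod>i<n. real (w ! (Suc i * l - 1)))} w
      \<partial>count_space (words (n * l)))
    \<le> ennreal (M powr (- r)) * (part_fun s (l - 1) * (\<Sum>k. ennreal (real (Suc k) powr (- (2 * s - r))))) ^ n"
proof -
  \<comment> \<open>Of the exponent \<open>2 * s\<close> of a prescribed digit, r is spent on the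
    lower bound M for the product and z remains for the sum over the digit.\<close>
  define z where "z = 2 * s - r"
  define g where "g u = cont (butlast u) powr (-2 * s) * real (last u) powr (- z)" for u
  have "(\<integral>\<^sup>+u. ennreal (g u) \<partial>count_space (words l)) =
      (\<integral>\<^sup>+u. ennreal (g u) \<partial>count_space (words ((l - 1) + 1)))" using assms by simp
  also have "\<dots> = (\<integral>\<^sup>+u. \<integral>\<^sup>+v. ennreal (g (u @ v)) \<partial>count_space (words 1) \<partial>count_space (words (l - 1)))"
    by (rule nn_integral_words_append)
  also have "\<dots> = (\<integral>\<^sup>+u. \<integral>\<^sup>+v. ennreal (cont u powr (-2 * s)) * ennreal (real (last v) powr (- z))
      \<partial>count_space (words 1) \<partial>count_space (words (l - 1)))"
  proof (intro nn_integral_cong)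
    fix u v assume "v \<in> space (count_space (words 1))"
    then obtain a where "v = [a]" by (auto simp: words_def length_Suc_conv)
    then show "ennreal (g (u @ v)) = ennreal (cont u powr (-2 * s)) * ennreal (real (last v) powr (- z))"
      by (simp add: g_def ennreal_mult)
  qed
  finally have g_int: "(\<integral>\<^sup>+u. ennreal (g u) \<partial>count_space (words l)) =
      part_fun s (l - 1) * (\<Sum>k. ennreal (real (Suc k) powr (- z)))"
    unfolding nn_integral_mult_split nn_integral_words_1 part_fun_def by (simp add: nn_integral_multc)
  have "(\<integral>\<^sup>+w. ennreal (cont w powr (-2 * s)) * indicator {w. M \<le> (\<Prod>i<n. real (w ! (Suc i * l - 1)))} w
      \<partial>count_space (words (n * l)))
    \<le> (\<integral>\<^sup>+w. ennreal (M powr (- r)) * (\<Prod>i<n. ennreal (g (take l (drop (i * l) w)))) \<partial>count_space (words (n * l)))"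
  proof (rule nn_integral_mono)
    fix w assume "w \<in> space (count_space (words (n * l)))"
    then have w: "w \<in> words (n * l)" by simp
    define c where "c i = take l (drop (i * l) w)" for i
    define Q P where "Q = (\<Prod>i<n. cont (butlast (c i)))" and "P = (\<Prod>i<n. real (last (c i)))"
    have c: "cont (butlast (c i)) > 0 \<and> real (last (c i)) > 0 \<and> last (c i) = w ! (Suc i * l - 1)"
      if "i < n" for i
    proof -
      have "Suc i * l \<le> n * l" using that by (intro mult_le_mono1) simp
      then have len: "length (c i) = l" using wordsD[OF w] by (simp add: c_def)
      have "last (c i) = c i ! (l - 1)" using len assms by (subst last_conv_nth) auto
      also have "\<dots> = w ! (Suc i * l - 1)"
      proof -
        have "i * l \<le> length w" "i * l + (l - 1) = Suc i * l - 1"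
          using assms that wordsD[OF w] by simp_all
        then show ?thesis using assms nth_drop[of "i * l" w "l - 1"] by (simp only: c_def) simp
      qed
      finally have l: "last (c i) = w ! (Suc i * l - 1)" .
      have "\<forall>a\<in>set (c i). 1 \<le> a"
        using wordsD[OF w] by (auto simp: c_def dest: in_set_takeD in_set_dropD)
      moreover from this have "\<forall>a\<in>set (butlast (c i)). 1 \<le> a" by (auto dest: in_set_butlastD)
      moreover have "c i \<noteq> []" using len assms by auto
      ultimately show ?thesis using l cont_pos[of "butlast (c i)"] last_in_set[of "c i"] by fastforce
    qed
    have "Q > 0" unfolding Q_def using c by (intro prod_pos) blast
    moreover have "P > 0" unfolding P_def using c by (intro prod_pos) blast
    ultimately have "Q > 0" "P > 0" .
    have P: "P = (\<Prod>i<n. real (w ! (Suc i * l - 1)))" using c by (simp add: P_def)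
    have prod: "(\<Prod>i<n. ennreal (g (c i))) = ennreal (Q powr (-2 * s) * P powr (- z))"
      using c by (simp add: prod_ennreal g_def prod.distrib Q_def P_def prod_powr_distrib less_imp_le)
    show "ennreal (cont w powr (-2 * s)) * indicator {w. M \<le> (\<Prod>i<n. real (w ! (Suc i * l - 1)))} w \<le>
        ennreal (M powr (- r)) * (\<Prod>i<n. ennreal (g (take l (drop (i * l) w))))"
    proof (cases "M \<le> P")
      case True
      have "cont w powr (-2 * s) \<le> (Q * P) powr (-2 * s)"
        using prod_blocks_le_cont[OF w assms(1)] \<open>Q > 0\<close> \<open>P > 0\<close> assms
        by (intro powr_mono2') (auto simp: c_def[symmetric] prod.distrib Q_def P_def)
      also have "\<dots> = P powr (- r) * (Q powr (-2 * s) * P powr (- z))"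
        using \<open>Q > 0\<close> \<open>P > 0\<close> by (simp add: powr_mult powr_add[symmetric] z_def)
      also have "\<dots> \<le> M powr (- r) * (Q powr (-2 * s) * P powr (- z))"
        using True assms by (intro mult_right_mono powr_mono2') auto
      finally show ?thesis using True P
        by (simp add: c_def[symmetric] prod ennreal_mult[symmetric] ennreal_leI)
    next
      case False
      then show ?thesis using P by simp
    qed
  qed
  also have "\<dots> = ennreal (M powr (- r)) * (part_fun s (l - 1) * (\<Sum>k. ennreal (real (Suc k) powr (- z)))) ^ n"
    by (subst nn_integral_cmult, simp)
      (subst nn_integral_prod_blocks[where g = "\<lambda>u. ennreal (g u)"], simp only: g_int)
  finally show ?thesis by (simp add: z_def)
qed

text \<open>The product is positive, so its last factor, of index \<open>n * f\<close>, is not 0. As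
  0 is a fixed point of \<open>gauss_map\<close>, no earlier iterate vanishes either, and the first
  \<open>n * f\<close> digits are genuine.\<close>

lemma large_product_set_cylinder:
  fixes d t n :: nat and B :: real
  defines "f \<equiv> d * n + t"
  assumes "0 < n" "0 < d" "1 \<le> B" "x \<in> {0..<1}"
    and prod: "(\<Prod>i=1..n. real_of_int (partial_quotient (i * f) x)) \<ge> B ^ (d * n\<^sup>2)"
  shows "\<exists>w\<in>words (n * f). B ^ (d * n\<^sup>2) \<le> (\<Prod>i<n. real (w ! (Suc i * f - 1))) \<and> x \<in> cf_eval w ` {0..1}"
proof -
  have "0 < f" using assms by (simp add: f_def)
  have "0 < B ^ (d * n\<^sup>2)" using assms by simp
  then have "(\<Prod>i=1..n. real_of_int (partial_quotient (i * f) x)) \<noteq> 0" using prod by linarith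
  then have "partial_quotient (n * f) x \<noteq> 0" using \<open>0 < n\<close> by (auto simp: prod_zero_iff)
  then have nz: "(gauss_map ^^ (n * f - 1)) x \<noteq> 0" by (auto simp: partial_quotient_def)
  have nz': "\<forall>j<n * f. (gauss_map ^^ j) x \<noteq> 0"
  proof (intro allI impI notI)
    fix j assume "j < n * f" "(gauss_map ^^ j) x = 0"
    then have "(gauss_map ^^ ((n * f - 1 - j) + j)) x = 0" unfolding funpow_add by simp
    then show False using nz \<open>j < n * f\<close> by simp
  qed
  define w where "w = map (\<lambda>j. nat (partial_quotient (Suc j) x)) [0..<n * f]"
  note ex = cf_eval_expansion[of x "n * f", OF _ _ nz', folded w_def]
  have "w \<in> words (n * f)" using ex(1) assms by (simp add: words_def w_def)
  moreover have "x \<in> cf_eval w ` {0..1}" using ex(2-4) assms by (metis atLeastAtMost_iff atLeastLessThan_iff image_eqI less_imp_le)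
  moreover have "(\<Prod>i<n. real (w ! (Suc i * f - 1))) = (\<Prod>i<n. real_of_int (partial_quotient (Suc i * f) x))"
  proof (rule prod.cong)
    fix i assume "i \<in> {..<n}"
    then have "Suc i * f \<le> n * f" by (intro mult_le_mono1) simp
    moreover have "0 < Suc i * f" using \<open>0 < f\<close> by simp
    ultimately have j: "Suc i * f - 1 < n * f" "Suc (Suc i * f - 1) = Suc i * f" by linarith+
    have "1 \<le> partial_quotient (Suc i * f) x" using ex(5) assms j by (metis atLeastLessThan_iff)
    moreover have "w ! (Suc i * f - 1) = nat (partial_quotient (Suc i * f) x)"
      using j by (simp add: w_def del: mult_Suc)
    ultimately show "real (w ! (Suc i * f - 1)) = real_of_int (partial_quotient (Suc i * f) x)" by simp
  qed simp
  moreover have "(\<Prod>i<n. real_of_int (partial_quotient (Suc i * f) x)) =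
      (\<Prod>i=1..n. real_of_int (partial_quotient (i * f) x))"
    by (rule prod.reindex_bij_witness[of _ "\<lambda>i. i - 1" Suc]) auto
  ultimately show ?thesis using prod by metis
qed

lemma hausdorff_measure_large_product_set:
  assumes "1 \<le> d" "1 \<le> B" "1 / 2 < s" "geom_pressure s \<le> (2 * s - 1) * ln B" "s < s'"
  shows "hausdorff_measure s' (large_product_set d t B) = 0"
proof -
  define f where "f n = d * n + t" for n
  \<comment> \<open>Taken from s and not from s': then \<open>2 * s' - r\<close> = 1 + 2 (s' - s)
    exceeds 1 and the zeta series converges.\<close>
  define r where "r = 2 * s - 1"
  \<comment> \<open>\<open>part_fun_decay\<close> gains 2 \<epsilon> per digit. One \<epsilon> pays
    for the approximation of the pressure by \<open>log_part\<close>, the other beats C and the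
    shift t.\<close>
  define \<epsilon> where "\<epsilon> = (s' - s) * ln 2 / 2"
  have "0 < \<epsilon>" using assms by (simp add: \<epsilon>_def)
  have "0 < r" using assms by (simp add: r_def)
  define A where "A n = {w \<in> words (n * f n). B ^ (d * n\<^sup>2) \<le> (\<Prod>i<n. real (w ! (Suc i * f n - 1)))}" for n
  define V where "V n w = (if w \<in> A n then cf_eval w ` {0..1} else {})" for n w
  have "(\<Sum>k. ennreal (real (Suc k) powr (- (2 * s' - r)))) < top"
    using assms by (subst zeta_finite_iff) (simp add: r_def)
  then obtain C where C: "0 \<le> C" "(\<Sum>k. ennreal (real (Suc k) powr (- (2 * s' - r)))) = ennreal C"
    by (metis ennreal_cases less_irrefl)
  have "eventually (\<lambda>n. log_part s n / real n < geom_pressure s + \<epsilon>) sequentially"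
    using geom_pressure_LIMSEQ[OF assms(3)] \<open>0 < \<epsilon>\<close> by (intro order_tendstoD) auto
  then obtain K where K: "\<And>k. K \<le> k \<Longrightarrow> log_part s k / real k < geom_pressure s + \<epsilon>"
    by (auto simp: eventually_sequentially)
  \<comment> \<open>With f(n) in place of n this is the factor contributed by one block. Once it is
    below 1/2, the n blocks together give the (1/2)^n that the limsup lemma asks for.\<close>
  have "(\<lambda>n. C * exp (r * real t * ln B + 2 * \<epsilon>) * exp (- \<epsilon> * (real n - 1))) \<longlonglongrightarrow> 0"
    using \<open>0 < \<epsilon>\<close> by real_asymp
  then have "eventually (\<lambda>n. C * exp (r * real t * ln B + 2 * \<epsilon>) * exp (- \<epsilon> * (real n - 1)) < 1 / 2) sequentially"
    by (rule order_tendstoD) simp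
  then obtain N0 where N0: "\<And>n. N0 \<le> n \<Longrightarrow>
      C * exp (r * real t * ln B + 2 * \<epsilon>) * exp (- \<epsilon> * (real n - 1)) < 1 / 2"
    by (auto simp: eventually_sequentially)
  have diam: "ennreal (diameter (V n w) powr s') \<le> ennreal (cont w powr (-2 * s')) * indicator (A n) w" for n w
  proof (cases "w \<in> A n")
    case True
    then have w: "\<forall>a\<in>set w. 1 \<le> a" by (auto simp: A_def words_def)
    have "diameter (cf_eval w ` {0..1}) \<le> 1 / (cont w)\<^sup>2"
      using cf_eval_diff_le[OF w] by (intro diameter_le) (auto simp: dist_real_def)
    then have "diameter (cf_eval w ` {0..1}) powr s' \<le> (1 / (cont w)\<^sup>2) powr s'"
      using assms w by (intro powr_mono2 diameter_ge_0)
        (auto intro!: compact_imp_bounded compact_continuous_image continuous_on_cf_eval)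
    also have "1 / (cont w)\<^sup>2 = cont w powr (- 2)"
      using cont_pos[OF w] by (simp add: powr_minus powr_numeral field_simps)
    finally show ?thesis using True by (simp add: V_def powr_powr ennreal_leI)
  qed (simp add: V_def)
  show ?thesis
  proof (rule hausdorff_measure_limsup_zero[where V = V and N = "N0 + K + 2"])
    show "0 < s'" using assms by simp
    show "bounded (V n w)" for n w
    proof (cases "w \<in> A n")
      case True
      then show ?thesis by (auto simp: V_def A_def words_def
            intro!: compact_imp_bounded compact_continuous_image continuous_on_cf_eval)
    qed (simp add: V_def)
    show "\<exists>\<^sub>\<infinity>n. \<exists>w. x \<in> V n w" if "x \<in> large_product_set d t B" for x
    proof -
      from that have x: "x \<in> {0..<1}" and inf: "\<exists>\<^sub>\<infinity>n. (\<Prod>i=1..n. real_of_int (partial_quotient (i * (d * n + t)) x))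
          \<ge> B ^ (d * n\<^sup>2)" by (auto simp: large_product_set_def)
      have "\<exists>\<^sub>\<infinity>n. 0 < n \<and> (\<Prod>i=1..n. real_of_int (partial_quotient (i * (d * n + t)) x)) \<ge> B ^ (d * n\<^sup>2)"
      proof -
        have "\<forall>\<^sub>\<infinity>n. 0 < (n::nat)" unfolding MOST_nat by blast
        from frequently_eventually_frequently[OF inf this] show ?thesis by (simp only: conj_commute)
      qed
      then show ?thesis
      proof (rule INFM_mono)
        fix n assume "0 < n \<and> (\<Prod>i=1..n. real_of_int (partial_quotient (i * (d * n + t)) x)) \<ge> B ^ (d * n\<^sup>2)"
        then have "\<exists>w\<in>words (n * f n). B ^ (d * n\<^sup>2) \<le> (\<Prod>i<n. real (w ! (Suc i * f n - 1))) \<and> x \<in> cf_eval w ` {0..1}"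
          unfolding f_def using assms x by (intro large_product_set_cylinder) auto
        then show "\<exists>w. x \<in> V n w" by (auto simp: V_def A_def)
      qed
    qed
    show "(\<integral>\<^sup>+w. ennreal (diameter (V n w) powr s') \<partial>count_space UNIV) \<le> ennreal ((1 / 2) ^ n)"
      if n: "N0 + K + 2 \<le> n" for n
    proof -
      define k where "k = f n - 1"
      have "1 * n \<le> d * n" using assms by (intro mult_le_mono1) simp
      then have fn: "n \<le> f n" unfolding f_def by linarith
      then have k: "K \<le> k" "0 < k" "real k = real (f n) - 1" using n by (auto simp: k_def of_nat_diff)
      have "part_fun s' k \<le> ennreal (2 powr (- (s' - s) * (real k - 1))) * part_fun s k"
        using assms by (intro part_fun_decay) simp
      also have "\<dots> = ennreal (exp (- 2 * \<epsilon> * (real k - 1) + log_part s k))"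
      proof -
        have "- (s' - s) * (real k - 1) * ln 2 = - 2 * \<epsilon> * (real k - 1)"
          by (simp add: \<epsilon>_def algebra_simps)
        then have "2 powr (- (s' - s) * (real k - 1)) = exp (- 2 * \<epsilon> * (real k - 1))"
          by (simp only: powr_def) simp
        then show ?thesis
          using assms by (simp only: part_fun_eq_exp[OF assms(3)] ennreal_mult'[symmetric] exp_add exp_ge_zero)
      qed
      also have "\<dots> \<le> ennreal (exp (- \<epsilon> * (real k - 2) + r * ln B * real (f n)))"
      proof -
        have "log_part s k < (geom_pressure s + \<epsilon>) * real k" using K[OF k(1)] k by (simp add: pos_divide_less_eq)
        also have "\<dots> \<le> (r * ln B + \<epsilon>) * real k"
          using assms by (intro mult_right_mono) (auto simp: r_def)
        also have "\<dots> \<le> r * ln B * real (f n) + \<epsilon> * real k"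
        proof -
          have "r * ln B * real k \<le> r * ln B * real (f n)"
            using \<open>0 < r\<close> assms k by (intro mult_left_mono) auto
          then show ?thesis by (simp add: algebra_simps)
        qed
        finally show ?thesis by (intro ennreal_leI) (simp add: algebra_simps)
      qed
      finally have pf: "part_fun s' k \<le> ennreal (exp (- \<epsilon> * (real k - 2) + r * ln B * real (f n)))" .
      have "(\<integral>\<^sup>+w. ennreal (diameter (V n w) powr s') \<partial>count_space UNIV)
          \<le> (\<integral>\<^sup>+w. ennreal (cont w powr (-2 * s')) * indicator (A n) w \<partial>count_space UNIV)"
        using diam by (intro nn_integral_mono) simp
      also have "\<dots> = (\<integral>\<^sup>+w. (ennreal (cont w powr (-2 * s')) *
          indicator {w. B ^ (d * n\<^sup>2) \<le> (\<Prod>i<n. real (w ! (Suc i * f n - 1)))} w) * indicator (words (n * f n)) w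
          \<partial>count_space UNIV)"
        by (intro nn_integral_cong) (auto simp: A_def indicator_def)
      also have "\<dots> = (\<integral>\<^sup>+w. ennreal (cont w powr (-2 * s')) *
          indicator {w. B ^ (d * n\<^sup>2) \<le> (\<Prod>i<n. real (w ! (Suc i * f n - 1)))} w
          \<partial>count_space (words (n * f n)))"
        by (rule nn_integral_count_space_indicator[symmetric]) simp
      also have "\<dots> \<le> ennreal ((B ^ (d * n\<^sup>2)) powr (- r)) *
          (part_fun s' k * (\<Sum>k. ennreal (real (Suc k) powr (- (2 * s' - r))))) ^ n"
        unfolding k_def using fn n assms \<open>0 < r\<close> by (intro block_cover_sum_le) auto
      also have "\<dots> \<le> ennreal ((B ^ (d * n\<^sup>2)) powr (- r)) *
          (ennreal (exp (- \<epsilon> * (real k - 2) + r * ln B * real (f n))) * ennreal C) ^ n"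
        unfolding C(2) by (intro mult_left_mono power_mono mult_right_mono pf) auto
      also have "(B ^ (d * n\<^sup>2)) powr (- r) = exp (- r * ln B * real (d * n)) ^ n"
        using assms by (simp add: powr_def ln_realpow exp_of_nat_mult[symmetric] power2_eq_square algebra_simps)
      also have "ennreal (exp (- r * ln B * real (d * n)) ^ n) *
          (ennreal (exp (- \<epsilon> * (real k - 2) + r * ln B * real (f n))) * ennreal C) ^ n =
          ennreal ((exp (- r * ln B * real (d * n)) * (exp (- \<epsilon> * (real k - 2) + r * ln B * real (f n)) * C)) ^ n)"
        using C(1) by (simp add: ennreal_mult[symmetric] ennreal_power power_mult_distrib)
      also have "exp (- r * ln B * real (d * n)) * (exp (- \<epsilon> * (real k - 2) + r * ln B * real (f n)) * C) =
          C * exp (r * real t * ln B + 2 * \<epsilon>) * exp (- \<epsilon> * (real (f n) - 1))"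
      proof -
        have "- r * ln B * real (d * n) + (- \<epsilon> * (real k - 2) + r * ln B * real (f n)) =
            (r * real t * ln B + 2 * \<epsilon>) + - \<epsilon> * (real (f n) - 1)"
          unfolding k(3) by (simp add: f_def algebra_simps)
        then have "exp (- r * ln B * real (d * n)) * exp (- \<epsilon> * (real k - 2) + r * ln B * real (f n)) =
            exp (r * real t * ln B + 2 * \<epsilon>) * exp (- \<epsilon> * (real (f n) - 1))"
          unfolding exp_add[symmetric] by (rule arg_cong)
        then show ?thesis by (simp only: mult_ac)
      qed
      also have "ennreal ((C * exp (r * real t * ln B + 2 * \<epsilon>) * exp (- \<epsilon> * (real (f n) - 1))) ^ n) \<le> ennreal ((1 / 2) ^ n)"
        using N0[of "f n"] fn n C(1) by (intro ennreal_leI power_mono) auto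
      finally show ?thesis .
    qed
  qed
qed


section \<open>A mass distribution principle for products of words\<close>

text \<open>Independent choices at all stages define a product probability measure, and countable
  subadditivity applies to the cylinders that cover its whole space.\<close>

lemma product_cover_ge_1:
  fixes W :: "nat \<Rightarrow> 'a set" and wt :: "nat \<Rightarrow> 'a \<Rightarrow> real"
  assumes fin: "\<And>i. finite (W i)" and nonneg: "\<And>i w. w \<in> W i \<Longrightarrow> 0 \<le> wt i w"
    and one: "\<And>i. sum (wt i) (W i) = 1"
    and sub: "\<And>k j. V k j \<subseteq> W j"
    and cover: "\<And>\<omega>. (\<And>i. \<omega> i \<in> W i) \<Longrightarrow> \<exists>k::nat. \<forall>j\<le>l k. \<omega> j \<in> V k j"
  shows "1 \<le> (\<Sum>k. ennreal (\<Prod>j\<le>l k. sum (wt j) (V k j)))"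
proof -
  define M where "M i = point_measure (W i) (\<lambda>w. ennreal (wt i w))" for i
  have em: "emeasure (M i) X = ennreal (sum (wt i) X)" if "X \<subseteq> W i" for i X
    using that fin nonneg unfolding M_def
    by (subst emeasure_point_measure_finite) (auto intro!: sum_ennreal)
  interpret product_prob_space M UNIV
  proof (rule product_prob_spaceI)
    show "prob_space (M i)" for i
      using em[of "W i" i] one by (intro prob_spaceI) (simp add: M_def space_point_measure)
  qed
  have space_M [simp]: "space (M i) = W i" for i by (simp add: M_def space_point_measure)
  define R where "R k = {\<omega> \<in> space (PiM UNIV M). \<forall>j\<in>{..l k}. \<omega> j \<in> V k j}" for k
  have V_sets: "V k j \<in> sets (M j)" for k j
    using sub by (simp add: M_def sets_point_measure)
  have eR: "emeasure (PiM UNIV M) (R k) = ennreal (\<Prod>j\<le>l k. sum (wt j) (V k j))" for k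
  proof -
    have "emeasure (PiM UNIV M) (R k) = (\<Prod>j\<le>l k. emeasure (M j) (V k j))"
      unfolding R_def using V_sets by (intro emeasure_PiM_Collect) auto
    also have "\<dots> = (\<Prod>j\<le>l k. ennreal (sum (wt j) (V k j)))" using em sub by simp
    also have "\<dots> = ennreal (\<Prod>j\<le>l k. sum (wt j) (V k j))"
      using sub nonneg by (intro prod_ennreal sum_nonneg) blast
    finally show ?thesis .
  qed
  have R_sets: "R k \<in> sets (PiM UNIV M)" for k
    unfolding R_def using V_sets by (intro sets.sets_Collect_finite_All) auto
  have "space (PiM UNIV M) \<subseteq> (\<Union>k. R k)"
  proof
    fix \<omega> assume \<omega>: "\<omega> \<in> space (PiM UNIV M)"
    then have "\<omega> i \<in> W i" for i by (auto simp: space_PiM)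
    from cover[of \<omega>, OF this] show "\<omega> \<in> (\<Union>k. R k)" using \<omega> by (auto simp: R_def)
  qed
  then have "emeasure (PiM UNIV M) (space (PiM UNIV M)) \<le> emeasure (PiM UNIV M) (\<Union>k. R k)"
    using R_sets by (intro emeasure_mono) auto
  also have "\<dots> \<le> (\<Sum>k. emeasure (PiM UNIV M) (R k))"
    using R_sets by (intro emeasure_subadditive_countably) auto
  finally show ?thesis using eR P.emeasure_space_1 by simp
qed

lemma suminf_ennreal_linear:
  assumes "0 \<le> c" "\<And>i. 0 \<le> f i" "\<And>i. 0 \<le> g i"
  shows "(\<Sum>i. ennreal (c * f i + g i)) = ennreal c * (\<Sum>i. ennreal (f i)) + (\<Sum>i. ennreal (g i))"
  using assms by (simp add: ennreal_plus ennreal_mult suminf_add[symmetric])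

text \<open>The \<open>i\<close>-th stage chooses a word from \<open>W i\<close> with probability \<open>wt i\<close>; \<open>\<Psi> i\<close> bounds the
  ratio between the mass of a cylinder after \<open>i\<close> stages and the \<open>s\<close>-th power of its length.
  In \<open>separated\<close>, \<open>V\<close> collects the words at stage \<open>i\<close> that a set of diameter \<open>r\<close> can meet, after
  rescaling by the preceding stages.\<close>

locale cantor_scheme =
  fixes W :: "nat \<Rightarrow> nat list set" and wt :: "nat \<Rightarrow> nat list \<Rightarrow> real"
    and s \<delta> C :: real and \<Psi> :: "nat \<Rightarrow> real"
  assumes s_pos: "0 < s" and C_pos: "0 < C"
    and fin_W: "\<And>i. finite (W i)"
    and word_nonempty: "\<And>i w. w \<in> W i \<Longrightarrow> w \<noteq> []"
    and word_pos: "\<And>i w. w \<in> W i \<Longrightarrow> \<forall>a\<in>set w. 1 \<le> a"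
    and wt_nonneg: "\<And>i w. w \<in> W i \<Longrightarrow> 0 \<le> wt i w"
    and wt_sum: "\<And>i. sum (wt i) (W i) = 1"
    and \<Psi>_0: "\<Psi> 0 = 1"
    and \<Psi>_step: "\<And>i w. w \<in> W i \<Longrightarrow> wt i w * (2 * cont w) powr (2 * s) * \<Psi> i \<le> \<Psi> (Suc i)"
    and \<Psi>_le: "\<And>i. \<Psi> i \<le> C"
    and tail: "\<And>i w z. w \<in> W i \<Longrightarrow> 0 \<le> z \<Longrightarrow> z \<le> 1 \<Longrightarrow> cf_eval w z \<le> 1 - \<delta>"
    and separated: "\<And>i V r u v. V \<subseteq> W i \<Longrightarrow> u \<in> V \<Longrightarrow> v \<in> V \<Longrightarrow> u \<noteq> v \<Longrightarrow> 0 \<le> r \<Longrightarrow>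
      (\<And>u v. u \<in> V \<Longrightarrow> v \<in> V \<Longrightarrow> \<exists>z\<in>{0..1 - \<delta>}. \<exists>z'\<in>{0..1 - \<delta>}. \<bar>cf_eval u z - cf_eval v z'\<bar> \<le> r) \<Longrightarrow>
      \<Psi> i * sum (wt i) V \<le> C * r powr s"
begin

definition word_upto :: "(nat \<Rightarrow> nat list) \<Rightarrow> nat \<Rightarrow> nat list" where
  "word_upto \<omega> n = concat (map \<omega> [0..<n])"

lemma word_upto_0 [simp]: "word_upto \<omega> 0 = []" and word_upto_Suc: "word_upto \<omega> (Suc n) = word_upto \<omega> n @ \<omega> n"
  by (simp_all add: word_upto_def)

lemma word_upto_pos: "(\<And>i. \<omega> i \<in> W i) \<Longrightarrow> \<forall>a\<in>set (word_upto \<omega> n). 1 \<le> a"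
  using word_pos by (fastforce simp: word_upto_def)

lemma length_word_upto_ge: "(\<And>i. \<omega> i \<in> W i) \<Longrightarrow> n \<le> length (word_upto \<omega> n)"
proof (induction n)
  case (Suc n)
  have "\<omega> n \<noteq> []" using Suc.prems word_nonempty by blast
  then have "1 \<le> length (\<omega> n)" by (simp add: Suc_leI)
  then show ?case unfolding word_upto_Suc length_append using Suc.IH[OF Suc.prems] by linarith
qed simp

text \<open>The 2 in \<open>\<Psi>_step\<close> is the constant of \<open>cont_append_le\<close>:
  attaching a word multiplies the denominator by at most \<open>2 * cont (\<omega> n)\<close>, so
  the steps multiply up.\<close>

lemma word_upto_mass:
  assumes "\<And>i. \<omega> i \<in> W i"
  shows "(\<Prod>j<n. wt j (\<omega> j)) * cont (word_upto \<omega> n) powr (2 * s) \<le> \<Psi> n"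
proof (induction n)
  case 0
  then show ?case by (simp add: \<Psi>_0)
next
  case (Suc n)
  define m where "m = (\<Prod>j<n. wt j (\<omega> j))"
  have m: "0 \<le> m" unfolding m_def using wt_nonneg[OF assms] by (simp add: prod_nonneg)
  have pos: "0 < cont (word_upto \<omega> n)" "0 < cont (\<omega> n)" "0 < cont (word_upto \<omega> (Suc n))"
    using cont_pos[OF word_upto_pos[OF assms]] cont_pos[OF word_pos[OF assms]] by auto
  have "cont (word_upto \<omega> (Suc n)) \<le> cont (word_upto \<omega> n) * (2 * cont (\<omega> n))"
    using cont_append_le[OF word_upto_pos[OF assms] word_pos[OF assms], of n n]
    by (simp add: word_upto_Suc mult_ac)
  then have "cont (word_upto \<omega> (Suc n)) powr (2 * s) \<le> (cont (word_upto \<omega> n) * (2 * cont (\<omega> n))) powr (2 * s)"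
    using s_pos pos by (intro powr_mono2) auto
  also have "\<dots> = cont (word_upto \<omega> n) powr (2 * s) * (2 * cont (\<omega> n)) powr (2 * s)"
    by (rule powr_mult)
  finally have "(m * wt n (\<omega> n)) * cont (word_upto \<omega> (Suc n)) powr (2 * s) \<le>
      (m * wt n (\<omega> n)) * (cont (word_upto \<omega> n) powr (2 * s) * (2 * cont (\<omega> n)) powr (2 * s))"
    using m wt_nonneg assms by (intro mult_left_mono) auto
  also have "\<dots> = (wt n (\<omega> n) * (2 * cont (\<omega> n)) powr (2 * s)) * (m * cont (word_upto \<omega> n) powr (2 * s))"
    by (simp only: mult_ac)
  also have "\<dots> \<le> (wt n (\<omega> n) * (2 * cont (\<omega> n)) powr (2 * s)) * \<Psi> n"
    using Suc wt_nonneg assms by (intro mult_left_mono) (auto simp: m_def)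
  also have "\<dots> \<le> \<Psi> (Suc n)" using \<Psi>_step assms by blast
  finally show ?case by (simp add: m_def)
qed

text \<open>Denominators grow exponentially with the number of stages while \<Psi> stays bounded, so
  cylinder masses tend to 0. Needed for a covering set that catches a single sequence, since its
  diameter may be 0.\<close>

lemma word_upto_mass_tendsto:
  assumes "\<And>i. \<omega> i \<in> W i" "0 < \<gamma>"
  shows "\<exists>n. (\<Prod>j\<le>n. wt j (\<omega> j)) < \<gamma>"
proof -
  have "(\<lambda>n. C * (2 powr ((real n - 1) / 2)) powr (- 2 * s)) \<longlonglongrightarrow> 0"
    using s_pos C_pos by real_asymp
  then have "eventually (\<lambda>n. C * (2 powr ((real n - 1) / 2)) powr (- 2 * s) < \<gamma>) sequentially"
    using assms by (intro order_tendstoD) auto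
  then obtain n where "\<And>m. n \<le> m \<Longrightarrow> C * (2 powr ((real m - 1) / 2)) powr (- 2 * s) < \<gamma>"
    by (auto simp: eventually_sequentially)
  from this[of "Suc n"] have n: "C * (2 powr ((real (Suc n) - 1) / 2)) powr (- 2 * s) < \<gamma>" by simp
  define q where "q = cont (word_upto \<omega> (Suc n))"
  have "real (length (word_upto \<omega> (Suc n))) \<le> real (2 * (length (word_upto \<omega> (Suc n)) div 2) + 1)"
    unfolding of_nat_le_iff by simp
  then have "(real (Suc n) - 1) / 2 \<le> real (length (word_upto \<omega> (Suc n)) div 2)"
    using length_word_upto_ge[of \<omega> "Suc n", OF assms(1)] by simp
  then have "2 powr ((real (Suc n) - 1) / 2) \<le> 2 powr real (length (word_upto \<omega> (Suc n)) div 2)"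
    by (intro powr_mono) auto
  also have "\<dots> \<le> q"
    using cont_ge_power2[OF word_upto_pos[OF assms(1)], of "Suc n"] by (simp add: powr_realpow q_def)
  finally have q: "2 powr ((real (Suc n) - 1) / 2) \<le> q" "0 < q"
    using cont_pos[OF word_upto_pos[OF assms(1)], of "Suc n"] by (simp_all add: q_def)
  have "(\<Prod>j\<le>n. wt j (\<omega> j)) * q powr (2 * s) \<le> C"
    using word_upto_mass[of \<omega> "Suc n", OF assms(1)] \<Psi>_le[of "Suc n"] by (simp add: q_def lessThan_Suc_atMost)
  then have "(\<Prod>j\<le>n. wt j (\<omega> j)) \<le> C * q powr (- 2 * s)"
    using q by (simp add: powr_minus field_simps)
  also have "\<dots> \<le> C * (2 powr ((real (Suc n) - 1) / 2)) powr (- 2 * s)"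
    using q C_pos s_pos by (intro mult_left_mono powr_mono2') auto
  finally show ?thesis using n by (intro exI[of _ n]) linarith
qed

text \<open>The mass estimate for one covering set. All sequences of S share their words before the
  first stage l at which some of them differ. Undoing this common prefix enlarges distances by at
  most \<open>4 * q^2\<close>, and \<open>separated\<close> then bounds the mass of the words
  occurring at stage l. The slack \<gamma> covers the case of a single sequence.\<close>

lemma ball_mass:
  assumes Y: "\<And>\<omega>. \<omega> \<in> S \<Longrightarrow> (\<forall>i. \<omega> i \<in> W i) \<and>
      (\<forall>i. 0 < Y \<omega> i \<and> Y \<omega> i < 1 \<and> Y \<omega> i = cf_eval (\<omega> i) (Y \<omega> (Suc i)))"
    and diam: "\<And>\<omega> \<omega>'. \<omega> \<in> S \<Longrightarrow> \<omega>' \<in> S \<Longrightarrow> \<bar>Y \<omega> 0 - Y \<omega>' 0\<bar> \<le> r" and "0 \<le> r" "0 < \<gamma>"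
  shows "\<exists>l V. (\<forall>j. V j \<subseteq> W j) \<and> (\<forall>\<omega>\<in>S. \<forall>j\<le>l. \<omega> j \<in> V j) \<and>
      (\<Prod>j\<le>l. sum (wt j) (V j)) \<le> C * 4 powr s * r powr s + \<gamma>"
proof (cases "S = {}")
  case True
  then show ?thesis using C_pos \<open>0 < \<gamma>\<close>
    by (intro exI[of _ 0] exI[of _ "\<lambda>_. {}"]) auto
next
  case False
  then obtain \<omega>0 where \<omega>0: "\<omega>0 \<in> S" by auto
  then have W0: "\<And>i. \<omega>0 i \<in> W i" using Y by blast
  show ?thesis
  proof (cases "\<exists>l. \<exists>\<omega>\<in>S. \<omega> l \<noteq> \<omega>0 l")
    case False
    obtain l where "(\<Prod>j\<le>l. wt j (\<omega>0 j)) < \<gamma>" using word_upto_mass_tendsto[OF W0 \<open>0 < \<gamma>\<close>] by auto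
    moreover have "0 \<le> C * 4 powr s * r powr s" using C_pos by simp
    ultimately have "(\<Prod>j\<le>l. wt j (\<omega>0 j)) \<le> C * 4 powr s * r powr s + \<gamma>" by linarith
    then show ?thesis using False W0 by (intro exI[of _ l] exI[of _ "\<lambda>j. {\<omega>0 j}"]) auto
  next
    case True
    define l where "l = (LEAST l. \<exists>\<omega>\<in>S. \<omega> l \<noteq> \<omega>0 l)"
    obtain \<omega>1 where \<omega>1: "\<omega>1 \<in> S" "\<omega>1 l \<noteq> \<omega>0 l" using LeastI_ex[OF True] by (auto simp: l_def)
    have agree: "\<omega> j = \<omega>0 j" if "\<omega> \<in> S" "j < l" for \<omega> j
      using not_less_Least[of j "\<lambda>l. \<exists>\<omega>\<in>S. \<omega> l \<noteq> \<omega>0 l"] that by (auto simp: l_def)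
    define p where "p = word_upto \<omega>0 l"
    have p_pos: "\<forall>a\<in>set p. 1 \<le> a" using word_upto_pos[OF W0] by (simp add: p_def)
    define q where "q = cont p"
    have q: "0 < q" using cont_pos[OF p_pos] by (simp add: q_def)
    have Yp: "Y \<omega> 0 = cf_eval p (Y \<omega> l)" if "\<omega> \<in> S" for \<omega>
    proof -
      have "Y \<omega> 0 = cf_eval (word_upto \<omega> m) (Y \<omega> m)" for m
      proof (induction m)
        case (Suc m)
        have "Y \<omega> m = cf_eval (\<omega> m) (Y \<omega> (Suc m))" using Y[OF that] by blast
        then have "cf_eval (word_upto \<omega> (Suc m)) (Y \<omega> (Suc m)) = cf_eval (word_upto \<omega> m) (Y \<omega> m)"
          by (simp only: word_upto_Suc cf_eval_append)
        then show ?case using Suc by simp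
      qed simp
      moreover have "word_upto \<omega> l = p"
        unfolding p_def word_upto_def using agree[OF that] by (intro arg_cong[where f = concat] map_cong) auto
      ultimately show ?thesis by metis
    qed
    have yb: "0 \<le> Y \<omega> i" "Y \<omega> i \<le> 1" if "\<omega> \<in> S" for \<omega> i using Y[OF that] less_imp_le by blast+
    have yeq: "Y \<omega> i = cf_eval (\<omega> i) (Y \<omega> (Suc i))" if "\<omega> \<in> S" for \<omega> i using Y[OF that] by blast
    have W: "\<omega> i \<in> W i" if "\<omega> \<in> S" for \<omega> i using Y[OF that] by blast
    define V where "V = (\<lambda>\<omega>. \<omega> l) ` S"
    have VW: "V \<subseteq> W l" using W by (auto simp: V_def)
    have "\<Psi> l * sum (wt l) V \<le> C * (4 * q\<^sup>2 * r) powr s"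
    proof (rule separated[OF VW])
      show "\<omega>0 l \<in> V" "\<omega>1 l \<in> V" "\<omega>0 l \<noteq> \<omega>1 l" using \<omega>0 \<omega>1 by (auto simp: V_def)
      show "0 \<le> 4 * q\<^sup>2 * r" using \<open>0 \<le> r\<close> by simp
      fix u v assume "u \<in> V" "v \<in> V"
      then obtain \<omega> \<omega>' where o: "\<omega> \<in> S" "\<omega>' \<in> S" "u = \<omega> l" "v = \<omega>' l" by (auto simp: V_def)
      have in_tail: "Y \<omega> (Suc i) \<in> {0..1 - \<delta>}" if "\<omega> \<in> S" for \<omega> i
      proof -
        have "cf_eval (\<omega> (Suc i)) (Y \<omega> (Suc (Suc i))) \<le> 1 - \<delta>"
          using yb[OF that] W[OF that] by (intro tail) auto
        then show ?thesis using yb[OF that, of "Suc i"] yeq[OF that, of "Suc i"] by simp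
      qed
      have "\<bar>Y \<omega> l - Y \<omega>' l\<bar> / (4 * q\<^sup>2) \<le> \<bar>Y \<omega> 0 - Y \<omega>' 0\<bar>"
        unfolding Yp[OF o(1)] Yp[OF o(2)] q_def using yb o
        by (intro cf_eval_diff_ge p_pos) auto
      also have "\<dots> \<le> r" using diam o by blast
      finally have "\<bar>Y \<omega> l - Y \<omega>' l\<bar> \<le> 4 * q\<^sup>2 * r" using q by (simp add: field_simps)
      moreover have "Y \<omega> l = cf_eval u (Y \<omega> (Suc l))" "Y \<omega>' l = cf_eval v (Y \<omega>' (Suc l))"
        using yeq[OF o(1)] yeq[OF o(2)] o(3,4) by blast+
      ultimately have "\<bar>cf_eval u (Y \<omega> (Suc l)) - cf_eval v (Y \<omega>' (Suc l))\<bar> \<le> 4 * q\<^sup>2 * r"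
        by (simp only:)
      then show "\<exists>z\<in>{0..1 - \<delta>}. \<exists>z'\<in>{0..1 - \<delta>}. \<bar>cf_eval u z - cf_eval v z'\<bar> \<le> 4 * q\<^sup>2 * r"
        using in_tail[OF o(1)] in_tail[OF o(2)] by blast
    qed
    also have "(4 * q\<^sup>2 * r) powr s = 4 powr s * q powr (2 * s) * r powr s"
    proof -
      have "q powr (2 * s) = (q powr 2) powr s" by (simp only: powr_powr)
      then have "q\<^sup>2 powr s = q powr (2 * s)" using q by simp
      then show ?thesis using q \<open>0 \<le> r\<close> by (simp add: powr_mult)
    qed
    finally have sep: "\<Psi> l * sum (wt l) V \<le> C * (4 powr s * q powr (2 * s) * r powr s)" .
    define m where "m = (\<Prod>j<l. wt j (\<omega>0 j))"
    have "m * q powr (2 * s) * sum (wt l) V \<le> \<Psi> l * sum (wt l) V"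
      using word_upto_mass[OF W0, of l] VW wt_nonneg
      by (intro mult_right_mono sum_nonneg) (auto simp: m_def q_def p_def)
    also note sep
    finally have "m * sum (wt l) V \<le> C * 4 powr s * r powr s"
      using q by (simp add: mult_ac)
    moreover have "(\<Prod>j\<le>l. sum (wt j) (if j = l then V else {\<omega>0 j})) = m * sum (wt l) V"
      by (simp add: lessThan_Suc_atMost[symmetric] m_def)
    ultimately show ?thesis
      using agree VW W0 \<open>0 < \<gamma>\<close>
      by (intro exI[of _ l] exI[of _ "\<lambda>j. if j = l then V else {\<omega>0 j}"]) (auto simp: V_def le_less)
  qed
qed

text \<open>From a cover with sum below \<open>1 / (4 * c)\<close>, \<open>ball_mass\<close> would
  produce cylinders of total mass at most 1/4 + 1/2, where 1/2 is the sum of the slacks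
  \<open>\<gamma> k\<close>, against \<open>product_cover_ge_1\<close>.\<close>

lemma hausdorff_measure_nonzero:
  assumes E: "\<And>\<omega> y. (\<And>i. \<omega> i \<in> W i) \<Longrightarrow>
      (\<And>i. 0 < y i \<and> y i < 1 \<and> y i = cf_eval (\<omega> i) (y (Suc i))) \<Longrightarrow> y 0 \<in> E"
    and "0 \<le> s0" "s0 \<le> s"
  shows "hausdorff_measure s0 E \<noteq> 0"
proof
  assume zero: "hausdorff_measure s0 E = 0"
  define c where "c = C * 4 powr s"
  have c: "0 < c" using C_pos by (simp add: c_def)
  \<comment> \<open>At scale 1 all diameters are at most 1, so raising the exponent from s0 to s
    only decreases the sum.\<close>
  have "hausdorff_premeasure 1 s0 E \<le> hausdorff_measure s0 E"
    unfolding hausdorff_measure_def by (rule SUP_upper) simp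
  then have "hausdorff_premeasure 1 s0 E < ennreal (1 / (4 * c))" using zero c by simp
  then obtain U where U: "E \<subseteq> (\<Union>i. U i)" "\<And>i::nat. bounded (U i) \<and> diameter (U i) \<le> 1"
    "(\<Sum>i. diameter_pow s0 (U i)) < ennreal (1 / (4 * c))"
    unfolding hausdorff_premeasure_def INF_less_iff by auto
  have "\<forall>\<omega>. \<exists>y. (\<forall>i. \<omega> i \<in> W i) \<longrightarrow> (\<forall>i. 0 < y i \<and> y i < 1 \<and> y i = cf_eval (\<omega> i) (y (Suc i)))"
    using coding_exists word_nonempty word_pos by metis
  then obtain Y where Y: "\<And>\<omega> i. (\<And>i. \<omega> i \<in> W i) \<Longrightarrow>
      0 < Y \<omega> i \<and> Y \<omega> i < 1 \<and> Y \<omega> i = cf_eval (\<omega> i) (Y \<omega> (Suc i))" by metis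
  define \<gamma> where "\<gamma> k = (1 / 4) * (1 / 2 :: real) ^ k" for k :: nat
  define Q where "Q k l V \<longleftrightarrow> (\<forall>j. V j \<subseteq> W j) \<and>
      (\<forall>\<omega>\<in>{\<omega>. (\<forall>i. \<omega> i \<in> W i) \<and> Y \<omega> 0 \<in> U k}. \<forall>j\<le>l. \<omega> j \<in> V j) \<and>
      (\<Prod>j\<le>l. sum (wt j) (V j)) \<le> C * 4 powr s * diameter (U k) powr s + \<gamma> k" for k l V
  have "\<exists>l V. (\<forall>j. V j \<subseteq> W j) \<and> (\<forall>\<omega>\<in>{\<omega>. (\<forall>i. \<omega> i \<in> W i) \<and> Y \<omega> 0 \<in> U k}. \<forall>j\<le>l. \<omega> j \<in> V j) \<and>
      (\<Prod>j\<le>l. sum (wt j) (V j)) \<le> C * 4 powr s * diameter (U k) powr s + \<gamma> k" for k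
  proof (rule ball_mass)
    show "0 \<le> diameter (U k)" using U(2) by (simp add: diameter_ge_0)
    show "0 < \<gamma> k" by (simp add: \<gamma>_def)
    fix \<omega> \<omega>' assume "\<omega> \<in> {\<omega>. (\<forall>i. \<omega> i \<in> W i) \<and> Y \<omega> 0 \<in> U k}" "\<omega>' \<in> {\<omega>. (\<forall>i. \<omega> i \<in> W i) \<and> Y \<omega> 0 \<in> U k}"
    then show "\<bar>Y \<omega> 0 - Y \<omega>' 0\<bar> \<le> diameter (U k)"
      using U(2) diameter_bounded_bound[of "U k" "Y \<omega> 0" "Y \<omega>' 0"] by (simp add: dist_real_def)
  qed (use Y in blast)
  then have "\<forall>k. \<exists>l V. Q k l V" unfolding Q_def by blast
  then obtain l V where "\<And>k. Q k (l k) (V k)" by metis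
  then have V: "\<And>k j. V k j \<subseteq> W j"
    "\<And>k \<omega> j. (\<And>i. \<omega> i \<in> W i) \<Longrightarrow> Y \<omega> 0 \<in> U k \<Longrightarrow> j \<le> l k \<Longrightarrow> \<omega> j \<in> V k j"
    "\<And>k. (\<Prod>j\<le>l k. sum (wt j) (V k j)) \<le> C * 4 powr s * diameter (U k) powr s + \<gamma> k"
    unfolding Q_def by blast+
  have "1 \<le> (\<Sum>k. ennreal (\<Prod>j\<le>l k. sum (wt j) (V k j)))"
  proof (rule product_cover_ge_1[OF fin_W wt_nonneg wt_sum V(1)])
    fix \<omega> assume \<omega>: "\<And>i. \<omega> i \<in> W i"
    have "Y \<omega> 0 \<in> E" by (rule E[OF \<omega> Y[OF \<omega>]])
    then obtain k where "Y \<omega> 0 \<in> U k" using U(1) by auto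
    then show "\<exists>k. \<forall>j\<le>l k. \<omega> j \<in> V k j" using V(2) \<omega> by blast
  qed
  also have "\<dots> \<le> (\<Sum>k. ennreal (c * diameter (U k) powr s + \<gamma> k))"
    using V(3) by (intro suminf_le ennreal_leI) (auto simp: c_def)
  also have "\<dots> = ennreal c * (\<Sum>k. ennreal (diameter (U k) powr s)) + (\<Sum>k. ennreal (\<gamma> k))"
    using c by (intro suminf_ennreal_linear) (auto simp: \<gamma>_def)
  also have "(\<Sum>k. ennreal (\<gamma> k)) = ennreal (1 / 2)"
    proof (rule suminf_ennreal_eq)
    have "\<gamma> = (\<lambda>k. (1 / 4) * (1 / 2) ^ k)" by (rule ext) (simp add: \<gamma>_def)
    then show "\<gamma> sums (1 / 2)"
      using sums_mult[OF geometric_sums[of "1 / 2 :: real"], of "1 / 4"] by simp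
  qed (simp add: \<gamma>_def)
  finally have le: "1 \<le> ennreal c * (\<Sum>k. ennreal (diameter (U k) powr s)) + ennreal (1 / 2)" .
  have "(\<Sum>k. ennreal (diameter (U k) powr s)) \<le> (\<Sum>k. diameter_pow s0 (U k))"
  proof (intro suminf_le)
    fix k
    have d: "0 \<le> diameter (U k)" "diameter (U k) \<le> 1" using U(2) by (auto simp: diameter_ge_0)
    have "diameter (U k) powr s \<le> 1" using d s_pos by (simp add: powr_le1)
    moreover have "diameter (U k) powr s \<le> diameter (U k) powr s0"
      using d assms(3) by (intro powr_mono') auto
    ultimately show "ennreal (diameter (U k) powr s) \<le> diameter_pow s0 (U k)"
      by (auto simp: diameter_pow_def intro: ennreal_leI simp flip: ennreal_1)
  qed auto
  also have "\<dots> \<le> ennreal (1 / (4 * c))" using U(3) by simp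
  finally have "ennreal c * (\<Sum>k. ennreal (diameter (U k) powr s)) \<le> ennreal c * ennreal (1 / (4 * c))"
    by (intro mult_left_mono) auto
  also have "\<dots> = ennreal (1 / 4)" using c by (simp add: ennreal_mult[symmetric])
  finally have "1 \<le> ennreal (1 / 4) + ennreal (1 / 2)" using le add_right_mono order_trans by blast
  also have "\<dots> = ennreal (3 / 4)" by (subst ennreal_plus[symmetric]) auto
  finally show False by (simp flip: ennreal_1)
qed

end


section \<open>Stages of the Cantor construction\<close>

text \<open>A free stage chooses a word of \<open>F\<close> with probability proportional to \<open>q\<^sup>-\<^sup>2\<^sup>s\<close>; a padding stage
  corrects the position by one digit; a big stage chooses one digit of prescribed size. All words
  end in a digit at least 2, which keeps the cylinders at each stage uniformly apart.\<close>

datatype stage = Free | Pad | Big nat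

text \<open>Tails bounded away from 1 separate even neighbouring digits: (b + y) - (a + x) is at
  least (b - a) - (1 - \<delta>), and this is at least \<delta> (b - a) because b - a >= 1.\<close>

lemma digit_gap:
  fixes a b :: nat
  assumes "1 \<le> a" "a < b" "0 \<le> x" "x \<le> 1 - \<delta>" "0 \<le> y" "y \<le> 1 - \<delta>" "0 < \<delta>"
  shows "\<delta> * (real b - real a) / ((real a + 1) * (real b + 1)) \<le> \<bar>1 / (real a + x) - 1 / (real b + y)\<bar>"
proof -
  have "1 \<le> real b - real a" using assms by (simp add: Suc_leI)
  then have "(1 - \<delta>) * 1 \<le> (1 - \<delta>) * (real b - real a)" using assms by (intro mult_left_mono) auto
  then have num: "\<delta> * (real b - real a) \<le> (real b + y) - (real a + x)"
    using assms by (simp add: algebra_simps)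
  have "\<delta> * (real b - real a) / ((real a + 1) * (real b + 1)) \<le>
      ((real b + y) - (real a + x)) / ((real a + x) * (real b + y))"
    using assms num by (intro frac_le mult_mono mult_pos_pos) auto
  also have "\<dots> = 1 / (real a + x) - 1 / (real b + y)"
    using assms by (simp add: divide_simps)
  also have "\<dots> \<le> \<bar>1 / (real a + x) - 1 / (real b + y)\<bar>" by simp
  finally show ?thesis .
qed

text \<open>A value near 1 needs the digit 1 followed by a tail near 0. Inside the word the next
  digit is at most M, so the tail is at least 1 / (M + 1); behind the last letter the tail z may be
  arbitrarily small, but there the digit is 2.\<close>

lemma cf_eval_tail_bound:
  assumes "v \<noteq> []" "\<forall>a\<in>set v. 1 \<le> a \<and> a \<le> M" "last v = 2" "0 \<le> z" "z \<le> 1"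
  shows "cf_eval v z \<le> 1 - 1 / (real M + 2)"
proof (cases v)
  case (Cons c v')
  show ?thesis
  proof (cases v')
    case Nil
    have "1 / (2 + z) \<le> 1 / 2" using assms by (intro divide_left_mono) auto
    moreover have "1 / (real M + 2) \<le> 1 / 2" by (intro divide_left_mono) auto
    moreover have "cf_eval v z = 1 / (2 + z)" using assms Cons Nil by simp
    ultimately show ?thesis by linarith
  next
    case (Cons c' u)
    have u: "0 \<le> cf_eval u z" "cf_eval u z \<le> 1" "1 \<le> c" "1 \<le> c'" "c' \<le> M"
      using assms \<open>v = c # v'\<close> Cons cf_eval_bounds[of u z] by auto
    have "1 / (real M + 1) \<le> 1 / (real c' + cf_eval u z)"
      using u by (intro divide_left_mono mult_pos_pos) auto
    then have "1 + 1 / (real M + 1) \<le> real c + cf_eval v' z" using u Cons by simp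
    then have "1 / (real c + cf_eval v' z) \<le> 1 / (1 + 1 / (real M + 1))"
      using u Cons by (intro divide_left_mono mult_pos_pos) (auto intro: add_pos_nonneg)
    also have "\<dots> = 1 - 1 / (real M + 2)" by (simp add: field_simps)
    finally show ?thesis using \<open>v = c # v'\<close> by simp
  qed
qed (use assms in simp)

text \<open>\<theta> is the net gain per digit of a free stage; the 4 in \<open>F_sum\<close>
  absorbs the distortion \<open>2 powr (2 * s)\<close>.\<close>

locale stages =
  fixes F :: "nat list set" and k :: nat and s \<theta> :: real
  assumes fin_F: "finite F" and F_nonempty: "F \<noteq> {}" and k_pos: "0 < k"
    and F_words: "\<And>w. w \<in> F \<Longrightarrow> w \<in> words k \<and> last w = 2"
    and s_gt: "1 / 2 < s" and s_le: "s \<le> 1" and \<theta>_pos: "0 < \<theta>"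
    and F_sum: "4 \<le> exp (- \<theta> * real k) * (\<Sum>w\<in>F. cont w powr (-2 * s))"
begin

fun stage_words :: "stage \<Rightarrow> nat list set" where
  "stage_words Free = F"
| "stage_words Pad = {[2]}"
| "stage_words (Big A) = (\<lambda>a. [a]) ` {A..<2 * A}"

fun stage_wt :: "stage \<Rightarrow> nat list \<Rightarrow> real" where
  "stage_wt Free w = cont w powr (-2 * s) / (\<Sum>w\<in>F. cont w powr (-2 * s))"
| "stage_wt Pad w = 1"
| "stage_wt (Big A) w = 1 / real A"

fun stage_len :: "stage \<Rightarrow> nat" where
  "stage_len Free = k"
| "stage_len Pad = 1"
| "stage_len (Big A) = 1"

text \<open>How much a stage can raise the ratio of mass to the s-th power of length, see
  \<open>stage_step\<close>. Each 16 bounds \<open>4 powr (2 * s)\<close>: one 2 is the distortion,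
  the other is the padding digit itself or the bound \<open>2 * A\<close> for a big digit.\<close>

fun stage_fac :: "stage \<Rightarrow> real" where
  "stage_fac Free = exp (- \<theta> * real k)"
| "stage_fac Pad = 16"
| "stage_fac (Big A) = 16 * real A powr (2 * s - 1)"

text \<open>Before a big digit the whole mass lies over the digits from A to
  \<open>2 * A - 1\<close>, in an interval of relative length about 1 / A, so the ratio \<psi> must
  not exceed \<open>A powr (- s)\<close>. The ceiling \<open>16 ^ k\<close> leaves room for a row of
  fewer than k paddings.\<close>

fun stage_ok :: "real \<Rightarrow> stage \<Rightarrow> bool" where
  "stage_ok \<psi> (Big A) \<longleftrightarrow> 2 \<le> A \<and> \<psi> \<le> 16 ^ k \<and> \<psi> * real A powr s \<le> 1"
| "stage_ok \<psi> c \<longleftrightarrow> \<psi> \<le> 16 ^ k"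

lemma F_digits: "w \<in> F \<Longrightarrow> \<forall>a\<in>set w. 1 \<le> a" "w \<in> F \<Longrightarrow> length w = k" "w \<in> F \<Longrightarrow> w \<noteq> []"
  using F_words k_pos by (fastforce simp: words_def)+

lemma F_sum_pos: "0 < (\<Sum>w\<in>F. cont w powr (-2 * s))"
proof (rule ccontr)
  assume "\<not> ?thesis"
  then have "exp (- \<theta> * real k) * (\<Sum>w\<in>F. cont w powr (-2 * s)) \<le> 0"
    by (intro mult_nonneg_nonpos) auto
  then show False using F_sum by linarith
qed

lemma stage_fac_pos: "stage_ok \<psi> c \<Longrightarrow> 0 < stage_fac c"
  by (cases c) auto

lemma stage_words_props:
  assumes "stage_ok \<psi> c" "w \<in> stage_words c"
  shows "length w = stage_len c" "w \<noteq> []" "\<forall>a\<in>set w. 1 \<le> a" "0 \<le> stage_wt c w"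
  using assms F_digits F_sum_pos by (cases c; auto)+

lemma finite_stage_words: "finite (stage_words c)"
  using fin_F by (cases c) auto

lemma stage_wt_sum:
  assumes "stage_ok \<psi> c"
  shows "sum (stage_wt c) (stage_words c) = 1"
proof (cases c)
  case Free
  then show ?thesis using F_sum_pos by (simp add: sum_divide_distrib[symmetric])
next
  case (Big A)
  show ?thesis
  proof -
    have "sum (stage_wt (Big A)) ((\<lambda>a. [a]) ` {A..<2 * A}) = (\<Sum>a\<in>{A..<2 * A}. 1 / real A)"
      by (subst sum.reindex) (auto simp: inj_on_def)
    then show ?thesis using assms Big by simp
  qed
qed simp

lemma stage_step:
  assumes "stage_ok \<psi> c" "w \<in> stage_words c"
  shows "stage_wt c w * (2 * cont w) powr (2 * s) \<le> stage_fac c"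
proof (cases c)
  case Free
  then have w: "w \<in> F" using assms by simp
  have q: "0 < cont w" using F_digits[OF w] by (intro cont_pos)
  define Z where "Z = (\<Sum>w\<in>F. cont w powr (-2 * s))"
  have Z: "0 < Z" "4 \<le> exp (- \<theta> * real k) * Z" using F_sum_pos F_sum by (auto simp: Z_def)
  have "2 powr (2 * s) \<le> 2 powr 2" using s_le by (intro powr_mono) auto
  also have "\<dots> = 4" by simp
  finally have "2 powr (2 * s) \<le> exp (- \<theta> * real k) * Z" using Z by linarith
  moreover have "cont w powr (-2 * s) * (2 * cont w) powr (2 * s) = 2 powr (2 * s)"
    using q by (simp add: powr_mult powr_minus)
  ultimately have "cont w powr (-2 * s) / Z * (2 * cont w) powr (2 * s) \<le> exp (- \<theta> * real k)"
    using Z by (simp add: pos_divide_le_eq)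
  then show ?thesis by (simp only: Free stage_wt.simps stage_fac.simps Z_def[symmetric])
next
  case Pad
  have "(4::real) powr (2 * s) \<le> 4 powr 2" using s_le by (intro powr_mono) auto
  then show ?thesis using Pad assms by simp
next
  case (Big A)
  then obtain a where a: "w = [a]" "A \<le> a" "a < 2 * A" and A: "2 \<le> A" using assms by auto
  have "(2 * cont w) powr (2 * s) \<le> (4 * real A) powr (2 * s)"
    using a s_gt by (intro powr_mono2) auto
  also have "\<dots> = 4 powr (2 * s) * real A powr (2 * s)" by (rule powr_mult)
  also have "\<dots> \<le> 16 * real A powr (2 * s)"
  proof (rule mult_right_mono)
    have "(4::real) powr (2 * s) \<le> 4 powr 2" using s_le by (intro powr_mono) auto
    then show "(4::real) powr (2 * s) \<le> 16" by simp
  qed simp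
  finally have "(1 / real A) * (2 * cont w) powr (2 * s) \<le> (1 / real A) * (16 * real A powr (2 * s))"
    by (intro mult_left_mono) auto
  also have "\<dots> = 16 * real A powr (2 * s - 1)" using A by (simp add: powr_diff)
  finally show ?thesis using Big by simp
qed

text \<open>Words of equal length split at some letter behind a common prefix, where
  \<open>digit_gap\<close> applies; F is finite, so a minimum over pairs is uniform. The tail bound
  is required for all suffixes because the split can occur at any letter.\<close>

lemma F_separated:
  assumes "0 < \<delta>" and tl: "\<And>w v z. w \<in> F \<Longrightarrow> suffix v w \<Longrightarrow> v \<noteq> [] \<Longrightarrow> 0 \<le> z \<Longrightarrow> z \<le> 1 \<Longrightarrow> cf_eval v z \<le> 1 - \<delta>"
  shows "\<exists>\<epsilon>>0. \<epsilon> \<le> 1 \<and> (\<forall>u\<in>F. \<forall>v\<in>F. u \<noteq> v \<longrightarrow>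
    (\<forall>z\<in>{0..1 - \<delta>}. \<forall>z'\<in>{0..1 - \<delta>}. \<epsilon> \<le> \<bar>cf_eval u z - cf_eval v z'\<bar>))"
proof -
  have pair: "\<exists>e>0. \<forall>z\<in>{0..1 - \<delta>}. \<forall>z'\<in>{0..1 - \<delta>}. e \<le> \<bar>cf_eval u z - cf_eval v z'\<bar>"
    if "u \<in> F" "v \<in> F" "u \<noteq> v" for u v
  proof -
    note uvF = that
    have len: "length u = length v" using F_digits that by simp
    then obtain p a b u' v' where uv: "u = p @ a # u'" "v = p @ b # v'" "a \<noteq> b"
      using same_length_different[OF uvF(3) len] by auto
    have d: "\<forall>a\<in>set p. 1 \<le> a" "1 \<le> a" "1 \<le> b" "\<forall>a\<in>set u'. 1 \<le> a" "\<forall>a\<in>set v'. 1 \<le> a"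
      using F_digits(1)[OF that(1)] F_digits(1)[OF that(2)] uv by auto
    define m where "m = (\<lambda>a b. \<delta> * \<bar>real b - real a\<bar> / ((real a + 1) * (real b + 1))) a b"
    have m: "0 < m" using uv(3) \<open>0 < \<delta>\<close> by (auto simp: m_def)
    have q: "0 < cont p" using d by (intro cont_pos)
    have bd: "m / (4 * (cont p)\<^sup>2) \<le> \<bar>cf_eval u z - cf_eval v z'\<bar>"
      if z: "z \<in> {0..1 - \<delta>}" "z' \<in> {0..1 - \<delta>}" for z z'
    proof -
      define x y where "x = cf_eval u' z" and "y = cf_eval v' z'"
      have "suffix u' u" "suffix v' v" using uv by (auto simp: suffix_def)
      have z01: "0 \<le> z" "z \<le> 1" "0 \<le> z'" "z' \<le> 1" using z \<open>0 < \<delta>\<close> by auto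
      have "x \<le> 1 - \<delta>" using z z01 tl[OF \<open>u \<in> F\<close> \<open>suffix u' u\<close>, of z]
        unfolding x_def by (cases "u' = []") auto
      moreover have "y \<le> 1 - \<delta>" using z z01 tl[OF \<open>v \<in> F\<close> \<open>suffix v' v\<close>, of z']
        unfolding y_def by (cases "v' = []") auto
      moreover have "0 \<le> x" "0 \<le> y"
        using cf_eval_bounds(1)[OF d(4), of z] cf_eval_bounds(1)[OF d(5), of z'] z01
        by (simp_all add: x_def y_def)
      ultimately have xy: "0 \<le> x" "x \<le> 1 - \<delta>" "0 \<le> y" "y \<le> 1 - \<delta>" by auto
      have "m \<le> \<bar>1 / (real a + x) - 1 / (real b + y)\<bar>"
      proof (cases "a < b")
        case True
        then show ?thesis using digit_gap[of a b x \<delta> y] d xy \<open>0 < \<delta>\<close> by (simp add: m_def)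
      next
        case False
        then show ?thesis using digit_gap[of b a y \<delta> x] d xy \<open>0 < \<delta>\<close> uv(3)
          by (simp add: m_def abs_minus_commute mult.commute)
      qed
      then have "m / (4 * (cont p)\<^sup>2) \<le> \<bar>1 / (real a + x) - 1 / (real b + y)\<bar> / (4 * (cont p)\<^sup>2)"
        by (intro divide_right_mono) auto
      also have "\<dots> \<le> \<bar>cf_eval p (1 / (real a + x)) - cf_eval p (1 / (real b + y))\<bar>"
        using d xy by (intro cf_eval_diff_ge) (auto simp: field_simps)
      finally show ?thesis by (simp add: uv cf_eval_append x_def y_def)
    qed
    moreover have "0 < m / (4 * (cont p)\<^sup>2)" using m q by simp
    ultimately show ?thesis by blast
  qed
  then obtain e where e: "\<And>u v. u \<in> F \<Longrightarrow> v \<in> F \<Longrightarrow> u \<noteq> v \<Longrightarrow> 0 < e u v \<and>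
      (\<forall>z\<in>{0..1 - \<delta>}. \<forall>z'\<in>{0..1 - \<delta>}. e u v \<le> \<bar>cf_eval u z - cf_eval v z'\<bar>)" by metis
  define S where "S = insert 1 ((\<lambda>(u, v). e u v) ` {(u, v) \<in> F \<times> F. u \<noteq> v})"
  have S: "finite S" "S \<noteq> {}" using fin_F by (auto simp: S_def intro: finite_subset[of _ "F \<times> F"])
  have "0 < Min S" using S e by (subst Min_gr_iff) (auto simp: S_def)
  moreover have "Min S \<le> 1" using S by (intro Min_le) (auto simp: S_def)
  moreover have "Min S \<le> e u v" if "u \<in> F" "v \<in> F" "u \<noteq> v" for u v
    using S that by (intro Min_le) (force simp: S_def)+
  ultimately show ?thesis using e by (intro exI[of _ "Min S"]) (meson order_trans)
qed

lemma cantor_scheme_exists: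
  fixes \<sigma> :: "nat \<Rightarrow> stage"
  defines "\<Psi> \<equiv> (\<lambda>i. \<Prod>j<i. stage_fac (\<sigma> j))"
  assumes ok: "\<And>i. stage_ok (\<Psi> i) (\<sigma> i)"
  shows "\<exists>\<delta> C. cantor_scheme (\<lambda>i. stage_words (\<sigma> i)) (\<lambda>i. stage_wt (\<sigma> i)) s \<delta> C \<Psi>"
proof -
  obtain M where M: "\<And>w a. w \<in> F \<Longrightarrow> a \<in> set w \<Longrightarrow> a \<le> M"
  proof
    show "a \<le> Max (\<Union>(set ` F))" if "w \<in> F" "a \<in> set w" for w a
      using fin_F that by (intro Max_ge) auto
  qed
  define \<delta> where "\<delta> = 1 / (real M + 2)"
  have \<delta>: "0 < \<delta>" "\<delta> \<le> 1 / 2" by (auto simp: \<delta>_def field_simps)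
  have tlF: "cf_eval v z \<le> 1 - \<delta>" if "w \<in> F" "suffix v w" "v \<noteq> []" "0 \<le> z" "z \<le> 1" for w v z
    unfolding \<delta>_def
  proof (rule cf_eval_tail_bound)
    show "\<forall>a\<in>set v. 1 \<le> a \<and> a \<le> M"
      using M F_digits(1)[OF that(1)] that set_mono_suffix[OF that(2)] by blast
    show "last v = 2" using F_words[OF that(1)] that by (auto simp: suffix_def)
  qed (use that in auto)
  obtain \<epsilon> where \<epsilon>: "0 < \<epsilon>" "\<epsilon> \<le> 1" and \<epsilon>F: "\<And>u v z z'. u \<in> F \<Longrightarrow> v \<in> F \<Longrightarrow> u \<noteq> v \<Longrightarrow>
      z \<in> {0..1 - \<delta>} \<Longrightarrow> z' \<in> {0..1 - \<delta>} \<Longrightarrow> \<epsilon> \<le> \<bar>cf_eval u z - cf_eval v z'\<bar>"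
  proof -
    have "\<exists>\<epsilon>>0. \<epsilon> \<le> 1 \<and> (\<forall>u\<in>F. \<forall>v\<in>F. u \<noteq> v \<longrightarrow>
        (\<forall>z\<in>{0..1 - \<delta>}. \<forall>z'\<in>{0..1 - \<delta>}. \<epsilon> \<le> \<bar>cf_eval u z - cf_eval v z'\<bar>))"
      by (rule F_separated[OF \<delta>(1)]) (rule tlF)
    then show thesis using that by blast
  qed
  define K :: real where "K = 16 ^ k"
  have K: "1 \<le> K" by (simp add: K_def)
  \<comment> \<open>One summand for big digits and one for words of F, the two kinds of stage with a
    real choice.\<close>
  define C where "C = K * (2 * (4 / \<delta>) powr s + 1 / \<epsilon> powr s)"
  have C1: "K / \<epsilon> powr s \<le> C" and C2: "2 * (4 / \<delta>) powr s \<le> C"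
  proof -
    have "1 * (2 * (4 / \<delta>) powr s) \<le> K * (2 * (4 / \<delta>) powr s)" using K by (intro mult_right_mono) auto
    moreover have "0 \<le> K / \<epsilon> powr s" using K by simp
    ultimately show "2 * (4 / \<delta>) powr s \<le> C" by (simp add: C_def algebra_simps)
    show "K / \<epsilon> powr s \<le> C" using K by (simp add: C_def algebra_simps)
  qed
  have "\<epsilon> powr s \<le> 1" using \<epsilon> s_gt by (simp add: powr_le1)
  then have "K \<le> K / \<epsilon> powr s" using K \<epsilon> by (simp add: field_simps)
  then have KC: "K \<le> C" using C1 by linarith
  have \<Psi>_le: "\<Psi> i \<le> K" for i using ok[of i] by (cases "\<sigma> i") (auto simp: K_def)
  have \<Psi>_pos: "0 < \<Psi> i" for i unfolding \<Psi>_def using stage_fac_pos ok by (intro prod_pos) blast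
  have "cantor_scheme (\<lambda>i. stage_words (\<sigma> i)) (\<lambda>i. stage_wt (\<sigma> i)) s \<delta> C \<Psi>"
  proof
    show "0 < s" using s_gt by simp
    show "0 < C" using K KC by linarith
    show "\<Psi> 0 = 1" by (simp add: \<Psi>_def)
    show "\<Psi> i \<le> C" for i using \<Psi>_le KC order_trans by blast
    show "stage_wt (\<sigma> i) w * (2 * cont w) powr (2 * s) * \<Psi> i \<le> \<Psi> (Suc i)" if "w \<in> stage_words (\<sigma> i)" for i w
    proof -
      have "stage_wt (\<sigma> i) w * (2 * cont w) powr (2 * s) * \<Psi> i \<le> stage_fac (\<sigma> i) * \<Psi> i"
        using stage_step[OF ok that] \<Psi>_pos[of i] by (intro mult_right_mono) auto
      then show ?thesis by (simp add: \<Psi>_def mult.commute)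
    qed
    show "cf_eval w z \<le> 1 - \<delta>" if w: "w \<in> stage_words (\<sigma> i)" and z: "0 \<le> z" "z \<le> 1" for i w z
    proof (cases "\<sigma> i")
      case Free
      then show ?thesis using tlF[of w w z] w z F_digits(3) by auto
    next
      case Pad
      then have "cf_eval w z = 1 / (2 + z)" using w by simp
      also have "\<dots> \<le> 1 / 2" using z by (intro divide_left_mono) auto
      finally show ?thesis using \<delta> by linarith
    next
      case (Big A)
      then obtain a where a: "w = [a]" "A \<le> a" using w by auto
      have "2 \<le> a" using ok[of i] Big a by auto
      then have "1 / (real a + z) \<le> 1 / 2" using z by (intro divide_left_mono) auto
      then show ?thesis using \<delta> a by simp
    qed
    show "\<Psi> i * sum (stage_wt (\<sigma> i)) V \<le> C * r powr s"
      if V: "V \<subseteq> stage_words (\<sigma> i)" and uv: "u \<in> V" "v \<in> V" "u \<noteq> v" and r: "0 \<le> r"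
        and close: "\<And>u v. u \<in> V \<Longrightarrow> v \<in> V \<Longrightarrow>
          \<exists>z\<in>{0..1 - \<delta>}. \<exists>z'\<in>{0..1 - \<delta>}. \<bar>cf_eval u z - cf_eval v z'\<bar> \<le> r" for i V r u v
    proof (cases "\<sigma> i")
      case Free
      \<comment> \<open>Two different words force r to be at least \<epsilon>, so bounding the mass
        by its total suffices.\<close>
      have "\<epsilon> \<le> r" using close[OF uv(1,2)] \<epsilon>F[of u v] uv V Free by fastforce
      have "sum (stage_wt (\<sigma> i)) V \<le> sum (stage_wt (\<sigma> i)) (stage_words (\<sigma> i))"
        using V finite_stage_words stage_words_props(4)[OF ok] by (intro sum_mono2) auto
      then have "sum (stage_wt (\<sigma> i)) V \<le> 1" using stage_wt_sum[OF ok] by simp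
      then have "\<Psi> i * sum (stage_wt (\<sigma> i)) V \<le> \<Psi> i * 1" using \<Psi>_pos[of i] by (intro mult_left_mono) auto
      also have "\<dots> \<le> K" using \<Psi>_le by simp
      also have "\<dots> = K / \<epsilon> powr s * \<epsilon> powr s" using \<epsilon> by simp
      also have "\<dots> \<le> C * r powr s"
        using C1 \<open>\<epsilon> \<le> r\<close> \<epsilon> K KC s_gt by (intro mult_mono powr_mono2) auto
      finally show ?thesis .
    next
      case Pad
      then show ?thesis using V uv by auto
    next
      case (Big A)
      have A: "2 \<le> A" "\<Psi> i * real A powr s \<le> 1" using ok[of i] Big by auto
      define V' where "V' = {a. [a] \<in> V}"
      have V': "V = (\<lambda>a. [a]) ` V'" "V' \<subseteq> {A..<2 * A}" using V Big by (auto simp: V'_def)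
      have finV': "finite V'" using V'(2) finite_subset by blast
      define a b where "a = Min V'" and "b = Max V'"
      have "V' \<noteq> {}" using uv V' by auto
      then have ab: "a \<in> V'" "b \<in> V'" using finV' by (auto simp: a_def b_def)
      have sub: "V' \<subseteq> {a..b}" using finV' by (auto simp: a_def b_def)
      obtain x y where "x \<in> V'" "y \<in> V'" "x \<noteq> y" using uv V'(1) by auto
      then have "a < b" using sub by (metis atLeastAtMost_iff le_antisym le_trans linorder_neqE_nat not_le subsetD)
      have abA: "A \<le> a" "b < 2 * A" using ab V'(2) by auto
      \<comment> \<open>The share of the digit range spanned by V'. The mass of V is at most 2 D,
        and its extreme digits show that r is at least \<delta> D / (4 A). Since s <= 1, D <=
        \<open>D powr s\<close> converts the mass into the required power.\<close>
      define D where "D = (real b - real a) / real A"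
      have D: "0 < D" "D \<le> 1" using \<open>a < b\<close> abA A by (auto simp: D_def field_simps)
      have "card V' \<le> card {a..b}" using sub by (intro card_mono) auto
      then have card: "real (card V') \<le> 2 * (real b - real a)" using \<open>a < b\<close> by (simp add: of_nat_diff)
      obtain z z' where z: "z \<in> {0..1 - \<delta>}" "z' \<in> {0..1 - \<delta>}" "\<bar>cf_eval [a] z - cf_eval [b] z'\<bar> \<le> r"
        using close[of "[a]" "[b]"] ab V'(1) by auto
      have "\<delta> / 4 * (D / real A) = \<delta> * (real b - real a) / ((2 * real A) * (2 * real A))"
        by (simp add: D_def)
      also have "\<dots> \<le> \<delta> * (real b - real a) / ((real a + 1) * (real b + 1))"
        using abA \<open>a < b\<close> \<delta> A by (intro divide_left_mono mult_mono mult_pos_pos mult_nonneg_nonneg) auto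
      also have "\<dots> \<le> r"
        using digit_gap[of a b z \<delta> z'] z \<delta> \<open>a < b\<close> abA A by auto
      finally have "(\<delta> / 4 * (D / real A)) powr s \<le> r powr s"
        using \<delta> D A s_gt by (intro powr_mono2) auto
      then have rs: "(\<delta> / 4) powr s * (D powr s / real A powr s) \<le> r powr s"
        by (simp only: powr_mult powr_divide)
      have "\<Psi> i * sum (stage_wt (\<sigma> i)) V = \<Psi> i * (real (card V') / real A)"
      proof -
        have "card ((\<lambda>a. [a]) ` V') = card V'" by (rule card_image) (simp add: inj_on_def)
        then show ?thesis using V'(1) Big by simp
      qed
      also have "\<dots> \<le> \<Psi> i * (2 * D)"
        using card \<Psi>_pos[of i] A by (intro mult_left_mono) (auto simp: D_def field_simps)
      also have "\<dots> \<le> \<Psi> i * (2 * D powr s)"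
        using D s_le s_gt \<Psi>_pos[of i] powr_mono'[of s 1 D] by (intro mult_left_mono) auto
      also have "\<dots> = (\<Psi> i * real A powr s) * (2 * (D powr s / real A powr s))" using A by simp
      also have "\<dots> \<le> 1 * (2 * (D powr s / real A powr s))" using A by (intro mult_right_mono) auto
      also have "\<dots> = (2 * (4 / \<delta>) powr s) * ((\<delta> / 4) powr s * (D powr s / real A powr s))"
        using \<delta> by (simp add: powr_divide)
      also have "\<dots> \<le> C * r powr s" using C2 rs KC K by (intro mult_mono) auto
      finally show ?thesis .
    qed
  qed (use finite_stage_words stage_words_props[OF ok] stage_wt_sum[OF ok] in blast)+
  then show ?thesis by blast
qed

end


section \<open>Placing the big digits\<close>

lemma map_upt_split:
  assumes "i < n"
  shows "map g [0..<n] = map g [0..<i] @ g i # map g [Suc i..<n]"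
proof -
  have "[0..<n] = [0..<i] @ [i..<n]" using upt_add_eq_append[of 0 i "n - i"] assms by simp
  then show ?thesis using upt_conv_Cons[OF assms] by simp
qed

context stages
begin

definition run_len :: "stage list \<Rightarrow> nat" where
  "run_len cs = sum_list (map stage_len cs)"

definition run_fac :: "stage list \<Rightarrow> real" where
  "run_fac cs = prod_list (map stage_fac cs)"

fun run_ok :: "real \<Rightarrow> stage list \<Rightarrow> bool" where
  "run_ok \<psi> [] \<longleftrightarrow> True"
| "run_ok \<psi> (c # cs) \<longleftrightarrow> stage_ok \<psi> c \<and> run_ok (\<psi> * stage_fac c) cs"

lemma run_len_simps [simp]:
  "run_len [] = 0" "run_len (c # cs) = stage_len c + run_len cs" "run_len (xs @ ys) = run_len xs + run_len ys"
  by (simp_all add: run_len_def)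

lemma run_fac_simps [simp]:
  "run_fac [] = 1" "run_fac (c # cs) = stage_fac c * run_fac cs" "run_fac (xs @ ys) = run_fac xs * run_fac ys"
  by (simp_all add: run_fac_def)

lemma run_fac_map_upt: "run_fac (map \<sigma> [0..<n]) = (\<Prod>j<n. stage_fac (\<sigma> j))"
  by (induction n) auto

lemma run_ok_append: "run_ok \<psi> (xs @ ys) \<longleftrightarrow> run_ok \<psi> xs \<and> run_ok (\<psi> * run_fac xs) ys"
  by (induction xs arbitrary: \<psi>) (auto simp: mult.assoc)

lemma run_fac_nonneg: "0 \<le> run_fac cs"
proof (induction cs)
  case (Cons c cs)
  then show ?case by (cases c) auto
qed simp

text \<open>Free stages come first: they lower the ratio before the fewer than k paddings raise
  it.\<close>

definition fill :: "nat \<Rightarrow> stage list" where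
  "fill L = replicate (L div k) Free @ replicate (L mod k) Pad"

lemma run_len_fill [simp]: "run_len (fill L) = L"
  by (simp add: fill_def run_len_def sum_list_replicate)

lemma run_ok_replicate_Free: "\<psi> \<le> 1 \<Longrightarrow> 0 \<le> \<psi> \<Longrightarrow> run_ok \<psi> (replicate n Free)"
proof (induction n arbitrary: \<psi>)
  case (Suc n)
  have "\<psi> * exp (- (\<theta> * real k)) \<le> 1 * 1" using Suc.prems \<theta>_pos by (intro mult_mono) auto
  moreover have "\<psi> \<le> 16 ^ k" using Suc.prems by (meson one_le_power order_trans one_le_numeral)
  ultimately show ?case using Suc by auto
qed simp

lemma run_ok_replicate_Pad: "\<psi> \<le> 1 \<Longrightarrow> m + n \<le> k \<Longrightarrow> run_ok (\<psi> * 16 ^ m) (replicate n Pad)"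
proof (induction n arbitrary: m)
  case (Suc n)
  have "\<psi> * 16 ^ m \<le> 1 * 16 ^ m" using Suc.prems by (intro mult_right_mono) auto
  also have "\<dots> \<le> 16 ^ k" using Suc.prems by (simp add: power_increasing)
  finally have "\<psi> * 16 ^ m \<le> 16 ^ k" .
  moreover have "run_ok (\<psi> * 16 ^ Suc m) (replicate n Pad)" using Suc by (intro Suc.IH) auto
  ultimately show ?case by (simp add: mult_ac)
qed simp

lemma run_fac_replicate: "run_fac (replicate n c) = stage_fac c ^ n"
  by (simp add: run_fac_def)

lemma run_ok_fill:
  assumes "0 \<le> \<psi>" "\<psi> \<le> 1"
  shows "run_ok \<psi> (fill L)"
proof -
  have "run_fac (replicate (L div k) Free) \<le> 1" using \<theta>_pos by (simp add: run_fac_replicate power_le_one)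
  then have "\<psi> * run_fac (replicate (L div k) Free) \<le> 1"
    using assms run_fac_nonneg[of "replicate (L div k) Free"] mult_le_one by blast
  moreover have "L mod k < k" using k_pos by simp
  ultimately show ?thesis
    using run_ok_replicate_Free[OF assms(2,1)]
      run_ok_replicate_Pad[of "\<psi> * run_fac (replicate (L div k) Free)" 0 "L mod k"]
    by (simp add: fill_def run_ok_append)
qed

lemma run_fac_fill_le: "run_fac (fill L) \<le> 16 ^ k * exp (\<theta> * real k) * exp (- \<theta> * real L)"
proof -
  have "real L = real (L div k) * real k + real (L mod k)"
    by (metis of_nat_add of_nat_mult div_mult_mod_eq)
  moreover have "real (L mod k) \<le> real k" using k_pos by (simp add: less_imp_le)
  ultimately have "real L - real k \<le> real (L div k) * real k" by linarith
  then have "\<theta> * (real L - real k) \<le> \<theta> * (real (L div k) * real k)"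
    using \<theta>_pos by (intro mult_left_mono) auto
  then have "- \<theta> * (real (L div k) * real k) \<le> \<theta> * real k + - \<theta> * real L" by (simp add: algebra_simps)
  moreover have "run_fac (replicate (L div k) Free) = exp (- \<theta> * (real (L div k) * real k))"
    by (simp add: run_fac_replicate exp_of_nat_mult[symmetric] algebra_simps)
  ultimately have "run_fac (replicate (L div k) Free) \<le> exp (\<theta> * real k) * exp (- \<theta> * real L)"
    unfolding exp_add[symmetric] by simp
  moreover have "(16::real) ^ (L mod k) \<le> 16 ^ k" using k_pos by (intro power_increasing) (auto simp: less_imp_le)
  ultimately have "run_fac (replicate (L div k) Free) * 16 ^ (L mod k) \<le>
      (exp (\<theta> * real k) * exp (- \<theta> * real L)) * 16 ^ k"
    by (intro mult_mono run_fac_nonneg) auto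
  then show ?thesis by (simp add: fill_def run_fac_replicate mult_ac)
qed

text \<open>\<open>big_at cs A p\<close>: the digit at position \<open>p\<close> (counted from 1) is produced by a big stage.\<close>

definition big_at :: "stage list \<Rightarrow> nat \<Rightarrow> nat \<Rightarrow> bool" where
  "big_at cs A p \<longleftrightarrow> (\<exists>xs ys. cs = xs @ Big A # ys \<and> Suc (run_len xs) = p)"

lemma big_at_append: "big_at cs A p \<Longrightarrow> big_at (cs @ zs) A p"
  unfolding big_at_def by fastforce

lemma big_at_snoc: "big_at (xs @ [Big A]) A (Suc (run_len xs))"
  unfolding big_at_def by auto

text \<open>\<open>first\<close> provides the reserve \<open>A powr s\<close> once; afterwards
  \<open>period\<close> only has to balance the net loss \<open>A powr (2 * s - 1)\<close> of each
  further big digit.\<close>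

lemma periodic_extension:
  assumes f: "0 < f" and A: "2 \<le> A"
    and cs: "run_ok 1 cs" "run_fac cs \<le> 1" and pos: "run_len cs + L0 + 1 = p0 + f"
    and first: "run_fac (fill L0) * (16 * real A powr s) \<le> 1"
    and period: "run_fac (fill (f - 1)) * (16 * real A powr (2 * s - 1)) \<le> 1"
  shows "\<exists>zs. zs \<noteq> [] \<and> run_ok 1 (cs @ zs) \<and> run_fac (cs @ zs) \<le> 1 \<and>
    run_len (cs @ zs) = p0 + Suc j * f \<and> (\<forall>i\<in>{1..Suc j}. big_at (cs @ zs) A (p0 + i * f))"
proof -
  \<comment> \<open>Bounds the ratio right after the first big digit. Keeping G as the invariant,
    rather than 1, preserves the reserve: G times the next filling times \<open>A powr s\<close>
    regroups into the quantities bounded by \<open>first\<close> and \<open>period\<close>.\<close>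
  define G where "G = run_fac (fill L0) * (16 * real A powr (2 * s - 1))"
  have pw: "real A powr (2 * s - 1) \<le> real A powr s" "1 \<le> real A powr s"
    using A s_le s_gt by (auto intro!: powr_mono ge_one_powr_ge_zero)
  have "G \<le> run_fac (fill L0) * (16 * real A powr s)"
    unfolding G_def using pw run_fac_nonneg by (intro mult_left_mono) auto
  then have G1: "G \<le> 1" using first by linarith
  have G0: "0 \<le> G" unfolding G_def by (intro mult_nonneg_nonneg run_fac_nonneg) auto
  have fac_fill: "run_fac (fill L) \<le> 16 ^ k" for L
  proof -
    have "run_fac (replicate (L div k) Free) \<le> 1" using \<theta>_pos by (simp add: run_fac_replicate power_le_one)
    moreover have "(16::real) ^ (L mod k) \<le> 16 ^ k" using k_pos by (intro power_increasing) (auto simp: less_imp_le)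
    ultimately have "run_fac (replicate (L div k) Free) * 16 ^ (L mod k) \<le> 1 * 16 ^ k"
      by (intro mult_mono) auto
    then show ?thesis by (simp add: fill_def run_fac_replicate)
  qed
  show ?thesis
  proof -
    have "\<exists>zs. zs \<noteq> [] \<and> run_ok 1 (cs @ zs) \<and> run_fac (cs @ zs) \<le> G \<and>
      run_len (cs @ zs) = p0 + Suc j * f \<and> (\<forall>i\<in>{1..Suc j}. big_at (cs @ zs) A (p0 + i * f))"
    proof (induction j)
      case 0
      define zs where "zs = fill L0 @ [Big A]"
      have le: "run_fac cs * run_fac (fill L0) \<le> 1 * run_fac (fill L0)"
        using cs by (intro mult_right_mono run_fac_nonneg) auto
      have "run_fac cs * run_fac (fill L0) * real A powr s \<le> run_fac (fill L0) * (16 * real A powr s)"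
        using le pw run_fac_nonneg[of "fill L0"] by (intro order_trans[OF mult_right_mono[OF le]]) auto
      then have "stage_ok (run_fac cs * run_fac (fill L0)) (Big A)"
        using A first le fac_fill[of L0] by simp
      then have "run_ok 1 (cs @ zs)"
        using cs run_ok_fill[OF run_fac_nonneg cs(2)] by (simp add: zs_def run_ok_append)
      moreover have "run_fac (cs @ zs) \<le> G"
        using mult_right_mono[OF le, of "16 * real A powr (2 * s - 1)"] by (simp add: zs_def G_def mult_ac)
      moreover have "big_at (cs @ zs) A (p0 + f)"
        using big_at_snoc[of "cs @ fill L0" A] pos by (simp add: zs_def)
      ultimately show ?case using pos by (intro exI[of _ zs]) (auto simp: zs_def)
    next
      case (Suc j)
      then obtain zs where zs: "zs \<noteq> []" "run_ok 1 (cs @ zs)" "run_fac (cs @ zs) \<le> G"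
        "run_len (cs @ zs) = p0 + Suc j * f" "\<forall>i\<in>{1..Suc j}. big_at (cs @ zs) A (p0 + i * f)" by blast
      define ys where "ys = fill (f - 1) @ [Big A]"
      have le: "run_fac (cs @ zs) * run_fac (fill (f - 1)) \<le> G * run_fac (fill (f - 1))"
        using zs(3) by (rule mult_right_mono) (rule run_fac_nonneg)
      have le1: "run_fac (cs @ zs) * run_fac (fill (f - 1)) \<le> 16 ^ k"
      proof -
        have "G * run_fac (fill (f - 1)) \<le> 1 * 16 ^ k"
          using G1 G0 fac_fill by (intro mult_mono run_fac_nonneg) auto
        then show ?thesis using le by linarith
      qed
      have "run_fac (cs @ zs) * run_fac (fill (f - 1)) * real A powr s \<le> G * run_fac (fill (f - 1)) * real A powr s"
        by (rule mult_right_mono[OF le]) simp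
      also have "\<dots> = (run_fac (fill L0) * real A powr s) * (run_fac (fill (f - 1)) * (16 * real A powr (2 * s - 1)))"
        by (simp add: G_def mult_ac)
      also have "\<dots> \<le> 1 * 1"
      proof (intro mult_mono period)
        have "1 * (run_fac (fill L0) * real A powr s) \<le> 16 * (run_fac (fill L0) * real A powr s)"
          by (intro mult_right_mono mult_nonneg_nonneg run_fac_nonneg) auto
        then show "run_fac (fill L0) * real A powr s \<le> 1" using first by (simp add: mult_ac)
      qed (auto intro!: mult_nonneg_nonneg run_fac_nonneg)
      finally have "stage_ok (run_fac (cs @ zs) * run_fac (fill (f - 1))) (Big A)"
        using A le1 by simp
      moreover have "run_fac (cs @ zs) \<le> 1" using zs G1 by linarith
      ultimately have "run_ok 1 ((cs @ zs) @ ys)"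
        using zs(2) run_ok_fill[OF run_fac_nonneg, of "cs @ zs" "f - 1"] unfolding ys_def run_ok_append by simp
      moreover have "run_fac ((cs @ zs) @ ys) \<le> G"
      proof -
        have "run_fac (cs @ zs) * (run_fac (fill (f - 1)) * (16 * real A powr (2 * s - 1))) \<le> G * 1"
          using zs(3) period G0 by (intro mult_mono mult_nonneg_nonneg run_fac_nonneg) auto
        then show ?thesis by (simp add: ys_def mult_ac)
      qed
      moreover have len: "run_len ((cs @ zs) @ ys) = p0 + Suc (Suc j) * f"
        using zs(4) f by (simp add: ys_def)
      moreover have "big_at ((cs @ zs) @ ys) A (p0 + i * f)" if "i \<in> {1..Suc (Suc j)}" for i
      proof (cases "i = Suc (Suc j)")
        case True
        have "Suc (run_len ((cs @ zs) @ fill (f - 1))) = p0 + i * f"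
          using zs(4) f True by simp
        then show ?thesis using big_at_snoc[of "(cs @ zs) @ fill (f - 1)" A] by (simp add: ys_def)
      next
        case False
        then have "big_at (cs @ zs) A (p0 + i * f)" using that zs(5) by (simp del: One_nat_def)
        then show ?thesis by (rule big_at_append)
      qed
      ultimately show ?case using zs(1) by (intro exI[of _ "zs @ ys"]) auto
    qed
    then show ?thesis using G1 by (meson order_trans)
  qed
qed

end

section \<open>Runs of stages that satisfy the product condition infinitely often\<close>

locale stages_placed = stages +
  fixes d t :: nat and B b :: real
  assumes d_ge: "1 \<le> d" and B_ge: "1 \<le> B" and b_pos: "0 < b" and b_gt: "ln B < b"
    and \<theta>_gt: "(2 * s - 1) * b < \<theta>"
begin

text \<open>The first \<open>i0\<close> prescribed positions carry ordinary digits, of which only >=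
  1 is known, so the remaining \<open>n - i0\<close> digits of size at least A must reach the bound
  alone.\<close>

definition hit :: "nat \<Rightarrow> stage list \<Rightarrow> bool" where
  "hit n cs \<longleftrightarrow> run_len cs = n * (d * n + t) \<and>
     (\<exists>i0 A. i0 \<le> n \<and> B ^ (d * n\<^sup>2) \<le> real A ^ (n - i0) \<and>
        (\<forall>i\<in>{i0<..n}. big_at cs A (i * (d * n + t))))"

lemma extension_exists:
  assumes cs: "run_ok 1 cs" "run_fac cs \<le> 1"
  shows "\<exists>zs n. zs \<noteq> [] \<and> N \<le> n \<and> run_ok 1 (cs @ zs) \<and> run_fac (cs @ zs) \<le> 1 \<and> hit n (cs @ zs)"
proof -
  define D where "D = 16 ^ k * exp (\<theta> * real k)"
  have D: "0 < D" by (simp add: D_def)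
  obtain i0 :: nat where i0: "s * b / \<theta> < real i0" using reals_Archimedean2 by blast
  then have i0_gt: "s * b < real i0 * \<theta>" using \<theta>_pos by (simp add: field_simps)
  define P where "P = run_len cs"
  define \<eta>1 \<eta>2 where "\<eta>1 = \<theta> - (2 * s - 1) * b" and "\<eta>2 = real (Suc i0) * \<theta> - s * b"
  have \<eta>: "0 < \<eta>1" "0 < \<eta>2" using \<theta>_gt i0_gt \<theta>_pos by (auto simp: \<eta>1_def \<eta>2_def algebra_simps)
  \<comment> \<open>32 is the 16 of a big stage times 2 for rounding A up, and D is the overhead of
    \<open>fill\<close>. \<eta>1 and \<eta>2 are the margins of a full period and of the
    \<open>i0 + 1\<close> blocks before the first big digit; the length P already used is a constant
    that large n absorbs.\<close>
  have "eventually (\<lambda>n. 32 * D * exp \<theta> * exp (- \<eta>1 * real n) < 1) sequentially"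
    by (rule order_tendstoD[of _ 0], use \<eta> in real_asymp) simp
  moreover have "eventually (\<lambda>n. 32 * D * exp (\<theta> * (real P + 1)) * exp (- \<eta>2 * real n) < 1) sequentially"
    by (rule order_tendstoD[of _ 0], use \<eta> in real_asymp) simp
  moreover have "eventually (\<lambda>n. real n * ln B < b * (real n - real i0)) sequentially"
    using b_gt b_pos by real_asymp
  moreover have "eventually (\<lambda>n. real 2 < exp (b * real n)) sequentially"
    using b_pos by real_asymp
  ultimately have "eventually (\<lambda>n. 32 * D * exp \<theta> * exp (- \<eta>1 * real n) < 1 \<and>
      32 * D * exp (\<theta> * (real P + 1)) * exp (- \<eta>2 * real n) < 1 \<and>
      real n * ln B < b * (real n - real i0) \<and> 2 < exp (b * real n) \<and>
      N + P + i0 + 1 \<le> n) sequentially"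
    using eventually_ge_at_top[of "N + P + i0 + 1"] by eventually_elim simp
  then obtain n where n: "32 * D * exp \<theta> * exp (- \<eta>1 * real n) < 1"
      "32 * D * exp (\<theta> * (real P + 1)) * exp (- \<eta>2 * real n) < 1"
      "real n * ln B < b * (real n - real i0)" "2 < exp (b * real n)" "N + P + i0 + 1 \<le> n"
    using eventually_happens'[OF sequentially_bot] by blast
  define f where "f = d * n + t"
  have "1 * n \<le> d * n" using d_ge by (intro mult_le_mono1) simp
  then have fn: "n \<le> f" unfolding f_def by linarith
  have f_pos: "0 < f" using fn n by linarith
  define A where "A = nat \<lceil>exp (b * real f)\<rceil>"
  have A_ge: "exp (b * real f) \<le> real A" unfolding A_def by (rule real_nat_ceiling_ge)
  have e1: "1 \<le> exp (b * real f)" using b_pos by simp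
  have "real A \<le> exp (b * real f) + 1" unfolding A_def using e1 by linarith
  then have A_le: "real A \<le> 2 * exp (b * real f)" using e1 by linarith
  have "exp (b * real n) \<le> exp (b * real f)" using fn b_pos by simp
  then have A2: "2 \<le> A" using n(4) A_ge by linarith
  have A_powr: "real A powr c \<le> 2 * exp (c * b * real f)" if "0 \<le> c" "c \<le> 1" for c
  proof -
    have "real A powr c \<le> (2 * exp (b * real f)) powr c" using A_le that by (intro powr_mono2) auto
    also have "\<dots> = 2 powr c * exp (b * real f) powr c" by (rule powr_mult)
    also have "exp (b * real f) powr c = exp (c * b * real f)" by (simp add: powr_def mult_ac)
    also have "2 powr c * exp (c * b * real f) \<le> 2 powr 1 * exp (c * b * real f)"
      using that by (intro mult_right_mono powr_mono) auto
    finally show ?thesis by simp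
  qed
  define L0 where "L0 = Suc i0 * f - 1 - P"
  have "1 * f \<le> Suc i0 * f" by (intro mult_le_mono1) simp
  then have L0: "P + L0 + 1 = i0 * f + f" using fn n by (simp add: L0_def)
  have period: "run_fac (fill (f - 1)) * (16 * real A powr (2 * s - 1)) \<le> 1"
  proof -
    have "run_fac (fill (f - 1)) * (16 * real A powr (2 * s - 1)) \<le>
        (D * exp (- \<theta> * real (f - 1))) * (16 * (2 * exp ((2 * s - 1) * b * real f)))"
      using run_fac_fill_le[of "f - 1"] A_powr[of "2 * s - 1"] s_gt s_le D
      by (intro mult_mono) (auto simp: D_def)
    also have "\<dots> = 32 * D * (exp (- \<theta> * real (f - 1)) * exp ((2 * s - 1) * b * real f))" by simp
    also have "exp (- \<theta> * real (f - 1)) * exp ((2 * s - 1) * b * real f) = exp \<theta> * exp (- \<eta>1 * real f)"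
      unfolding exp_add[symmetric] using f_pos by (simp add: \<eta>1_def of_nat_diff algebra_simps)
    also have "32 * D * (exp \<theta> * exp (- \<eta>1 * real f)) \<le> 32 * D * (exp \<theta> * exp (- \<eta>1 * real n))"
      using D fn \<eta> by (intro mult_left_mono) auto
    also have "\<dots> < 1" using n(1) by (simp only: mult.assoc)
    finally show ?thesis by (rule less_imp_le)
  qed
  have first: "run_fac (fill L0) * (16 * real A powr s) \<le> 1"
  proof -
    have "run_fac (fill L0) * (16 * real A powr s) \<le> (D * exp (- \<theta> * real L0)) * (16 * (2 * exp (s * b * real f)))"
      using run_fac_fill_le[of L0] A_powr[of s] s_gt s_le D by (intro mult_mono) (auto simp: D_def)
    also have "\<dots> = 32 * D * (exp (- \<theta> * real L0) * exp (s * b * real f))" by simp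
    also have "exp (- \<theta> * real L0) * exp (s * b * real f) = exp (\<theta> * (real P + 1)) * exp (- \<eta>2 * real f)"
    proof -
      have "real (P + L0 + 1) = real (i0 * f + f)" using L0 by (simp only:)
      then have L0_real: "real L0 = real i0 * real f + real f - 1 - real P" by simp
      show ?thesis unfolding exp_add[symmetric] \<eta>2_def L0_real by (simp add: algebra_simps)
    qed
    also have "32 * D * (exp (\<theta> * (real P + 1)) * exp (- \<eta>2 * real f)) \<le>
        32 * D * (exp (\<theta> * (real P + 1)) * exp (- \<eta>2 * real n))"
      using D fn \<eta> by (intro mult_left_mono) auto
    also have "\<dots> < 1" using n(2) by (simp only: mult.assoc)
    finally show ?thesis by (rule less_imp_le)
  qed
  have big: "B ^ (d * n\<^sup>2) \<le> real A ^ (n - i0)"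
  proof -
    have "real (d * n\<^sup>2) * ln B = real (d * n) * (real n * ln B)" by (simp add: power2_eq_square)
    also have "\<dots> \<le> real (d * n) * (b * (real n - real i0))" using n(3) by (intro mult_left_mono) auto
    also have "\<dots> \<le> real f * (b * (real n - real i0))"
      using n(5) b_pos by (intro mult_right_mono) (auto simp: f_def)
    also have "\<dots> = real (n - i0) * (b * real f)" using n(5) by (simp add: of_nat_diff)
    finally have "exp (real (d * n\<^sup>2) * ln B) \<le> exp (real (n - i0) * (b * real f))" by simp
    moreover have "exp (real (d * n\<^sup>2) * ln B) = B ^ (d * n\<^sup>2)" using B_ge by (simp add: exp_of_nat_mult del: of_nat_mult of_nat_power)
    moreover have "exp (real (n - i0) * (b * real f)) = exp (b * real f) ^ (n - i0)" by (rule exp_of_nat_mult)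
    moreover have "exp (b * real f) ^ (n - i0) \<le> real A ^ (n - i0)" using A_ge by (intro power_mono) auto
    ultimately show ?thesis by linarith
  qed
  obtain zs where zs: "zs \<noteq> []" "run_ok 1 (cs @ zs)" "run_fac (cs @ zs) \<le> 1"
      "run_len (cs @ zs) = i0 * f + Suc (n - i0 - 1) * f"
      "\<forall>i\<in>{1..Suc (n - i0 - 1)}. big_at (cs @ zs) A (i0 * f + i * f)"
    using periodic_extension[OF f_pos A2 cs, of L0 "i0 * f" "n - i0 - 1"] L0 first period unfolding P_def by blast
  have len: "Suc (n - i0 - 1) = n - i0" "i0 + (n - i0) = n" using n(5) by auto
  have "run_len (cs @ zs) = n * f" using zs(4) unfolding len(1) add_mult_distrib[symmetric] len(2) .
  moreover have "\<forall>i\<in>{i0<..n}. big_at (cs @ zs) A (i * f)"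
  proof
    fix i assume i: "i \<in> {i0<..n}"
    then have "i - i0 \<in> {1..Suc (n - i0 - 1)}" "i0 + (i - i0) = i" using len by auto
    then show "big_at (cs @ zs) A (i * f)" using zs(5) by (metis add_mult_distrib)
  qed
  moreover have "i0 \<le> n" using n(5) by simp
  ultimately have "hit n (cs @ zs)" unfolding hit_def f_def[symmetric] using big by blast
  then show ?thesis using zs n(5) by (intro exI[of _ zs] exI[of _ n]) auto
qed

text \<open>Repeated extension yields runs that are proper prefixes of one another, so \<sigma> is
  read off the diagonal \<open>c (Suc i) ! i\<close>; the condition j <= n makes the values of n hit
  unbounded.\<close>

lemma stage_sequence_exists:
  "\<exists>\<sigma>. (\<forall>i. stage_ok (\<Prod>j<i. stage_fac (\<sigma> j)) (\<sigma> i)) \<and> (\<exists>\<^sub>\<infinity>n. \<exists>m. hit n (map \<sigma> [0..<m]))"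
proof -
  have "\<exists>c. \<forall>j. (run_ok 1 (c j) \<and> run_fac (c j) \<le> 1) \<and>
      (\<exists>zs n. c (Suc j) = c j @ zs \<and> zs \<noteq> [] \<and> j \<le> n \<and> hit n (c (Suc j)))"
  proof (rule dependent_nat_choice)
    show "\<exists>cs. run_ok 1 cs \<and> run_fac cs \<le> 1" by (intro exI[of _ "[]"]) simp
    fix cs j assume "run_ok 1 cs \<and> run_fac cs \<le> 1"
    then obtain zs n where "zs \<noteq> []" "j \<le> n" "run_ok 1 (cs @ zs)" "run_fac (cs @ zs) \<le> 1" "hit n (cs @ zs)"
      using extension_exists by blast
    then show "\<exists>cs'. (run_ok 1 cs' \<and> run_fac cs' \<le> 1) \<and> (\<exists>zs n. cs' = cs @ zs \<and> zs \<noteq> [] \<and> j \<le> n \<and> hit n cs')"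
      by blast
  qed
  then obtain c where ok: "\<And>j. run_ok 1 (c j)"
    and ext: "\<And>j. \<exists>zs n. c (Suc j) = c j @ zs \<and> zs \<noteq> [] \<and> j \<le> n \<and> hit n (c (Suc j))" by blast
  define \<sigma> where "\<sigma> i = c (Suc i) ! i" for i
  have len: "j \<le> length (c j)" for j
  proof (induction j)
    case (Suc j)
    obtain zs where "c (Suc j) = c j @ zs" "zs \<noteq> []" using ext by blast
    then show ?case using Suc by (cases zs) auto
  qed simp
  have pre: "\<exists>zs. c (i + j) = c i @ zs" for i j
  proof (induction j)
    case (Suc j)
    then obtain zs where "c (i + j) = c i @ zs" by blast
    moreover obtain ys where "c (Suc (i + j)) = c (i + j) @ ys" using ext by blast
    ultimately show ?case by simp
  qed simp
  have nth: "c j ! i = \<sigma> i" if "i < length (c j)" for i j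
  proof (cases "j \<le> Suc i")
    case True
    then obtain zs where "c (Suc i) = c j @ zs" using pre[of j "Suc i - j"] by auto
    then show ?thesis using that by (simp add: \<sigma>_def nth_append)
  next
    case False
    then obtain zs where "c j = c (Suc i) @ zs" using pre[of "Suc i" "j - Suc i"] by auto
    moreover have "i < length (c (Suc i))" using len[of "Suc i"] by simp
    ultimately show ?thesis by (simp add: \<sigma>_def nth_append)
  qed
  have c_eq: "c j = map \<sigma> [0..<length (c j)]" for j
    by (rule nth_equalityI) (use nth in auto)
  have "stage_ok (\<Prod>j<i. stage_fac (\<sigma> j)) (\<sigma> i)" for i
  proof -
    have "Suc i \<le> length (c (Suc i))" by (rule len)
    then have "i < length (c (Suc i))" by simp
    then have "c (Suc i) = map \<sigma> [0..<i] @ \<sigma> i # map \<sigma> [Suc i..<length (c (Suc i))]"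
      using c_eq[of "Suc i"] map_upt_split by metis
    then have "run_ok 1 (map \<sigma> [0..<i] @ \<sigma> i # map \<sigma> [Suc i..<length (c (Suc i))])"
      by (rule subst[where P = "run_ok 1"]) (rule ok)
    then have "stage_ok (run_fac (map \<sigma> [0..<i])) (\<sigma> i)" by (simp add: run_ok_append)
    then show ?thesis
      by (simp add: run_fac_map_upt)
  qed
  moreover have "\<exists>\<^sub>\<infinity>n. \<exists>m. hit n (map \<sigma> [0..<m])"
    unfolding INFM_nat_le using ext c_eq by metis
  ultimately show ?thesis by blast
qed

lemma hit_imp_large_product:
  assumes ok: "\<And>i. stage_ok (\<Prod>j<i. stage_fac (\<sigma> j)) (\<sigma> i)"
    and \<omega>: "\<And>i. \<omega> i \<in> stage_words (\<sigma> i)"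
    and y: "\<And>i. 0 < y i \<and> y i < 1 \<and> y i = cf_eval (\<omega> i) (y (Suc i))"
    and hit: "hit n (map \<sigma> [0..<m])"
  shows "B ^ (d * n\<^sup>2) \<le> (\<Prod>i=1..n. real_of_int (partial_quotient (i * (d * n + t)) (y 0)))"
proof -
  define f where "f = d * n + t"
  define w where "w l = concat (map \<omega> [0..<l])" for l
  have w_Suc: "w (Suc l) = w l @ \<omega> l" for l by (simp add: w_def)
  have w_pos: "\<forall>a\<in>set (w l). 1 \<le> a" for l
    using stage_words_props(3)[OF ok \<omega>] by (auto simp: w_def)
  have w_len: "length (w l) = run_len (map \<sigma> [0..<l])" for l
    using stage_words_props(1)[OF ok \<omega>] by (induction l) (auto simp: w_def)
  have y0: "y 0 = cf_eval (w l) (y l)" for l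
  proof (induction l)
    case (Suc l)
    have "cf_eval (w (Suc l)) (y (Suc l)) = cf_eval (w l) (cf_eval (\<omega> l) (y (Suc l)))"
      by (simp only: w_Suc cf_eval_append)
    also have "\<dots> = cf_eval (w l) (y l)" using y[of l] by metis
    finally show ?case using Suc by simp
  qed (simp add: w_def)
  obtain i0 A where len: "run_len (map \<sigma> [0..<m]) = n * f" and i0: "i0 \<le> n"
    and big: "B ^ (d * n\<^sup>2) \<le> real A ^ (n - i0)" and at: "\<And>i. i \<in> {i0<..n} \<Longrightarrow> big_at (map \<sigma> [0..<m]) A (i * f)"
    using hit unfolding hit_def f_def[symmetric] by blast
  have pq: "partial_quotient j (y 0) = int (w m ! (j - 1))" if "1 \<le> j" "j \<le> n * f" for j
    unfolding y0[of m] using y[of m] w_pos that len w_len by (intro partial_quotient_cf_eval) auto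
  have lower: "(if i0 < i then real A else 1) \<le> real_of_int (partial_quotient (i * f) (y 0))" if i: "i \<in> {1..n}" for i
  proof -
    have "1 * 1 \<le> d * n" using d_ge i by (intro mult_le_mono) auto
    then have "1 \<le> f" unfolding f_def by linarith
    have "1 * 1 \<le> i * f" using i \<open>1 \<le> f\<close> by (intro mult_le_mono) auto
    then have if1: "1 \<le> i * f" by simp
    have if2: "i * f \<le> n * f" using i by (intro mult_le_mono1) simp
    have idx: "i * f - 1 < length (w m)" using if1 if2 unfolding w_len len by linarith
    show ?thesis
    proof (cases "i0 < i")
      case True
      then obtain xs ys where xs: "map \<sigma> [0..<m] = xs @ Big A # ys" "Suc (run_len xs) = i * f"
        using at[of i] i unfolding big_at_def by auto
      define p where "p = length xs"
      have "length (map \<sigma> [0..<m]) = length (xs @ Big A # ys)" by (simp only: xs(1))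
      then have pm: "p < m" by (simp add: p_def)
      have "xs = map \<sigma> [0..<p]" and p: "\<sigma> p = Big A"
        using xs(1) unfolding map_upt_split[OF pm, of \<sigma>] by (auto simp: p_def append_eq_append_conv)
      then have "length (w p) = i * f - 1" using xs(2) w_len by simp
      moreover obtain a where a: "\<omega> p = [a]" "A \<le> a" using \<omega>[of p] p by auto
      moreover have "w m = w p @ \<omega> p @ concat (map \<omega> [Suc p..<m])" by (simp add: w_def map_upt_split[OF pm])
      ultimately have "w m ! (i * f - 1) = a" by (simp add: nth_append)
      then show ?thesis using True a pq[OF if1 if2] by simp
    next
      case False
      have "1 \<le> w m ! (i * f - 1)" using w_pos idx nth_mem by blast
      then show ?thesis using False pq[OF if1 if2] by simp
    qed
  qed
  have "real A ^ (n - i0) = (\<Prod>i=1..n. if i0 < i then real A else 1)"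
  proof -
    have "(\<Prod>i=1..n. if i0 < i then real A else 1) = (\<Prod>i\<in>{i0<..n}. real A)"
      by (intro prod.mono_neutral_cong_right) auto
    then show ?thesis by simp
  qed
  also have "\<dots> \<le> (\<Prod>i=1..n. real_of_int (partial_quotient (i * f) (y 0)))"
    using lower by (intro prod_mono) auto
  finally show ?thesis using big by (simp add: f_def)
qed

end


section \<open>The lower bound\<close>

lemma finite_words_exist:
  assumes s: "1 / 2 < s" "s \<le> 1" and \<theta>: "0 < \<theta>" "\<theta> < geom_pressure s"
  shows "\<exists>F k. stages F k s \<theta>"
proof -
  obtain \<theta>' where \<theta>': "\<theta> < \<theta>'" "\<theta>' < geom_pressure s" using dense[OF \<theta>(2)] by blast
  have "eventually (\<lambda>n. \<theta>' < log_part s n / real n) sequentially"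
    using geom_pressure_LIMSEQ[OF s(1)] \<theta>' by (intro order_tendstoD)
  \<comment> \<open>64 = 4 * 16: the 4 required by \<open>F_sum\<close> and the 16 lost by appending
    the digit 2; exp \<theta> accounts for the additional position.\<close>
  moreover have "eventually (\<lambda>n. 64 * exp \<theta> * exp (\<theta> * real n) < exp (\<theta>' * real n)) sequentially"
    using \<theta>' \<theta> by real_asymp
  ultimately have "eventually (\<lambda>n. \<theta>' < log_part s n / real n \<and>
      64 * exp \<theta> * exp (\<theta> * real n) < exp (\<theta>' * real n) \<and> 0 < n) sequentially"
    using eventually_gt_at_top[of 0] by eventually_elim simp
  then obtain n where n: "\<theta>' < log_part s n / real n"
      "64 * exp \<theta> * exp (\<theta> * real n) < exp (\<theta>' * real n)" "0 < n"
    using eventually_happens'[OF sequentially_bot] by blast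
  have "\<theta>' * real n < log_part s n" using n by (simp add: field_simps)
  then have "ennreal (exp (\<theta>' * real n)) < part_fun s n"
    using s by (simp add: part_fun_eq_exp ennreal_less_iff)
  also have "part_fun s n = (SUP H\<in>{H. finite H \<and> H \<subseteq> words n}. \<Sum>w\<in>H. ennreal (cont w powr (-2 * s)))"
    unfolding part_fun_def by (subst infsum_eq_nn_integral[symmetric]) (auto simp: nonneg_infsum_complete)
  finally obtain H where H: "finite H" "H \<subseteq> words n"
      "ennreal (exp (\<theta>' * real n)) < (\<Sum>w\<in>H. ennreal (cont w powr (-2 * s)))"
    by (auto simp: less_SUP_iff)
  then have H_sum: "exp (\<theta>' * real n) < (\<Sum>w\<in>H. cont w powr (-2 * s))"
    by (simp add: sum_ennreal ennreal_less_iff)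
  define F where "F = (\<lambda>w. w @ [2]) ` H"
  have inj: "inj_on (\<lambda>w. w @ [2]) H" by (simp add: inj_on_def)
  have "stages F (Suc n) s \<theta>"
  proof
    show "finite F" using H by (simp add: F_def)
    show "F \<noteq> {}" using H_sum by (auto simp: F_def)
    show "w \<in> words (Suc n) \<and> last w = 2" if "w \<in> F" for w
      using that H(2) by (fastforce simp: F_def words_def)
    have "(\<Sum>w\<in>H. cont w powr (-2 * s)) / 16 \<le> (\<Sum>w\<in>H. cont (w @ [2]) powr (-2 * s))"
      unfolding sum_divide_distrib
    proof (rule sum_mono)
      fix w assume "w \<in> H"
      then have w: "\<forall>a\<in>set w. 1 \<le> a" using H by (auto simp: words_def)
      have "(1 / 16 :: real) = 4 powr (- 2)" by (simp add: powr_minus)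
      also have "\<dots> \<le> 4 powr (-2 * s)" using s by (intro powr_mono) auto
      finally have "cont w powr (-2 * s) / 16 \<le> 4 powr (-2 * s) * cont w powr (-2 * s)"
        using mult_right_mono[of "1 / 16" "4 powr (-2 * s)" "cont w powr (-2 * s)"] by simp
      also have "\<dots> = (4 * cont w) powr (-2 * s)" by (rule powr_mult[symmetric])
      also have "\<dots> \<le> cont (w @ [2]) powr (-2 * s)"
        using cont_append_le[of w "[2]"] cont_pos[of "w @ [2]"] w s by (intro powr_mono2') auto
      finally show "cont w powr (-2 * s) / 16 \<le> cont (w @ [2]) powr (-2 * s)" .
    qed
    also have "\<dots> = (\<Sum>w\<in>F. cont w powr (-2 * s))" unfolding F_def by (simp add: sum.reindex[OF inj])
    finally have "4 * exp (\<theta> + \<theta> * real n) \<le> (\<Sum>w\<in>F. cont w powr (-2 * s))"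
      using H_sum n(2) unfolding exp_add by linarith
    then have "exp (- (\<theta> + \<theta> * real n)) * (4 * exp (\<theta> + \<theta> * real n)) \<le>
        exp (- (\<theta> + \<theta> * real n)) * (\<Sum>w\<in>F. cont w powr (-2 * s))" by (intro mult_left_mono) auto
    moreover have "exp (- (\<theta> + \<theta> * real n)) * (4 * exp (\<theta> + \<theta> * real n)) = 4"
    proof -
      have "exp (- X) * (4 * exp X) = 4" for X :: real by (simp add: exp_minus)
      then show ?thesis .
    qed
    moreover have "- (\<theta> + \<theta> * real n) = - \<theta> * real (Suc n)" by (simp add: algebra_simps)
    ultimately show "4 \<le> exp (- \<theta> * real (Suc n)) * (\<Sum>w\<in>F. cont w powr (-2 * s))" by (simp only:)
  qed (use s \<theta> in auto)
  then show ?thesis by blast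
qed

lemma hausdorff_measure_large_product_set_nonzero:
  assumes "1 \<le> d" "1 \<le> B" and s: "1 / 2 < s" "s \<le> 1" and P: "(2 * s - 1) * ln B < geom_pressure s"
    and s0: "0 \<le> s0" "s0 \<le> s"
  shows "hausdorff_measure s0 (large_product_set d t B) \<noteq> 0"
proof -
  define r where "r = 2 * s - 1"
  have "0 < r" using s by (simp add: r_def)
  have "ln B < geom_pressure s / r" using P \<open>0 < r\<close> by (simp add: r_def field_simps)
  \<comment> \<open>The strict pressure inequality is split into two gaps: b above ln B, and
    \<theta> between \<open>r * b\<close> and the pressure.\<close>
  then obtain b where b: "ln B < b" "b < geom_pressure s / r" using dense by blast
  have "0 < b" using b(1) ln_ge_zero[OF assms(2)] by linarith
  have "r * b < geom_pressure s" using b(2) \<open>0 < r\<close> by (simp add: field_simps)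
  then obtain \<theta> where \<theta>: "r * b < \<theta>" "\<theta> < geom_pressure s" using dense by blast
  have "0 < r * b" using \<open>0 < r\<close> \<open>0 < b\<close> by simp
  then have "0 < \<theta>" using \<theta> by linarith
  then obtain F k where "stages F k s \<theta>" using finite_words_exist[OF s _ \<theta>(2)] by blast
  then interpret stages_placed F k s \<theta> d t B b
    using assms \<open>0 < b\<close> b \<theta> by (simp add: stages_placed_def stages_placed_axioms_def r_def)
  obtain \<sigma> where \<sigma>: "\<And>i. stage_ok (\<Prod>j<i. stage_fac (\<sigma> j)) (\<sigma> i)"
    "\<exists>\<^sub>\<infinity>n. \<exists>m. hit n (map \<sigma> [0..<m])"
    using stage_sequence_exists by blast
  obtain \<delta> C where "cantor_scheme (\<lambda>i. stage_words (\<sigma> i)) (\<lambda>i. stage_wt (\<sigma> i)) s \<delta> C (\<lambda>i. \<Prod>j<i. stage_fac (\<sigma> j))"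
    using cantor_scheme_exists[OF \<sigma>(1)] by blast
  then interpret scheme: cantor_scheme "\<lambda>i. stage_words (\<sigma> i)" "\<lambda>i. stage_wt (\<sigma> i)" s \<delta> C
    "\<lambda>i. \<Prod>j<i. stage_fac (\<sigma> j)" .
  show ?thesis
  proof (rule scheme.hausdorff_measure_nonzero[OF _ s0])
    fix \<omega> y
    assume \<omega>: "\<And>i. \<omega> i \<in> stage_words (\<sigma> i)"
      and y: "\<And>i::nat. 0 < y i \<and> y i < 1 \<and> y i = cf_eval (\<omega> i) (y (Suc i))"
    have "\<exists>\<^sub>\<infinity>n. B ^ (d * n\<^sup>2) \<le> (\<Prod>i=1..n. real_of_int (partial_quotient (i * (d * n + t)) (y 0)))"
      using \<sigma>(2)
    proof (rule INFM_mono)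
      fix n assume "\<exists>m. hit n (map \<sigma> [0..<m])"
      then obtain m where "hit n (map \<sigma> [0..<m])" ..
      from hit_imp_large_product[OF \<sigma>(1) \<omega> y this]
      show "B ^ (d * n\<^sup>2) \<le> (\<Prod>i=1..n. real_of_int (partial_quotient (i * (d * n + t)) (y 0)))" .
    qed
    moreover have "0 \<le> y 0" "y 0 < 1" using y[of 0] by linarith+
    ultimately show "y 0 \<in> large_product_set d t B" by (simp add: large_product_set_def)
  qed
qed

text \<open>The harmonic series diverges and its partial sums are continuous in the exponent, so
  \<open>part_fun s 1\<close> exceeds 4 B near s = 1/2; the 4 offsets \<open>s * ln 4\<close> in
  \<open>geom_pressure_ge\<close>. The construction works for s > 1/2, and this excludes dimensions
  below 1/2.\<close>

lemma geom_pressure_large_near_half: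
  assumes "1 \<le> B"
  shows "\<exists>s. 1 / 2 < s \<and> s \<le> 1 \<and> (2 * s - 1) * ln B < geom_pressure s"
proof -
  define h where "h N z = (\<Sum>n<N. real (Suc n) powr (- z))" for N z
  have "(\<Sum>n. ennreal (real (Suc n) powr (- 1))) = top"
    using zeta_finite_iff[of 1] by (simp add: less_top[symmetric])
  then have "(SUP N. \<Sum>n<N. ennreal (real (Suc n) powr (- 1))) = top" by (simp add: suminf_eq_SUP)
  then obtain N where "ennreal (4 * B) < (\<Sum>n<N. ennreal (real (Suc n) powr (- 1)))"
    using less_SUP_iff[of "ennreal (4 * B)"] by (metis UNIV_I ennreal_less_top)
  then have N: "4 * B < h N 1" using assms by (simp add: h_def sum_ennreal ennreal_less_iff)
  have "isCont (h N) 1" unfolding h_def by (intro continuous_intros) auto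
  then have "(h N \<longlongrightarrow> h N 1) (at_right 1)" by (simp add: isCont_def filterlim_at_split)
  then have "eventually (\<lambda>z. 4 * B < h N z) (at_right 1)" using N by (rule order_tendstoD)
  moreover have "eventually (\<lambda>z. z \<in> {1<..<2}) (at_right (1::real))" by (rule eventually_at_right_real) simp
  ultimately have "eventually (\<lambda>z. 4 * B < h N z \<and> z \<in> {1<..<2}) (at_right 1)" by (rule eventually_conj)
  then obtain z where z: "4 * B < h N z" "1 < z" "z < 2"
    using eventually_happens'[OF trivial_limit_at_right_real] by auto
  define s where "s = z / 2"
  have s: "1 / 2 < s" "s \<le> 1" using z by (auto simp: s_def)
  have "ennreal (h N z) = (\<Sum>n<N. ennreal (real (Suc n) powr (- z)))" by (simp add: h_def sum_ennreal)
  also have "\<dots> \<le> (\<Sum>n. ennreal (real (Suc n) powr (- z)))" by (rule sum_le_suminf) auto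
  also have "\<dots> = part_fun s 1" unfolding part_fun_1 by (simp add: s_def)
  finally have "h N z \<le> exp (log_part s 1)" using s by (simp add: part_fun_eq_exp ennreal_le_iff)
  then have "ln (4 * B) < log_part s 1"
    using z assms by (metis less_le_trans ln_exp ln_less_cancel_iff exp_gt_zero mult_pos_pos zero_less_numeral zero_less_one)
  moreover have "s * ln 4 \<le> ln 4" using s by simp
  moreover have "(2 * s - 1) * ln B \<le> 1 * ln B" using s assms by (intro mult_right_mono) auto
  moreover have "ln (4 * B) = ln 4 + ln B" using assms by (simp add: ln_mult)
  ultimately have "(2 * s - 1) * ln B < geom_pressure s" using geom_pressure_ge[OF s(1)] by linarith
  then show ?thesis using s by blast
qed

theorem theorem1p4:
  fixes d t :: nat and B :: real
  assumes "d \<ge> 1" and "B \<ge> 1"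
  shows "hausdorff_dim (large_product_set d t B) =
    (INF s \<in> {s :: real. 0 \<le> s \<and>
        pressure (\<lambda>x. - s * ln \<bar>deriv gauss_map x\<bar> - (2 * s - 1) * ln B) \<le> 0}. ereal s)"
proof -
  define S where "S = {s :: real. 0 \<le> s \<and> pressure (dim_potential s B) \<le> 0}"
  have S_iff: "s \<in> S \<longleftrightarrow> 1 / 2 < s \<and> geom_pressure s \<le> (2 * s - 1) * ln B" for s
  proof (cases "1 / 2 < s")
    case True
    then have "pressure (dim_potential s B) = ereal (geom_pressure s - (2 * s - 1) * ln B)"
      using assms by (intro pressure_eq) auto
    then show ?thesis using True by (simp add: S_def)
  next
    case False
    then show ?thesis using assms pressure_eq_infinity[of s B] by (auto simp: S_def)
  qed
  have "0 \<le> ln B" using assms by simp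
  then have one: "1 \<in> S" using geom_pressure_one_le by (simp add: S_iff)
  have "hausdorff_dim (large_product_set d t B) = (INF s\<in>S. ereal s)"
  proof (rule antisym)
    show "hausdorff_dim (large_product_set d t B) \<le> (INF s\<in>S. ereal s)"
    proof (rule INF_greatest)
      fix s assume s: "s \<in> S"
      show "hausdorff_dim (large_product_set d t B) \<le> ereal s"
      proof (rule ereal_le_epsilon2)
        fix e :: real assume "0 < e"
        then have "hausdorff_measure (s + e) (large_product_set d t B) = 0"
          using s assms by (intro hausdorff_measure_large_product_set) (auto simp: S_iff)
        then have "hausdorff_dim (large_product_set d t B) \<le> ereal (s + e)"
          unfolding hausdorff_dim_def using s \<open>0 < e\<close> by (intro INF_lower) (auto simp: S_iff)
        then show "hausdorff_dim (large_product_set d t B) \<le> ereal s + ereal e" by simp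
      qed
    qed
    show "(INF s\<in>S. ereal s) \<le> hausdorff_dim (large_product_set d t B)"
      unfolding hausdorff_dim_def
    proof (rule INF_greatest)
      fix s0 assume "s0 \<in> {s. 0 \<le> s \<and> hausdorff_measure s (large_product_set d t B) = 0}"
      then have s0: "0 \<le> s0" "hausdorff_measure s0 (large_product_set d t B) = 0" by auto
      \<comment> \<open>By \<open>S_iff\<close>, lying outside S is for such s exactly the strict
        inequality on which the lower bound rests.\<close>
      have no: False if "1 / 2 < s" "s \<le> 1" "s \<notin> S" "s0 \<le> s" for s
        using hausdorff_measure_large_product_set_nonzero[of d B s s0 t] that assms s0
        by (auto simp: S_iff not_le)
      show "(INF s\<in>S. ereal s) \<le> ereal s0"
      proof (rule ccontr)
        assume "\<not> ?thesis"
        then have lt: "ereal s0 < (INF s\<in>S. ereal s)" by simp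
        show False
        proof (cases "s0 < 1 / 2")
          case True
          obtain s where "1 / 2 < s" "s \<le> 1" "(2 * s - 1) * ln B < geom_pressure s"
            using geom_pressure_large_near_half assms by blast
          then show False using True by (intro no[of s]) (auto simp: S_iff)
        next
          case False
          \<comment> \<open>Such an s lies outside S, and 1 being in S keeps it below 1.\<close>
          obtain s where s: "ereal s0 < ereal s" "ereal s < (INF s\<in>S. ereal s)"
            using ereal_dense2[OF lt] by blast
          have "s \<notin> S" using s(2) INF_lower[of s S ereal] by auto
          moreover have "ereal s < ereal 1" using s(2) INF_lower[OF one, of ereal] by (rule less_le_trans)
          ultimately show False using False s(1) by (intro no[of s]) auto
        qed
      qed
    qed
  qed
  then show ?thesis by (simp add: S_def)
qed

end
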